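(* For $\vec{x}=(a,b,c,d,e,f,g)^T\in V$, $$A(1+a-e,1+b-e,1+c-e,1+d-e)\,A(1-a,e-a,f-a,g-a)\,B_4(\vec{x})\,K_{p_0}(\vec{x})$$ $$-\,S(e-a)\,A(f-a,f-b,f-c,f-d)\,A(g-a,g-b,g-c,g-d)\,A(a,b,c,d)\,A(a,1+a-e,1+a-f,1+a-g)\,K_{n_0}(\vec{x})-C(\vec{x})\,L_6(\vec{x})=0.$$
   Context: $V=\{(a,b,c,d,e,f,g)^T\in\mathbb{C}^7: e+f+g-a-b-c-d=1\}$. ${}_4F_3\left[\begin{smallmatrix}a,b,c,d\\ e,f,g\end{smallmatrix};1\right]=\sum_{n\ge0}\frac{(a)_n(b)_n(c)_n(d)_n}{n!(e)_n(f)_n(g)_n}$, with $(a)_n$ the rising factorial. For $(a,b,c,d,e,f,g)^T\in V$, $$K(a;b,c,d;e,f,g)=\frac{{}_4F_3\left[\begin{smallmatrix}a,b,c,d\\ e,f,g\end{smallmatrix};1\right]}{\sin\pi a\,\Gamma(a)\Gamma(1+a-e)\Gamma(1+a-f)\Gamma(1+a-g)\Gamma(e)\Gamma(f)\Gamma(g)}+\frac{{}_4F_3\left[\begin{smallmatrix}a,1+a-e,1+a-f,1+a-g\\ 1+a-b,1+a-c,1+a-d\end{smallmatrix};1\right]}{\sin\pi a\,\Gamma(a)\Gamma(b)\Gamma(c)\Gamma(d)\Gamma(1+a-b)\Gamma(1+a-c)\Gamma(1+a-d)},$$ $$L(a,b,c,d;e;f,g)=\frac{{}_4F_3\left[\begin{smallmatrix}a,b,c,d\\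 e,f,g\end{smallmatrix};1\right]}{\sin\pi e\,\Gamma(1+a-e)\Gamma(1+b-e)\Gamma(1+c-e)\Gamma(1+d-e)\Gamma(e)\Gamma(f)\Gamma(g)}-\frac{{}_4F_3\left[\begin{smallmatrix}1+a-e,1+b-e,1+c-e,1+d-e\\ 2-e,1+f-e,1+g-e\end{smallmatrix};1\right]}{\sin\pi e\,\Gamma(a)\Gamma(b)\Gamma(c)\Gamma(d)\Gamma(2-e)\Gamma(1+f-e)\Gamma(1+g-e)}.$$ Notation: $S(a_1,\dots,a_n)=\sin\pi a_1\cdots\sin\pi a_n$; $A(x,y,z,w)=\frac{1}{\Gamma(x)\Gamma(y)\Gamma(z)\Gamma(w)}$ (with $1/\Gamma=0$ at nonpositive integers). The relation is asserted for those $\vec{x}\in V$ at which the $K$ and $L$ functions occurring are defined (no lower parameter of an occurring series is a nonpositive integer, no sine in an occurring denominator vanishes). Here $K_{p_0}(\vec{x})=K(a;b,c,d;e,f,g)$, $K_{n_0}(\vec{x})=K(1-a;1-b,1-c,1-d;2-e,2-f,2-g)$, $L_6(\vec{x})=L(a,b,c,d;e;f,g)$, and $B_2(\vec{x})=\pi^{-4}S(f-a,g-a)\,[S(b-a,c-a,d-a)+S(e-2a,f-a,g-a)]$, $B_4(\vec{x})=\pi^{-4}S(f-a,g-a)\,[S(b,c,d)+S(e-a,f,g)]$, $C(\vec{x})=\pi^{-4}S(e-a)\,[S(b,c,d)B_2(\vec{x})+S(e,f-a,g-a)B_4(\vec{x})]$. *)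

theory Defs
  imports "HOL-Analysis.Analysis"
begin

type_synonym param = "complex \<times> complex \<times> complex \<times> complex \<times> complex \<times> complex \<times> complex"

definition V :: "param set" where
  "V = {(a, b, c, d, e, f, g). e + f + g - a - b - c - d = 1}"

text \<open>
  The series $_4F_3$ at unit argument. In every use below the lower parameters minus the upper
  parameters sum to \<open>1\<close>, so it converges absolutely as soon as no lower parameter is a
  nonpositive integer; outside that domain the value is a junk value.
\<close>

definition F43 ::
  "complex \<Rightarrow> complex \<Rightarrow> complex \<Rightarrow> complex \<Rightarrow> complex \<Rightarrow> complex \<Rightarrow> complex \<Rightarrow> complex" where
  "F43 a b c d e f g =
     (\<Sum>n. pochhammer a n * pochhammer b n * pochhammer c n * pochhammer d n /
           (fact n * pochhammer e n * pochhammer f n * pochhammer g n))"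

definition sin_pi :: "complex \<Rightarrow> complex" where
  "sin_pi z = sin (of_real pi * z)"

definition S :: "complex list \<Rightarrow> complex" where
  "S zs = prod_list (map sin_pi zs)"

text \<open>
  Reciprocal Gamma factors are written with the entire function \<^const>\<open>rGamma\<close>, which vanishes at
  the nonpositive integers.
\<close>

definition A :: "complex \<Rightarrow> complex \<Rightarrow> complex \<Rightarrow> complex \<Rightarrow> complex" where
  "A x y z w = rGamma x * rGamma y * rGamma z * rGamma w"

definition K ::
  "complex \<Rightarrow> complex \<Rightarrow> complex \<Rightarrow> complex \<Rightarrow> complex \<Rightarrow> complex \<Rightarrow> complex \<Rightarrow> complex" where
  "K a b c d e f g =
     F43 a b c d e f g / sin_pi a *
       (rGamma a * rGamma (1 + a - e) * rGamma (1 + a - f) * rGamma (1 + a - g) *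
        rGamma e * rGamma f * rGamma g)
     + F43 a (1 + a - e) (1 + a - f) (1 + a - g) (1 + a - b) (1 + a - c) (1 + a - d) / sin_pi a *
       (rGamma a * rGamma b * rGamma c * rGamma d *
        rGamma (1 + a - b) * rGamma (1 + a - c) * rGamma (1 + a - d))"

definition L ::
  "complex \<Rightarrow> complex \<Rightarrow> complex \<Rightarrow> complex \<Rightarrow> complex \<Rightarrow> complex \<Rightarrow> complex \<Rightarrow> complex" where
  "L a b c d e f g =
     F43 a b c d e f g / sin_pi e *
       (rGamma (1 + a - e) * rGamma (1 + b - e) * rGamma (1 + c - e) * rGamma (1 + d - e) *
        rGamma e * rGamma f * rGamma g)
     - F43 (1 + a - e) (1 + b - e) (1 + c - e) (1 + d - e) (2 - e) (1 + f - e) (1 + g - e) / sin_pi e *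
       (rGamma a * rGamma b * rGamma c * rGamma d *
        rGamma (2 - e) * rGamma (1 + f - e) * rGamma (1 + g - e))"

definition K_defined ::
  "complex \<Rightarrow> complex \<Rightarrow> complex \<Rightarrow> complex \<Rightarrow> complex \<Rightarrow> complex \<Rightarrow> complex \<Rightarrow> bool" where
  "K_defined a b c d e f g \<longleftrightarrow>
     sin_pi a \<noteq> 0 \<and>
     e \<notin> \<int>\<^sub>\<le>\<^sub>0 \<and> f \<notin> \<int>\<^sub>\<le>\<^sub>0 \<and> g \<notin> \<int>\<^sub>\<le>\<^sub>0 \<and>
     1 + a - b \<notin> \<int>\<^sub>\<le>\<^sub>0 \<and> 1 + a - c \<notin> \<int>\<^sub>\<le>\<^sub>0 \<and> 1 + a - d \<notin> \<int>\<^sub>\<le>\<^sub>0"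

definition L_defined ::
  "complex \<Rightarrow> complex \<Rightarrow> complex \<Rightarrow> complex \<Rightarrow> complex \<Rightarrow> complex \<Rightarrow> complex \<Rightarrow> bool" where
  "L_defined a b c d e f g \<longleftrightarrow>
     sin_pi e \<noteq> 0 \<and>
     e \<notin> \<int>\<^sub>\<le>\<^sub>0 \<and> f \<notin> \<int>\<^sub>\<le>\<^sub>0 \<and> g \<notin> \<int>\<^sub>\<le>\<^sub>0 \<and>
     2 - e \<notin> \<int>\<^sub>\<le>\<^sub>0 \<and> 1 + f - e \<notin> \<int>\<^sub>\<le>\<^sub>0 \<and> 1 + g - e \<notin> \<int>\<^sub>\<le>\<^sub>0"

fun K_p0 :: "param \<Rightarrow> complex" where
  "K_p0 (a, b, c, d, e, f, g) = K a b c d e f g"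

fun K_p0_defined :: "param \<Rightarrow> bool" where
  "K_p0_defined (a, b, c, d, e, f, g) \<longleftrightarrow> K_defined a b c d e f g"

fun K_n0 :: "param \<Rightarrow> complex" where
  "K_n0 (a, b, c, d, e, f, g) = K (1 - a) (1 - b) (1 - c) (1 - d) (2 - e) (2 - f) (2 - g)"

fun K_n0_defined :: "param \<Rightarrow> bool" where
  "K_n0_defined (a, b, c, d, e, f, g) \<longleftrightarrow>
     K_defined (1 - a) (1 - b) (1 - c) (1 - d) (2 - e) (2 - f) (2 - g)"

fun L_6 :: "param \<Rightarrow> complex" where
  "L_6 (a, b, c, d, e, f, g) = L a b c d e f g"

fun L_6_defined :: "param \<Rightarrow> bool" where
  "L_6_defined (a, b, c, d, e, f, g) \<longleftrightarrow> L_defined a b c d e f g"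

fun B_2 :: "param \<Rightarrow> complex" where
  "B_2 (a, b, c, d, e, f, g) =
     1 / of_real pi ^ 4 * S [f - a, g - a] *
       (S [b - a, c - a, d - a] + S [e - 2 * a, f - a, g - a])"

fun B_4 :: "param \<Rightarrow> complex" where
  "B_4 (a, b, c, d, e, f, g) =
     1 / of_real pi ^ 4 * S [f - a, g - a] * (S [b, c, d] + S [e - a, f, g])"

fun C :: "param \<Rightarrow> complex" where
  "C (a, b, c, d, e, f, g) =
     1 / of_real pi ^ 4 * S [e - a] *
       (S [b, c, d] * B_2 (a, b, c, d, e, f, g)
        + S [e, f - a, g - a] * B_4 (a, b, c, d, e, f, g))"

end

(*
Write T(t) for the bilateral sum over n of q(t+n), where q(t) is the product of 1/Gamma(1-u-t) over
u = a,b,c,d and of 1/Gamma(l+t) over l = 1,e,f,g. It is entire and 1-periodic, and by a growth estimate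
it lies in the span of 1, cos(2 pi t), sin(2 pi t). Its values at 0, -e, -f, -g, -a are, up to Gamma
factors, the 4F3 series that occur in K and in the functions L built from the pairs of lower parameters
{1,e} and {f,g}. Interpolation in this 3-dimensional space writes K as a combination of these two L
functions, with coefficients that do not change under the inversion (a,...;e,...) -> (1-a,...;2-e,...).

The inversion interchanges the two L functions. This follows from applying twice the two-term relation
for L, which comes from evaluating one double sum in two ways by the nonterminating Saalschuetz formula.
Eliminating the second L function from the two formulas for K at x and at its inversion gives the theorem.

The growth estimate is only made for real parameters in a small box. Multiplied by sin(pi a) sin(pi e)
the relation is entire on V, so it extends from the box to all of V.
*)

theory Submission
  imports Defs "HOL-Complex_Analysis.Complex_Analysis" "HOL-Real_Asymp.Real_Asymp"
begin

section \<open>Hypergeometric terms and the entire function Phi\<close>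

text \<open>At t = 0, -e, -f, -g, -a the bilateral sum collapses to a single 4F3, because a
  reciprocal Gamma factor vanishes on one half of the integers.

  The obstacle is the growth of T. By reflection its terms contain four sines, of size exp(4 pi |Im
  t|), and this bound alone would admit two more frequencies, 4 pi and -4 pi, too many for the
  interpolation. The balancing condition makes the remaining Gamma quotients decay like |t|^(-2);
  convergence of the sum over n consumes only part of that, and the rest excludes the extreme
  frequencies. The quotients are estimated by their values at real points, which requires real
  nonnegative differences between paired lower and upper parameters. Hence the real box.

  Gauss's theorem and the nonterminating Saalschuetz formula are obtained without integrals: both
  sides solve the same first-order recurrence and have the same asymptotics under integer shifts.

  The series are used multiplied by reciprocal Gamma functions. They are then entire along V, so the
  two-term relation can also be proved under convenient inequalities and continued.\<close>

lemma norm_one_plus_le_exp: "norm (1 + z) \<le> exp (Re z + (norm z)\<^sup>2 / 2)" for z :: complex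
proof (rule power2_le_imp_le)
  have "(norm (1 + z))\<^sup>2 = 1 + (2 * Re z + (norm z)\<^sup>2)"
    by (simp add: cmod_power2) (simp add: power2_eq_square algebra_simps)
  also have "\<dots> \<le> exp (2 * Re z + (norm z)\<^sup>2)"
    by (rule exp_ge_add_one_self)
  also have "\<dots> = (exp (Re z + (norm z)\<^sup>2 / 2))\<^sup>2"
    by (simp flip: exp_double add: algebra_simps)
  finally show "(norm (1 + z))\<^sup>2 \<le> (exp (Re z + (norm z)\<^sup>2 / 2))\<^sup>2" .
qed simp

text \<open>The bound for 1+z is applied to z = -w + w^2/(1+w). Since |1+w| >= 1/2, Re z contributes
  2|w|^2 and |z|^2/2 another 2|w|^2, whence the 4.\<close>

lemma norm_inverse_one_plus_le_exp:
  fixes w :: complex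
  assumes "norm w \<le> 1 / 2"
  shows "norm (1 / (1 + w)) \<le> exp (- Re w + 4 * (norm w)\<^sup>2)"
proof -
  have lower: "norm (1 + w) \<ge> 1 / 2"
    using norm_triangle_ineq2[of 1 "-w"] assms by simp
  hence nz: "1 + w \<noteq> 0" by auto
  define z where "z = - w / (1 + w)"
  have eq: "1 / (1 + w) = 1 + z" using nz by (simp add: z_def field_simps)
  have z_alt: "z = - w + w\<^sup>2 / (1 + w)"
    using nz by (simp add: z_def field_simps power2_eq_square)
  have inv: "norm (x / (1 + w)) \<le> 2 * norm x" for x
  proof -
    have "norm x \<le> norm x * (2 * norm (1 + w))"
      using lower mult_left_mono[of 1 "2 * norm (1 + w)" "norm x"] by simp
    thus ?thesis using nz by (simp add: norm_divide field_simps)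
  qed
  have "Re z \<le> - Re w + 2 * (norm w)\<^sup>2"
    using inv[of "w\<^sup>2"] complex_Re_le_cmod[of "w\<^sup>2 / (1 + w)"] by (simp add: z_alt norm_power)
  moreover have "(norm z)\<^sup>2 \<le> (2 * norm w)\<^sup>2"
    using inv[of "- w"] by (intro power_mono) (simp_all add: z_def)
  ultimately have "Re z + (norm z)\<^sup>2 / 2 \<le> - Re w + 4 * (norm w)\<^sup>2"
    by (simp add: power_mult_distrib)
  thus ?thesis unfolding eq using norm_one_plus_le_exp[of z] by (meson exp_le_cancel_iff order_trans)
qed

text \<open>The 5 is a round bound for 1/2 + 4, the second-order constants of numerator and
  denominator.\<close>

lemma norm_shift_ratio_le:
  fixes u l :: complex
  assumes "norm u \<le> R" "norm l \<le> R" "real n \<ge> 2 * R" "n > 0"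
  shows "norm ((u + of_nat n) / (l + of_nat n)) \<le> exp (- (Re l - Re u) / n + 5 * R\<^sup>2 / (real n)\<^sup>2)"
proof -
  have n: "real n > 0" using assms by simp
  have "(u + of_nat n) / (l + of_nat n) = (1 + u / of_nat n) * (1 / (1 + l / of_nat n))"
    using n by (simp add: divide_simps) (simp add: algebra_simps)
  hence "norm ((u + of_nat n) / (l + of_nat n))
      = norm (1 + u / of_nat n) * norm (1 / (1 + l / of_nat n))"
    by (simp only: norm_mult)
  also have "\<dots> \<le> exp (Re (u / of_nat n) + (norm (u / of_nat n))\<^sup>2 / 2)
        * exp (- Re (l / of_nat n) + 4 * (norm (l / of_nat n))\<^sup>2)"
    using assms n
    by (intro mult_mono norm_one_plus_le_exp norm_inverse_one_plus_le_exp)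
       (auto simp: norm_divide field_simps)
  also have "\<dots> = exp (- (Re l - Re u) / n + ((norm u)\<^sup>2 / 2 + 4 * (norm l)\<^sup>2) / (real n)\<^sup>2)"
    using n by (simp flip: exp_add add: norm_divide Re_divide_of_nat power_divide field_simps)
  also have "\<dots> \<le> exp (- (Re l - Re u) / n + 5 * R\<^sup>2 / (real n)\<^sup>2)"
  proof -
    have "(norm u)\<^sup>2 \<le> R\<^sup>2" "(norm l)\<^sup>2 \<le> R\<^sup>2" using assms by (auto intro!: power_mono)
    hence "(norm u)\<^sup>2 / 2 + 4 * (norm l)\<^sup>2 \<le> 5 * R\<^sup>2"
      using zero_le_power2[of "norm u"] by linarith
    thus ?thesis by (simp add: divide_right_mono)
  qed
  finally show ?thesis .
qed

section \<open>Decay, summability and holomorphic dependence of hypergeometric series\<close>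

text \<open>Consecutive terms have a ratio of norm at most exp(-sigma/n + O(1/n^2)), where sigma is
  the excess of the lower over the upper parameters. Beyond N the margin sigma - p absorbs the
  error, and the ratio is at most (n/(n+1))^p. The threshold is explicit in R so that one N serves
  for all parameters in a compact set.\<close>

lemma hypergeometric_term_bound:
  fixes t :: "nat \<Rightarrow> complex" and u l :: "nat \<Rightarrow> complex"
  assumes rec: "\<And>n. t (Suc n) * (\<Prod>i<k. l i + of_nat n) = t n * (\<Prod>i<k. u i + of_nat n)"
    and R: "\<And>i. i < k \<Longrightarrow> norm (u i) \<le> R" "\<And>i. i < k \<Longrightarrow> norm (l i) \<le> R"
    and p: "p > 0" "p < Re ((\<Sum>i<k. l i) - (\<Sum>i<k. u i))"
    and N: "real N > 2 * R" "real N \<ge> 5 * real k * R\<^sup>2 / (Re ((\<Sum>i<k. l i) - (\<Sum>i<k. u i)) - p)" "N > 0"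
    and "n \<ge> N"
  shows "norm (t n) \<le> norm (t N) * (real N / real n) powr p"
  using \<open>n \<ge> N\<close>
proof (induction n rule: dec_induct)
  case base
  thus ?case using N by simp
next
  case (step n)
  define \<sigma> where "\<sigma> = Re ((\<Sum>i<k. l i) - (\<Sum>i<k. u i))"
  have n: "real n > 2 * R" "real n > 0" "real n \<ge> 5 * real k * R\<^sup>2 / (\<sigma> - p)"
    using step N unfolding \<sigma>_def by auto
  have nz: "l i + of_nat n \<noteq> 0" if "i < k" for i
  proof
    assume "l i + of_nat n = 0"
    hence "norm (l i) = norm (- of_nat n :: complex)" by (simp add: add_eq_0_iff)
    thus False using R(2)[OF that] n by simp
  qed
  have "t (Suc n) = t n * ((\<Prod>i<k. u i + of_nat n) / (\<Prod>i<k. l i + of_nat n))"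
    using rec[of n] nz by (simp add: field_simps)
  also have "(\<Prod>i<k. u i + of_nat n) / (\<Prod>i<k. l i + of_nat n)
      = (\<Prod>i<k. (u i + of_nat n) / (l i + of_nat n))" by (simp add: prod_dividef)
  finally have "norm (t (Suc n)) = norm (t n) * (\<Prod>i<k. norm ((u i + of_nat n) / (l i + of_nat n)))"
    by (simp only: norm_mult prod_norm)
  also have "(\<Prod>i<k. norm ((u i + of_nat n) / (l i + of_nat n)))
      \<le> (\<Prod>i<k. exp (- (Re (l i) - Re (u i)) / n + 5 * R\<^sup>2 / (real n)\<^sup>2))"
    using n R by (intro prod_mono conjI norm_shift_ratio_le) auto
  also have "\<dots> = exp (\<Sum>i<k. - (Re (l i) - Re (u i)) / n + 5 * R\<^sup>2 / (real n)\<^sup>2)"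
    by (simp add: exp_sum)
  also have "(\<Sum>i<k. - (Re (l i) - Re (u i)) / n + 5 * R\<^sup>2 / (real n)\<^sup>2)
      = (- \<sigma> + (5 * real k * R\<^sup>2) / real n) / n"
  proof -
    have "(\<Sum>i<k. - (Re (l i) - Re (u i)) / n + 5 * R\<^sup>2 / (real n)\<^sup>2)
        = (\<Sum>i<k. - (Re (l i) - Re (u i))) / n + real k * (5 * R\<^sup>2 / (real n)\<^sup>2)"
      by (simp add: sum.distrib sum_divide_distrib)
    also have "(\<Sum>i<k. - (Re (l i) - Re (u i))) = - \<sigma>"
      by (simp add: \<sigma>_def sum_subtractf)
    finally show ?thesis
      using n by (simp add: field_simps power2_eq_square)
  qed
  also have "\<dots> \<le> - p / n"
  proof -
    have "5 * real k * R\<^sup>2 / real n \<le> \<sigma> - p"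
      using n p by (simp add: field_simps \<sigma>_def)
    thus ?thesis using n by (intro divide_right_mono) auto
  qed
  also have "exp (- p / n) \<le> (real n / real (Suc n)) powr p"
  proof -
    have "ln (1 + 1 / real n) \<le> 1 / n"
      using n by (intro ln_add_one_self_le_self) auto
    moreover have "ln (real n / real (Suc n)) = - ln (1 + 1 / real n)"
      using n by (simp add: ln_div field_simps)
    ultimately have "p * (- 1 / n) \<le> p * ln (real n / real (Suc n))"
      using p by (intro mult_left_mono) auto
    thus ?thesis using n by (simp add: powr_def)
  qed
  finally have "norm (t (Suc n)) \<le> norm (t n) * (real n / real (Suc n)) powr p"
    by (simp add: mult_left_mono)
  also have "\<dots> \<le> norm (t N) * (real N / real n) powr p * (real n / real (Suc n)) powr p"
    using step.IH by (intro mult_right_mono) auto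
  also have "\<dots> = norm (t N) * (real N / real (Suc n)) powr p"
    using n by (simp add: powr_mult[symmetric] mult.assoc)
  finally show ?case .
qed

lemma hypergeometric_term_decay:
  fixes t :: "nat \<Rightarrow> complex" and u l :: "nat \<Rightarrow> complex"
  assumes rec: "\<And>n. t (Suc n) * (\<Prod>i<k. l i + of_nat n) = t n * (\<Prod>i<k. u i + of_nat n)"
    and p: "p > 0" "p < Re ((\<Sum>i<k. l i) - (\<Sum>i<k. u i))"
  obtains C N where "C \<ge> 0" "N > 0" "\<And>n. n \<ge> N \<Longrightarrow> norm (t n) \<le> C * real n powr (- p)"
proof -
  define R where "R = (\<Sum>i<k. norm (u i)) + (\<Sum>i<k. norm (l i))"
  have R: "norm (u i) \<le> R" "norm (l i) \<le> R" if "i < k" for i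
    using that member_le_sum[of i "{..<k}" "\<lambda>i. norm (u i)"] member_le_sum[of i "{..<k}" "\<lambda>i. norm (l i)"]
    by (simp_all add: R_def sum_nonneg add_increasing add_increasing2)
  define N where "N = nat \<lceil>max (2 * R + 1) (5 * real k * R\<^sup>2 / (Re ((\<Sum>i<k. l i) - (\<Sum>i<k. u i)) - p))\<rceil> + 1"
  have "real N > max (2 * R + 1) (5 * real k * R\<^sup>2 / (Re ((\<Sum>i<k. l i) - (\<Sum>i<k. u i)) - p))"
    unfolding N_def by linarith
  hence N: "real N > 2 * R" "real N \<ge> 5 * real k * R\<^sup>2 / (Re ((\<Sum>i<k. l i) - (\<Sum>i<k. u i)) - p)"
    by auto
  have "N > 0" by (simp add: N_def)
  show thesis
  proof (rule that[of "norm (t N) * real N powr p" N])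
    fix n assume "n \<ge> N"
    have "norm (t n) \<le> norm (t N) * (real N / real n) powr p"
      by (rule hypergeometric_term_bound[OF rec R p N]) (use \<open>n \<ge> N\<close> \<open>N > 0\<close> in auto)
    also have "\<dots> = norm (t N) * real N powr p * real n powr (- p)"
      using \<open>n \<ge> N\<close> \<open>N > 0\<close> by (simp add: powr_divide powr_minus field_simps)
    finally show "norm (t n) \<le> norm (t N) * real N powr p * real n powr (- p)" .
  qed (use \<open>N > 0\<close> in auto)
qed

lemma hypergeometric_summable:
  fixes t :: "nat \<Rightarrow> complex" and u l :: "nat \<Rightarrow> complex"
  assumes rec: "\<And>n. t (Suc n) * (\<Prod>i<k. l i + of_nat n) = t n * (\<Prod>i<k. u i + of_nat n)"
    and "Re ((\<Sum>i<k. l i) - (\<Sum>i<k. u i)) > 1"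
  shows "summable (\<lambda>n. norm (t n))"
proof -
  define p where "p = (Re ((\<Sum>i<k. l i) - (\<Sum>i<k. u i)) + 1) / 2"
  have p: "p > 1" "p < Re ((\<Sum>i<k. l i) - (\<Sum>i<k. u i))"
    using assms(2) by (auto simp: p_def)
  obtain C N where CN: "C \<ge> 0" "\<And>n. n \<ge> N \<Longrightarrow> norm (t n) \<le> C * real n powr (- p)"
    using hypergeometric_term_decay[OF rec _ p(2)] p(1) by (metis less_trans zero_less_one)
  have "summable (\<lambda>n. C * real n powr (- p))"
    using p by (intro summable_mult) (simp add: summable_real_powr_iff)
  thus ?thesis
    by (rule summable_comparison_test_ev[rotated]) (use CN in \<open>auto simp: eventually_at_top_linorder\<close>)
qed

text \<open>The explicit threshold in \<open>hypergeometric_term_bound\<close> gives one majorant on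
  each closed unit disc, so the Weierstrass M-test applies.\<close>

lemma hypergeometric_suminf_holomorphic:
  fixes t :: "nat \<Rightarrow> complex \<Rightarrow> complex" and u l :: "nat \<Rightarrow> complex \<Rightarrow> complex"
  assumes rec: "\<And>n s. t (Suc n) s * (\<Prod>i<k. l i s + of_nat n) = t n s * (\<Prod>i<k. u i s + of_nat n)"
    and hol: "\<And>n. t n holomorphic_on UNIV" "\<And>i. i < k \<Longrightarrow> u i holomorphic_on UNIV"
      "\<And>i. i < k \<Longrightarrow> l i holomorphic_on UNIV"
    and \<sigma>: "\<And>s. Re ((\<Sum>i<k. l i s) - (\<Sum>i<k. u i s)) = \<sigma>" "\<sigma> > 1"
  shows "(\<lambda>s. \<Sum>n. t n s) holomorphic_on UNIV"
proof (rule holomorphic_uniform_sequence[where f = "\<lambda>n s. \<Sum>i<n. t i s"])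
  fix x :: complex
  define p where "p = (\<sigma> + 1) / 2"
  have p: "p > 1" "p < \<sigma>" using \<sigma>(2) by (auto simp: p_def)
  have bdd: "\<exists>B. \<forall>s\<in>cball x 1. norm (f s) \<le> B" if "f holomorphic_on UNIV" for f :: "complex \<Rightarrow> complex"
  proof -
    have "compact (f ` cball x 1)"
      using that by (intro compact_continuous_image holomorphic_on_imp_continuous_on)
        (auto intro: holomorphic_on_subset)
    thus ?thesis by (auto simp: bounded_iff dest!: compact_imp_bounded)
  qed
  have "\<forall>i. \<exists>B. i < k \<longrightarrow> (\<forall>s\<in>cball x 1. norm (u i s) \<le> B)" using bdd hol by blast
  then obtain Bu where Bu: "\<And>i s. i < k \<Longrightarrow> s \<in> cball x 1 \<Longrightarrow> norm (u i s) \<le> Bu i" by metis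
  have "\<forall>i. \<exists>B. i < k \<longrightarrow> (\<forall>s\<in>cball x 1. norm (l i s) \<le> B)" using bdd hol by blast
  then obtain Bl where Bl: "\<And>i s. i < k \<Longrightarrow> s \<in> cball x 1 \<Longrightarrow> norm (l i s) \<le> Bl i" by metis
  define R where "R = (\<Sum>i<k. \<bar>Bu i\<bar>) + (\<Sum>i<k. \<bar>Bl i\<bar>)"
  have R: "norm (u i s) \<le> R" "norm (l i s) \<le> R" if "i < k" "s \<in> cball x 1" for i s
  proof -
    have "\<bar>Bu i\<bar> \<le> (\<Sum>i<k. \<bar>Bu i\<bar>)" "\<bar>Bl i\<bar> \<le> (\<Sum>i<k. \<bar>Bl i\<bar>)"
      using that by (auto intro!: member_le_sum)
    moreover have "(\<Sum>i<k. \<bar>Bu i\<bar>) \<ge> 0" "(\<Sum>i<k. \<bar>Bl i\<bar>) \<ge> 0" by (auto intro: sum_nonneg)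
    ultimately show "norm (u i s) \<le> R" "norm (l i s) \<le> R"
      using Bu[OF that] Bl[OF that] unfolding R_def by linarith+
  qed
  define N where "N = nat \<lceil>max (2 * R + 1) (5 * real k * R\<^sup>2 / (\<sigma> - p))\<rceil> + 1"
  have "real N > max (2 * R + 1) (5 * real k * R\<^sup>2 / (\<sigma> - p))"
    unfolding N_def by linarith
  hence N: "real N > 2 * R" "real N \<ge> 5 * real k * R\<^sup>2 / (\<sigma> - p)" by auto
  have "N > 0" by (simp add: N_def)
  obtain B where B: "\<And>s. s \<in> cball x 1 \<Longrightarrow> norm (t N s) \<le> B" using bdd hol by meson
  have "uniform_limit (cball x 1) (\<lambda>n s. \<Sum>i<n. t i s) (\<lambda>s. \<Sum>n. t n s) sequentially"
  proof (rule Weierstrass_m_test_ev)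
    show "summable (\<lambda>n. B * real N powr p * real n powr (- p))"
      using p by (intro summable_mult) (simp add: summable_real_powr_iff)
    show "\<forall>\<^sub>F n in sequentially. \<forall>s\<in>cball x 1. norm (t n s) \<le> B * real N powr p * real n powr (- p)"
      using eventually_ge_at_top[of N]
    proof eventually_elim
      case (elim n)
      show ?case
      proof
        fix s assume s: "s \<in> cball x 1"
        have "norm (t n s) \<le> norm (t N s) * (real N / real n) powr p"
          by (rule hypergeometric_term_bound[where R = R and u = "\<lambda>i. u i s" and l = "\<lambda>i. l i s" and k = k])
             (use rec R s p N \<open>N > 0\<close> elim \<sigma>(1)[of s] in auto)
        also have "\<dots> \<le> B * (real N / real n) powr p"
          using B[OF s] by (intro mult_right_mono) auto
        also have "\<dots> = B * real N powr p * real n powr (- p)"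
          using elim \<open>N > 0\<close> by (simp add: powr_divide powr_minus field_simps)
        finally show "norm (t n s) \<le> B * real N powr p * real n powr (- p)" .
      qed
    qed
  qed
  thus "\<exists>d>0. cball x d \<subseteq> UNIV \<and>
      uniform_limit (cball x d) (\<lambda>n s. \<Sum>i<n. t i s) (\<lambda>s. \<Sum>n. t n s) sequentially"
    by (intro exI[of _ 1]) auto
qed (use hol in \<open>auto intro!: holomorphic_intros\<close>)

definition Phi_term ::
  "complex \<Rightarrow> complex \<Rightarrow> complex \<Rightarrow> complex \<Rightarrow> complex \<Rightarrow> complex \<Rightarrow> complex \<Rightarrow> nat \<Rightarrow> complex" where
  "Phi_term a b c d e f g n =
     pochhammer a n * pochhammer b n * pochhammer c n * pochhammer d n / fact n *
     (rGamma (e + of_nat n) * rGamma (f + of_nat n) * rGamma (g + of_nat n))"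

text \<open>The 4F3 at unit argument divided by Gamma(e) Gamma(f) Gamma(g). With the reciprocal
  Gammas inside the terms no lower parameter has to be excluded, and the sum stays holomorphic along
  entire curves in \<open>V\<close>.\<close>

definition Phi ::
  "complex \<Rightarrow> complex \<Rightarrow> complex \<Rightarrow> complex \<Rightarrow> complex \<Rightarrow> complex \<Rightarrow> complex \<Rightarrow> complex" where
  "Phi a b c d e f g = (\<Sum>n. Phi_term a b c d e f g n)"

lemma rGamma_Suc: "rGamma (z + of_nat (Suc n)) * (z + of_nat n) = rGamma (z + of_nat n)" for z :: complex
  using rGamma_plus1[of "z + of_nat n"] by (simp add: algebra_simps)

lemma prod_lessThan_4: "(\<Prod>i<4. f i) = f 0 * f 1 * f 2 * f (3::nat)" for f :: "nat \<Rightarrow> 'a::comm_monoid_mult"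
  by (simp add: numeral_eq_Suc lessThan_Suc ac_simps)

lemma sum_lessThan_4: "(\<Sum>i<4. f i) = f 0 + f 1 + f 2 + f (3::nat)" for f :: "nat \<Rightarrow> 'a::comm_monoid_add"
  by (simp add: numeral_eq_Suc lessThan_Suc ac_simps)

lemma less_4_cases: "i < (4::nat) \<Longrightarrow> i = 0 \<or> i = 1 \<or> i = 2 \<or> i = 3"
  by auto

text \<open>The factor n! counts as a fourth lower parameter 1. This raises the parameter excess
  from 1 to 2, as the general decay lemmas count it.\<close>

lemma Phi_term_Suc:
  "Phi_term a b c d e f g (Suc n) * (\<Prod>i<4. [1, e, f, g] ! i + of_nat n)
     = Phi_term a b c d e f g n * (\<Prod>i<4. [a, b, c, d] ! i + of_nat n)"
proof -
  have "Phi_term a b c d e f g (Suc n) * (\<Prod>i<4. [1, e, f, g] ! i + of_nat n)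
      = pochhammer a (Suc n) * pochhammer b (Suc n) * pochhammer c (Suc n) * pochhammer d (Suc n)
        / fact (Suc n) * (1 + of_nat n)
        * ((rGamma (e + of_nat (Suc n)) * (e + of_nat n)) * (rGamma (f + of_nat (Suc n)) * (f + of_nat n))
            * (rGamma (g + of_nat (Suc n)) * (g + of_nat n)))"
    unfolding Phi_term_def prod_lessThan_4 by (simp only: mult_ac) simp
  also have "\<dots> = Phi_term a b c d e f g n * (\<Prod>i<4. [a, b, c, d] ! i + of_nat n)"
  proof -
    have cancel: "(pa * xa) * (pb * xb) * (pc * xc) * (pd * xd) / (N * F) * N * r
        = pa * pb * pc * pd / F * r * (xa * xb * xc * xd)"
      if "N \<noteq> 0" for pa xa pb xb pc xc pd xd N F r :: complex
      using that by (cases "F = 0") (simp_all add: field_simps)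
    have "(1 + of_nat n :: complex) = of_nat (Suc n)" by simp
    thus ?thesis
      unfolding rGamma_Suc Phi_term_def prod_lessThan_4 pochhammer_Suc fact_Suc
      using cancel[of "of_nat (Suc n)"] of_nat_neq_0[of n, where 'a = complex]
      by (simp del: of_nat_Suc)
  qed
  finally show ?thesis .
qed

lemma Phi_summable:
  assumes "e + f + g - a - b - c - d = 1"
  shows "summable (\<lambda>n. norm (Phi_term a b c d e f g n))"
proof (rule hypergeometric_summable[where l = "\<lambda>i. [1, e, f, g] ! i" and u = "\<lambda>i. [a, b, c, d] ! i" and k = 4])
  have "(\<Sum>i<4. [1, e, f, g] ! i) - (\<Sum>i<4. [a, b, c, d] ! i) = 2"
    using assms by (simp add: sum_lessThan_4 algebra_simps)
  thus "1 < Re ((\<Sum>i<4. [1, e, f, g] ! i) - (\<Sum>i<4. [a, b, c, d] ! i))" by simp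
qed (rule Phi_term_Suc)

lemma F43_eq_Phi:
  assumes "e + f + g - a - b - c - d = 1"
    and "e \<notin> \<int>\<^sub>\<le>\<^sub>0" "f \<notin> \<int>\<^sub>\<le>\<^sub>0" "g \<notin> \<int>\<^sub>\<le>\<^sub>0"
  shows "F43 a b c d e f g * (rGamma e * rGamma f * rGamma g) = Phi a b c d e f g"
proof -
  let ?r = "rGamma e * rGamma f * rGamma g"
  have nz: "?r \<noteq> 0" using assms by (simp add: rGamma_eq_zero_iff)
  have poch: "pochhammer z n \<noteq> 0" if "z \<notin> \<int>\<^sub>\<le>\<^sub>0" for z :: complex and n
    using that pochhammer_eq_0_imp_nonpos_Int by blast
  have *: "rGamma (z + of_nat n) = rGamma z / pochhammer z n" if "z \<notin> \<int>\<^sub>\<le>\<^sub>0" for z :: complex and n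
    using pochhammer_rGamma[of z n] poch[OF that, of n] by (simp add: field_simps)
  define X where "X = (\<lambda>n. pochhammer a n * pochhammer b n * pochhammer c n * pochhammer d n /
           (fact n * pochhammer e n * pochhammer f n * pochhammer g n))"
  have eq: "Phi_term a b c d e f g = (\<lambda>n. ?r * X n)"
    using assms by (intro ext) (simp add: Phi_term_def X_def * divide_simps)
  have "summable (Phi_term a b c d e f g)"
    using Phi_summable[OF assms(1)] by (rule summable_norm_cancel)
  hence "summable X"
    using nz by (simp add: eq summable_cmult_iff)
  thus ?thesis
    unfolding F43_def Phi_def eq X_def[symmetric] by (subst suminf_mult) (auto simp: mult_ac)
qed

lemma Phi_holomorphic:
  assumes hol: "a holomorphic_on UNIV" "b holomorphic_on UNIV" "c holomorphic_on UNIV" "d holomorphic_on UNIV"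
      "e holomorphic_on UNIV" "f holomorphic_on UNIV" "g holomorphic_on UNIV"
    and "\<And>s. e s + f s + g s - a s - b s - c s - d s = 1"
  shows "(\<lambda>s. Phi (a s) (b s) (c s) (d s) (e s) (f s) (g s)) holomorphic_on UNIV"
  unfolding Phi_def
proof (rule hypergeometric_suminf_holomorphic[where l = "\<lambda>i s. [1, e s, f s, g s] ! i"
      and u = "\<lambda>i s. [a s, b s, c s, d s] ! i" and k = 4 and \<sigma> = 2])
  show "Re ((\<Sum>i<4. [1, e s, f s, g s] ! i) - (\<Sum>i<4. [a s, b s, c s, d s] ! i)) = 2" for s
  proof -
    have "(\<Sum>i<4. [1, e s, f s, g s] ! i) - (\<Sum>i<4. [a s, b s, c s, d s] ! i) = 2"
      using assms(8)[of s] by (simp add: sum_lessThan_4 algebra_simps)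
    thus ?thesis by simp
  qed
  show "(\<lambda>s. Phi_term (a s) (b s) (c s) (d s) (e s) (f s) (g s) n) holomorphic_on UNIV" for n
    unfolding Phi_term_def pochhammer_prod using hol
    by (intro holomorphic_intros) auto
  show "(\<lambda>s. [a s, b s, c s, d s] ! i) holomorphic_on UNIV" if "i < 4" for i
    using less_4_cases[OF that] hol by auto
  show "(\<lambda>s. [1, e s, f s, g s] ! i) holomorphic_on UNIV" if "i < 4" for i
    using less_4_cases[OF that] hol by auto
qed (auto simp: Phi_term_Suc)

section \<open>Bilateral series\<close>

text \<open>In Euler's limit formula the quotient is n^(-delta) times a product of factors 1 +
  delta/(p+k). Since |p+k| >= r+k, each factor is largest at the real point r; a real delta makes
  the power of n the same on both sides.\<close>

lemma norm_Gamma_quotient_le: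
  fixes p :: complex and r \<delta> :: real
  assumes "0 < r" "r \<le> Re p" "\<delta> \<ge> 0"
  shows "norm (Gamma p * rGamma (p + of_real \<delta>)) \<le> Gamma r * rGamma (r + \<delta>)"
proof (rule LIMSEQ_le)
  show "(\<lambda>n. norm (Gamma_series p n * rGamma_series (p + of_real \<delta>) n))
      \<longlonglongrightarrow> norm (Gamma p * rGamma (p + of_real \<delta>))"
    by (intro tendsto_intros)
  show "(\<lambda>n. Gamma_series r n * rGamma_series (r + \<delta>) n) \<longlonglongrightarrow> Gamma r * rGamma (r + \<delta>)"
    by (intro tendsto_intros)
  have "norm (Gamma_series p n * rGamma_series (p + of_real \<delta>) n)
      \<le> Gamma_series r n * rGamma_series (r + \<delta>) n" if "n > 0" for n
  proof -
    have nz: "p + of_nat k \<noteq> 0" for k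
      using assms by (auto simp: complex_eq_iff)
    have "(\<Prod>k=0..<n+1. norm ((p + of_real \<delta> + of_nat k) / (p + of_nat k)))
        \<le> (\<Prod>k=0..<n+1. (r + \<delta> + of_nat k) / (r + of_nat k))"
    proof (intro prod_mono conjI)
      fix k
      have "r + real k \<le> norm (p + of_nat k)"
        using complex_Re_le_cmod[of "p + of_nat k"] assms by simp
      moreover have "r + real k > 0" using assms by simp
      ultimately have pos: "r + real k \<le> norm (p + of_nat k)" "norm (p + of_nat k) * (r + real k) > 0"
        by (auto intro!: mult_pos_pos)
      have "norm ((p + of_real \<delta> + of_nat k) / (p + of_nat k)) = norm (1 + of_real \<delta> / (p + of_nat k))"
        using nz[of k] by (simp add: field_simps)
      also have "\<dots> \<le> 1 + \<delta> / norm (p + of_nat k)"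
        by (rule norm_triangle_le) (use assms in \<open>simp add: norm_divide\<close>)
      also have "\<dots> \<le> 1 + \<delta> / (r + real k)"
        using pos assms by (intro add_left_mono divide_left_mono) auto
      also have "\<dots> = (r + \<delta> + of_nat k) / (r + of_nat k)"
        using assms by (simp add: field_simps)
      finally show "norm ((p + of_real \<delta> + of_nat k) / (p + of_nat k)) \<le> \<dots>" .
    qed auto
    hence le: "norm (pochhammer (p + of_real \<delta>) (n + 1) / pochhammer p (n + 1))
        \<le> pochhammer (r + \<delta>) (n + 1) / pochhammer r (n + 1)"
      by (simp add: pochhammer_prod prod_dividef norm_divide prod_norm[symmetric] del: prod.op_ivl_Suc)
    have exp_quot: "exp (z * w) * inverse (exp ((z + y) * w)) = exp (- (y * w))"
      for z y w :: "'a :: {banach, real_normed_field}"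
      by (simp flip: exp_minus exp_add add: algebra_simps)
    have split: "Gamma_series z n * rGamma_series (z + y) n
        = exp (z * of_real (ln n)) * inverse (exp ((z + y) * of_real (ln n)))
          * (pochhammer (z + y) (n + 1) / pochhammer z (n + 1))"
      for z y :: "'a :: {banach, real_normed_field}"
      by (simp add: Gamma_series_def rGamma_series_def field_simps)
    have "norm (Gamma_series p n * rGamma_series (p + of_real \<delta>) n)
        = exp (- (\<delta> * ln n)) * norm (pochhammer (p + of_real \<delta>) (n + 1) / pochhammer p (n + 1))"
      unfolding split exp_quot norm_mult by simp
    also have "\<dots> \<le> exp (- (\<delta> * ln n)) * (pochhammer (r + \<delta>) (n + 1) / pochhammer r (n + 1))"
      using le by (intro mult_left_mono) auto
    also have "\<dots> = Gamma_series r n * rGamma_series (r + \<delta>) n"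
      unfolding split exp_quot by simp
    finally show ?thesis .
  qed
  thus "\<exists>N. \<forall>n\<ge>N. norm (Gamma_series p n * rGamma_series (p + of_real \<delta>) n)
      \<le> Gamma_series r n * rGamma_series (r + \<delta>) n"
    by (intro exI[of _ 1]) auto
qed

lemma Re_pos_not_nonpos_Int: "Re z > 0 \<Longrightarrow> z \<notin> \<int>\<^sub>\<le>\<^sub>0"
  by (auto elim!: nonpos_Ints_cases)

text \<open>Each \<open>rGamma (1 - u i - t)\<close> is Gamma(u+t) times sin pi(u+t) / pi. The sines
  make the term entire and do not disturb the recurrence in t, since the four sign changes cancel.
  Only the indices below 4 matter.\<close>

definition bilateral_term :: "(nat \<Rightarrow> complex) \<Rightarrow> (nat \<Rightarrow> complex) \<Rightarrow> complex \<Rightarrow> complex" where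
  "bilateral_term u l t = (\<Prod>i<4. rGamma (1 - u i - t)) * (\<Prod>i<4. rGamma (l i + t))"

definition half_series :: "(nat \<Rightarrow> complex) \<Rightarrow> (nat \<Rightarrow> complex) \<Rightarrow> complex \<Rightarrow> complex" where
  "half_series u l t = (\<Sum>n. bilateral_term u l (t + of_nat n))"

text \<open>Reflection interchanges upper and lower parameters and reverses the direction of
  summation, so the terms at t-1, t-2, ... form another half series, started at 1-t.\<close>

definition bilateral_series :: "(nat \<Rightarrow> complex) \<Rightarrow> (nat \<Rightarrow> complex) \<Rightarrow> complex \<Rightarrow> complex" where
  "bilateral_series u l t = half_series u l t + half_series (\<lambda>i. 1 - l i) (\<lambda>i. 1 - u i) (1 - t)"

lemma bilateral_term_reflect:
  "bilateral_term (\<lambda>i. 1 - l i) (\<lambda>i. 1 - u i) t = bilateral_term u l (- t)"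
  by (simp add: bilateral_term_def mult.commute algebra_simps)

lemma bilateral_term_plus1:
  "bilateral_term u l (t + 1) * (\<Prod>i<4. l i + t) = bilateral_term u l t * (\<Prod>i<4. u i + t)"
proof -
  have u: "rGamma (1 - u i - (t + 1)) = - ((u i + t) * rGamma (1 - u i - t))" for i
  proof -
    have "1 - u i - (t + 1) = - u i - t" "1 - u i - t = - u i - t + 1" by simp_all
    thus ?thesis by (simp only: rGamma_plus1[of "- u i - t", symmetric]) (simp add: algebra_simps)
  qed
  have l: "rGamma (l i + (t + 1)) * (l i + t) = rGamma (l i + t)" for i
    using rGamma_plus1[of "l i + t"] by (simp add: algebra_simps)
  have "bilateral_term u l (t + 1) * (\<Prod>i<4. l i + t)
      = (\<Prod>i<4. rGamma (1 - u i - (t + 1))) * (\<Prod>i<4. rGamma (l i + (t + 1)) * (l i + t))"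
    by (simp add: bilateral_term_def prod.distrib)
  also have "\<dots> = bilateral_term u l t * (\<Prod>i<4. u i + t)"
    unfolding u l by (simp add: bilateral_term_def prod_lessThan_4)
  finally show ?thesis .
qed

lemma bilateral_term_Suc:
  "bilateral_term u l (t + of_nat (Suc n)) * (\<Prod>i<4. (l i + t) + of_nat n)
     = bilateral_term u l (t + of_nat n) * (\<Prod>i<4. (u i + t) + of_nat n)"
  using bilateral_term_plus1[of u l "t + of_nat n"] by (simp add: add_ac)

lemma bilateral_term_holomorphic: "bilateral_term u l holomorphic_on X"
  unfolding bilateral_term_def [abs_def] by (intro holomorphic_intros)

context
  fixes u l :: "nat \<Rightarrow> complex"
  assumes balanced: "(\<Sum>i<4. l i) - (\<Sum>i<4. u i) = 2"
begin

lemma half_series_summable: "summable (\<lambda>n. norm (bilateral_term u l (t + of_nat n)))"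
proof (rule hypergeometric_summable[where l = "\<lambda>i. l i + t" and u = "\<lambda>i. u i + t" and k = 4])
  have "(\<Sum>i<4. l i + t) - (\<Sum>i<4. u i + t) = 2"
    using balanced by (simp add: sum.distrib)
  thus "1 < Re ((\<Sum>i<4. l i + t) - (\<Sum>i<4. u i + t))" by simp
qed (rule bilateral_term_Suc)

lemma half_series_holomorphic: "half_series u l holomorphic_on UNIV"
  unfolding half_series_def [abs_def]
proof (rule hypergeometric_suminf_holomorphic[where l = "\<lambda>i t. l i + t" and u = "\<lambda>i t. u i + t"
      and k = 4 and \<sigma> = 2])
  show "Re ((\<Sum>i<4. l i + t) - (\<Sum>i<4. u i + t)) = 2" for t
    using balanced by (simp add: sum.distrib complex_eq_iff)
  show "(\<lambda>t. bilateral_term u l (t + of_nat n)) holomorphic_on UNIV" for n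
    by (rule holomorphic_on_compose[of "\<lambda>t. t + of_nat n" UNIV "bilateral_term u l", unfolded o_def])
       (intro holomorphic_intros bilateral_term_holomorphic)+
qed (auto intro!: holomorphic_intros simp: bilateral_term_Suc simp del: of_nat_Suc)

lemma half_series_rec: "half_series u l t = bilateral_term u l t + half_series u l (t + 1)"
proof -
  have "summable (\<lambda>n. bilateral_term u l (t + of_nat n))"
    using half_series_summable by (rule summable_norm_cancel)
  from suminf_split_head[OF this] show ?thesis
    by (simp add: half_series_def add_ac)
qed

end

lemma balanced_reflect:
  fixes u l :: "nat \<Rightarrow> complex"
  assumes "(\<Sum>i<4. l i) - (\<Sum>i<4. u i) = 2"
  shows "(\<Sum>i<4. 1 - u i) - (\<Sum>i<4. 1 - l i) = (2 :: complex)"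
  using assms by (simp add: sum_subtractf)

lemma bilateral_series_holomorphic:
  assumes "(\<Sum>i<4. l i) - (\<Sum>i<4. u i) = 2"
  shows "bilateral_series u l holomorphic_on UNIV"
proof -
  have "(half_series (\<lambda>i. 1 - l i) (\<lambda>i. 1 - u i) \<circ> (\<lambda>t. 1 - t)) holomorphic_on UNIV"
    using half_series_holomorphic[OF balanced_reflect[OF assms]]
    by (intro holomorphic_on_compose holomorphic_intros) (auto intro: holomorphic_on_subset)
  thus ?thesis
    unfolding bilateral_series_def [abs_def] o_def
    by (intro holomorphic_on_add half_series_holomorphic assms)
qed

text \<open>A shift by 1 moves the single term at t from one half to the other.\<close>

lemma bilateral_series_periodic:
  assumes "(\<Sum>i<4. l i) - (\<Sum>i<4. u i) = 2"
  shows "bilateral_series u l (t + 1) = bilateral_series u l t"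
  unfolding bilateral_series_def
  using half_series_rec[OF assms, of t] half_series_rec[OF balanced_reflect[OF assms], of "- t"]
  by (simp add: bilateral_term_reflect add_ac)

section \<open>Growth of the bilateral series in the imaginary direction\<close>

lemma norm_bilateral_term_le:
  fixes u l :: "nat \<Rightarrow> real"
  assumes u: "\<And>i. i < 4 \<Longrightarrow> u i > 0" and ul: "\<And>i. i < 4 \<Longrightarrow> u i \<le> l i" and "u 0 + 1 \<le> l 0"
    and t: "Re t \<ge> 0" "\<bar>Im t\<bar> > 0"
  shows "norm (bilateral_term (\<lambda>i. u i) (\<lambda>i. l i) (t + of_nat n))
     \<le> exp (4 * pi * \<bar>Im t\<bar>) / sqrt \<bar>Im t\<bar>
       * (sqrt (l 0 - 1 + n) * (\<Prod>i<4. Gamma (u i + n) * rGamma (l i + n)))"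
proof -
  define G where "G = (\<lambda>i. Gamma (u i + t + of_nat n) * rGamma (l i + t + of_nat n))"
  define g where "g = (\<lambda>i. Gamma (u i + n) * rGamma (l i + n))"
  have sin_le: "norm (sin (of_real pi * (u i + t + of_nat n))) \<le> exp (pi * \<bar>Im t\<bar>)" for i
    using cmod_sin_le_exp[of 1 "of_real pi * (u i + t + of_nat n)"] by (simp add: abs_mult)
  have factor: "rGamma (1 - of_real (u i) - (t + of_nat n)) * rGamma (of_real (l i) + (t + of_nat n))
      = sin (of_real pi * (u i + t + of_nat n)) / of_real pi * G i" if "i < 4" for i
  proof -
    let ?z = "u i + t + of_nat n"
    have "Re ?z > 0" using u[OF that] t by simp
    hence "?z \<notin> \<int>\<^sub>\<le>\<^sub>0" by (rule Re_pos_not_nonpos_Int)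
    hence "Gamma ?z * rGamma ?z = 1" by (simp add: rGamma_inverse_Gamma Gamma_eq_zero_iff)
    hence "rGamma (1 - ?z) = Gamma ?z * (rGamma ?z * rGamma (1 - ?z))"
      by (simp only: mult.assoc[symmetric] mult_1_left)
    also have "\<dots> = sin (of_real pi * ?z) / of_real pi * Gamma ?z"
      by (simp add: rGamma_reflection_complex)
    finally have "rGamma (1 - ?z) = sin (of_real pi * ?z) / of_real pi * Gamma ?z" .
    thus ?thesis by (simp add: G_def algebra_simps)
  qed
  have G_le: "norm (G i) \<le> g i" if "i < 4" for i
    using norm_Gamma_quotient_le[of "u i + n" "u i + t + of_nat n" "l i - u i"]
      u[OF that] ul[OF that] t by (simp add: G_def g_def add_ac)
  \<comment> \<open>The factor 1/w, split off from the reciprocal Gamma of index 0, is the source of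
    the decay in Im t. The gap \<open>u 0 + 1 \<le> l 0\<close> leaves a quotient to which
    \<open>norm_Gamma_quotient_le\<close> still applies.\<close>
  have "norm (G 0) \<le> sqrt (l 0 - 1 + n) / sqrt \<bar>Im t\<bar> * g 0"
  proof -
    define w where "w = of_real (l 0) - 1 + t + of_nat n"
    define r where "r = l 0 - 1 + n"
    have r: "r > 0" using u[of 0] assms(3) by (simp add: r_def)
    have w: "norm w \<ge> r" "norm w \<ge> \<bar>Im t\<bar>"
      using complex_Re_le_cmod[of w] abs_Im_le_cmod[of w] t by (auto simp: w_def r_def)
    have "w \<noteq> 0" using w r by auto
    have rw: "rGamma (w + 1) = rGamma w / w" "rGamma (r + 1) = rGamma r / r"
      using rGamma_plus1[of w] rGamma_plus1[of r] \<open>w \<noteq> 0\<close> r by (simp_all add: field_simps)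
    have "w + 1 = of_real (l 0) + t + of_nat n" "r + 1 = l 0 + n" by (simp_all add: w_def r_def)
    hence eq: "G 0 = Gamma (u 0 + t + of_nat n) * rGamma w / w"
        "g 0 = Gamma (u 0 + n) * rGamma r / r"
      using rw by (simp_all add: G_def g_def)
    \<comment> \<open>|w| dominates both r and |Im t|, hence their geometric mean: half of the decay
      goes to |Im t|, the other half stays available for the sum over n.\<close>
    have "sqrt r * sqrt \<bar>Im t\<bar> \<le> sqrt (norm w) * sqrt (norm w)"
      using w r t by (intro mult_mono) auto
    hence w': "sqrt r * sqrt \<bar>Im t\<bar> \<le> norm w" by simp
    have le: "norm (Gamma (u 0 + t + of_nat n) * rGamma w) \<le> Gamma (u 0 + n) * rGamma r"
      using norm_Gamma_quotient_le[of "u 0 + n" "u 0 + t + of_nat n" "l 0 - 1 - u 0"]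
        u[of 0] assms(3) t by (simp add: w_def r_def algebra_simps)
    have "norm (G 0) = norm (Gamma (u 0 + t + of_nat n) * rGamma w) / norm w"
      by (simp add: eq norm_divide)
    also have "\<dots> \<le> (Gamma (u 0 + n) * rGamma r) / (sqrt r * sqrt \<bar>Im t\<bar>)"
      using le w' r t by (intro frac_le) (auto intro: order_trans[OF norm_ge_zero])
    also have "\<dots> = sqrt r / sqrt \<bar>Im t\<bar> * g 0"
    proof -
      have "sqrt r / \<bar>r\<bar> = 1 / sqrt r" using r by (simp add: field_simps)
      moreover have "sqrt r / sqrt \<bar>Im t\<bar> * g 0
          = (Gamma (u 0 + n) * rGamma r) / sqrt \<bar>Im t\<bar> * (sqrt r / \<bar>r\<bar>)"
        using r by (simp add: eq)
      ultimately show ?thesis by simp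
    qed
    finally show ?thesis by (simp add: r_def)
  qed
  moreover have "g i \<ge> 0" if "i < 4" for i using G_le[OF that] norm_ge_zero order_trans by blast
  ultimately have prod_le: "(\<Prod>i<4. norm (G i)) \<le> sqrt (l 0 - 1 + n) / sqrt \<bar>Im t\<bar> * (\<Prod>i<4. g i)"
    using G_le[of 1] G_le[of 2] G_le[of 3] u[of 0] assms(3)
    unfolding prod_lessThan_4 mult.assoc[symmetric]
    by (intro mult_mono) (auto intro!: mult_nonneg_nonneg)
  have "bilateral_term (\<lambda>i. u i) (\<lambda>i. l i) (t + of_nat n)
      = (\<Prod>i<4. sin (of_real pi * (u i + t + of_nat n)) / of_real pi * G i)"
    unfolding bilateral_term_def by (simp add: factor flip: prod.distrib)
  hence "norm (bilateral_term (\<lambda>i. u i) (\<lambda>i. l i) (t + of_nat n))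
      = (\<Prod>i<4. norm (sin (of_real pi * (u i + t + of_nat n))) / pi) * (\<Prod>i<4. norm (G i))"
    by (simp only: prod_norm[symmetric] norm_mult norm_divide prod.distrib norm_of_real
        abs_of_nonneg[OF pi_ge_zero])
  also have "\<dots> \<le> (\<Prod>i<(4::nat). exp (pi * \<bar>Im t\<bar>)) * (sqrt (l 0 - 1 + n) / sqrt \<bar>Im t\<bar> * (\<Prod>i<4. g i))"
  proof (intro mult_mono prod_mono conjI prod_le)
    fix i :: nat
    have "norm (sin (of_real pi * (u i + t + of_nat n))) / pi
        \<le> norm (sin (of_real pi * (u i + t + of_nat n))) / 1"
      using pi_ge_two by (intro divide_left_mono) auto
    thus "norm (sin (of_real pi * (u i + t + of_nat n))) / pi \<le> exp (pi * \<bar>Im t\<bar>)"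
      using sin_le[of i] by simp
  qed (auto intro!: prod_nonneg)
  also have "(\<Prod>i<(4::nat). exp (pi * \<bar>Im t\<bar>)) = exp (4 * pi * \<bar>Im t\<bar>)"
    by (simp flip: exp_of_nat_mult)
  finally show ?thesis by (simp add: g_def)
qed

lemma bilateral_majorant_summable:
  fixes u l :: "nat \<Rightarrow> real"
  assumes u: "\<And>i. i < 4 \<Longrightarrow> u i > 0" and "(\<Sum>i<4. l i) - (\<Sum>i<4. u i) = 2"
  shows "summable (\<lambda>n. sqrt (c + real n) * (\<Prod>i<4. Gamma (u i + n) * rGamma (l i + n)))"
proof -
  define w where "w = (\<lambda>n. \<Prod>i<4. Gamma (u i + real n) * rGamma (l i + real n))"
  have rec: "w (Suc n) * (\<Prod>i<4. l i + real n) = w n * (\<Prod>i<4. u i + real n)" for n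
  proof -
    have "w (Suc n) * (\<Prod>i<4. l i + real n)
        = (\<Prod>i<4. Gamma (u i + real (Suc n)) * (rGamma (l i + real (Suc n)) * (l i + real n)))"
      by (simp only: w_def mult.assoc prod.distrib[symmetric])
    also have "\<dots> = (\<Prod>i<4. (Gamma (u i + real n) * rGamma (l i + real n)) * (u i + real n))"
    proof (rule prod.cong[OF refl])
      fix i :: nat assume "i \<in> {..<4}"
      hence "u i + real n > 0" using u[of i] by simp
      hence "Gamma (u i + real n + 1) = (u i + real n) * Gamma (u i + real n)"
        by (intro Gamma_plus1) (auto elim!: nonpos_Ints_cases)
      moreover have "rGamma (l i + real n + 1) * (l i + real n) = rGamma (l i + real n)"
        using rGamma_plus1[of "l i + real n"] by (simp add: mult.commute)
      ultimately show "Gamma (u i + real (Suc n)) * (rGamma (l i + real (Suc n)) * (l i + real n))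
          = (Gamma (u i + real n) * rGamma (l i + real n)) * (u i + real n)"
        by (simp add: add_ac mult_ac)
    qed
    finally show ?thesis by (simp add: w_def prod.distrib)
  qed
  have rec': "of_real (w (Suc n)) * (\<Prod>i<4. of_real (l i) + of_nat n)
      = of_real (w n) * (\<Prod>i<4. of_real (u i) + (of_nat n :: complex))" for n
    using arg_cong[OF rec[of n], of complex_of_real] by simp
  \<comment> \<open>Any exponent strictly between 3/2 and 2 serves: the factor sqrt(c+n) lowers it
    by 1/2, and 5/4 still exceeds 1.\<close>
  have "7 / 4 < Re ((\<Sum>i<4. of_real (l i)) - (\<Sum>i<4. of_real (u i)))"
    using assms(2) by simp
  from hypergeometric_term_decay[where t = "\<lambda>n. of_real (w n)" and l = "\<lambda>i. of_real (l i)"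
      and u = "\<lambda>i. of_real (u i)", OF rec' _ this]
  obtain C N where CN: "C \<ge> 0" "N > 0" "\<And>n. n \<ge> N \<Longrightarrow> \<bar>w n\<bar> \<le> C * real n powr (- (7 / 4))"
    by auto
  have "summable (\<lambda>n. sqrt (\<bar>c\<bar> + 1) * C * real n powr (- (5 / 4)))"
    by (intro summable_mult) (simp add: summable_real_powr_iff)
  moreover have "\<forall>\<^sub>F n in sequentially.
      norm (sqrt (c + real n) * w n) \<le> sqrt (\<bar>c\<bar> + 1) * C * real n powr (- (5 / 4))"
    using eventually_ge_at_top[of N] eventually_ge_at_top[of "nat \<lceil>\<bar>c\<bar>\<rceil>"] eventually_gt_at_top[of 0]
  proof eventually_elim
    case (elim n)
    have "c + real n \<ge> 0" "real n \<ge> 1" using elim by linarith+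
    have "c + real n \<le> (\<bar>c\<bar> + 1) * real n"
      using \<open>real n \<ge> 1\<close> mult_left_mono[of 1 "real n" "\<bar>c\<bar>"] by (simp add: algebra_simps)
    hence "sqrt (c + real n) \<le> sqrt (\<bar>c\<bar> + 1) * sqrt (real n)"
      by (simp flip: real_sqrt_mult)
    hence "sqrt (c + real n) * \<bar>w n\<bar> \<le> (sqrt (\<bar>c\<bar> + 1) * sqrt (real n)) * (C * real n powr (- (7 / 4)))"
      using CN elim by (intro mult_mono) auto
    also have "\<dots> = sqrt (\<bar>c\<bar> + 1) * C * (real n powr (1 / 2) * real n powr (- (7 / 4)))"
      by (simp add: powr_half_sqrt)
    also have "real n powr (1 / 2) * real n powr (- (7 / 4)) = real n powr (- (5 / 4))"
      by (simp flip: powr_add)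
    finally show ?case using \<open>c + real n \<ge> 0\<close> by (simp add: abs_mult)
  qed
  ultimately show ?thesis
    unfolding w_def by (rule summable_comparison_test_ev[rotated])
qed

lemma bilateral_term_shift:
  "bilateral_term u l (t + z) = bilateral_term (\<lambda>i. u i + z) (\<lambda>i. l i + z) t"
  by (simp add: bilateral_term_def algebra_simps)

text \<open>The termwise estimate needs positive upper parameters. They are reached by shifting t by
  m, and each step costs only a constant because |u+s| >= |Im t| >= 1 gives |l+s| <= (1 + (l-u))
  |u+s|.\<close>

lemma norm_bilateral_term_le_shift:
  fixes u l :: "nat \<Rightarrow> real"
  assumes ul: "\<And>i. i < 4 \<Longrightarrow> u i \<le> l i" and t: "\<bar>Im t\<bar> \<ge> 1"
  shows "norm (bilateral_term (\<lambda>i. u i) (\<lambda>i. l i) t)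
      \<le> (\<Prod>i<4. 1 + (l i - u i)) ^ m * norm (bilateral_term (\<lambda>i. u i) (\<lambda>i. l i) (t + of_nat m))"
proof (induction m)
  case (Suc m)
  let ?s = "t + of_nat m" and ?q = "bilateral_term (\<lambda>i. u i) (\<lambda>i. l i)" and ?c = "\<Prod>i<4. 1 + (l i - u i)"
  have one_le: "1 \<le> norm (of_real (u i) + ?s)" for i
    using abs_Im_le_cmod[of "of_real (u i) + ?s"] t by simp
  have "norm (?q ?s) * (\<Prod>i<4. norm (of_real (u i) + ?s))
      = norm (?q (?s + 1)) * (\<Prod>i<4. norm (of_real (l i) + ?s))"
    by (simp only: prod_norm norm_mult[symmetric] bilateral_term_plus1)
  also have "\<dots> \<le> norm (?q (?s + 1))
      * (\<Prod>i<4. (1 + (l i - u i)) * norm (of_real (u i) + ?s))"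
  proof (intro mult_left_mono prod_mono conjI)
    fix i :: nat assume "i \<in> {..<4}"
    hence "u i \<le> l i" using ul by simp
    have "of_real (l i) + ?s = (of_real (u i) + ?s) + of_real (l i - u i)" by simp
    also have "norm \<dots> \<le> norm (of_real (u i) + ?s) + (l i - u i)"
      by (rule norm_triangle_le) (use \<open>u i \<le> l i\<close> in \<open>simp del: of_real_diff\<close>)
    also have "\<dots> \<le> norm (of_real (u i) + ?s) + (l i - u i) * norm (of_real (u i) + ?s)"
      using one_le[of i] \<open>u i \<le> l i\<close> mult_left_mono[of 1 "norm (of_real (u i) + ?s)" "l i - u i"] by simp
    finally show "norm (of_real (l i) + ?s) \<le> (1 + (l i - u i)) * norm (of_real (u i) + ?s)"
      by (simp add: algebra_simps)
  qed auto
  also have "\<dots> = (?c * norm (?q (?s + 1)))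
      * (\<Prod>i<4. norm (of_real (u i) + ?s))"
    by (simp add: prod.distrib)
  finally have "norm (?q ?s)
      \<le> ?c * norm (?q (?s + 1))"
    by (rule mult_right_le_imp_le) (intro prod_pos less_le_trans[OF zero_less_one one_le])
  moreover have "0 \<le> ?c ^ m"
    using ul by (intro zero_le_power prod_nonneg) (auto simp: add_nonneg_nonneg)
  ultimately have "norm (?q t) \<le> ?c ^ m
      * (?c * norm (?q (?s + 1)))"
    using Suc.IH by (meson mult_left_mono order_trans)
  thus ?case by (simp add: mult_ac add_ac)
qed simp

text \<open>The gap \<open>u 0 + 1 \<le> l 0\<close> yields the factor \<open>1 / sqrt \<bar>Im t\<bar>\<close>, which excludes the frequencies
  \<open>\<plusminus>4 pi\<close> from the Fourier expansion.\<close>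

lemma half_series_growth:
  fixes u l :: "nat \<Rightarrow> real"
  assumes ul: "\<And>i. i < 4 \<Longrightarrow> u i \<le> l i" and "u 0 + 1 \<le> l 0"
    and balanced: "(\<Sum>i<4. l i) - (\<Sum>i<4. u i) = 2"
  obtains B where "\<And>t. Re t \<ge> 0 \<Longrightarrow> \<bar>Im t\<bar> \<ge> 1 \<Longrightarrow>
      norm (half_series (\<lambda>i. u i) (\<lambda>i. l i) t) \<le> B * (exp (4 * pi * \<bar>Im t\<bar>) / sqrt \<bar>Im t\<bar>)"
proof -
  define m where "m = nat \<lceil>\<Sum>i<4. \<bar>u i\<bar>\<rceil> + 1"
  have m: "u i + m > 0" if "i < 4" for i
  proof -
    have "\<bar>u i\<bar> \<le> (\<Sum>i<4. \<bar>u i\<bar>)" using that by (auto intro!: member_le_sum)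
    thus ?thesis unfolding m_def by linarith
  qed
  define v where "v = (\<lambda>n. sqrt (l 0 + m - 1 + real n)
      * (\<Prod>i<4. Gamma (u i + m + real n) * rGamma (l i + m + real n)))"
  have "summable v"
    unfolding v_def by (rule bilateral_majorant_summable) (use m balanced in \<open>auto simp: sum.distrib\<close>)
  define X where "X = (\<Prod>i<4. 1 + (l i - u i)) ^ m"
  have "X \<ge> 0" unfolding X_def using ul by (intro zero_le_power prod_nonneg) (auto simp: add_nonneg_nonneg)
  show thesis
  proof (rule that)
    fix t :: complex assume t: "Re t \<ge> 0" "\<bar>Im t\<bar> \<ge> 1"
    define E where "E = exp (4 * pi * \<bar>Im t\<bar>) / sqrt \<bar>Im t\<bar>"
    let ?q = "\<lambda>n. bilateral_term (\<lambda>i. u i) (\<lambda>i. l i) (t + of_nat n)"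
    have "norm (?q n) \<le> X * E * v n" for n
    proof -
      have "norm (?q n) \<le> X * norm (bilateral_term (\<lambda>i. u i) (\<lambda>i. l i) (t + of_nat n + of_nat m))"
        unfolding X_def by (rule norm_bilateral_term_le_shift) (use ul t in auto)
      also have "bilateral_term (\<lambda>i. u i) (\<lambda>i. l i) (t + of_nat n + of_nat m)
          = bilateral_term (\<lambda>i. of_real (u i + m)) (\<lambda>i. of_real (l i + m)) (t + of_nat n)"
        by (simp add: bilateral_term_shift)
      also have "X * norm \<dots> \<le> X * (E * v n)"
        unfolding E_def v_def using norm_bilateral_term_le[of "\<lambda>i. u i + m" "\<lambda>i. l i + m" t n] m ul assms(2) t \<open>X \<ge> 0\<close>
        by (intro mult_left_mono) auto
      finally show ?thesis by (simp add: mult.assoc)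
    qed
    hence "norm (\<Sum>n. ?q n) \<le> (\<Sum>n. X * E * v n)"
      using \<open>summable v\<close> by (intro norm_suminf_le) auto
    also have "\<dots> = X * suminf v * E"
      using \<open>summable v\<close> by (simp add: suminf_mult mult_ac)
    finally show "norm (half_series (\<lambda>i. u i) (\<lambda>i. l i) t) \<le> X * suminf v * (exp (4 * pi * \<bar>Im t\<bar>) / sqrt \<bar>Im t\<bar>)"
      by (simp add: half_series_def E_def)
  qed
qed

text \<open>In the strip 0 <= Re t <= 1 both halves start at a point of nonnegative real part, and
  the reflected parameters have the same differences l - u.\<close>

lemma bilateral_series_growth:
  fixes u l :: "nat \<Rightarrow> real"
  assumes ul: "\<And>i. i < 4 \<Longrightarrow> u i \<le> l i" and "u 0 + 1 \<le> l 0"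
    and balanced: "(\<Sum>i<4. l i) - (\<Sum>i<4. u i) = 2"
  obtains B where "B \<ge> 0" "\<And>t. Re t \<ge> 0 \<Longrightarrow> Re t \<le> 1 \<Longrightarrow> \<bar>Im t\<bar> \<ge> 1 \<Longrightarrow>
      norm (bilateral_series (\<lambda>i. u i) (\<lambda>i. l i) t) \<le> B * (exp (4 * pi * \<bar>Im t\<bar>) / sqrt \<bar>Im t\<bar>)"
proof -
  obtain B1 where B1: "\<And>t. Re t \<ge> 0 \<Longrightarrow> \<bar>Im t\<bar> \<ge> 1 \<Longrightarrow>
      norm (half_series (\<lambda>i. u i) (\<lambda>i. l i) t) \<le> B1 * (exp (4 * pi * \<bar>Im t\<bar>) / sqrt \<bar>Im t\<bar>)"
    using half_series_growth[of u l] assms by blast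
  have "(\<Sum>i<4. 1 - u i) - (\<Sum>i<4. 1 - l i) = 2"
    using balanced by (simp add: sum_subtractf)
  then obtain B2 where B2: "\<And>t. Re t \<ge> 0 \<Longrightarrow> \<bar>Im t\<bar> \<ge> 1 \<Longrightarrow>
      norm (half_series (\<lambda>i. 1 - l i) (\<lambda>i. 1 - u i) t) \<le> B2 * (exp (4 * pi * \<bar>Im t\<bar>) / sqrt \<bar>Im t\<bar>)"
    using half_series_growth[of "\<lambda>i. 1 - l i" "\<lambda>i. 1 - u i"] assms by auto
  show thesis
  proof (rule that[of "\<bar>B1 + B2\<bar>"])
    fix t :: complex assume t: "Re t \<ge> 0" "Re t \<le> 1" "\<bar>Im t\<bar> \<ge> 1"
    let ?E = "exp (4 * pi * \<bar>Im t\<bar>) / sqrt \<bar>Im t\<bar>"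
    have "norm (bilateral_series (\<lambda>i. u i) (\<lambda>i. l i) t) \<le> (B1 + B2) * ?E"
      unfolding bilateral_series_def distrib_right
      using B1[of t] B2[of "1 - t"] t by (intro norm_triangle_le add_mono) auto
    also have "\<dots> \<le> \<bar>B1 + B2\<bar> * ?E"
      by (intro mult_right_mono) auto
    finally show "norm (bilateral_series (\<lambda>i. u i) (\<lambda>i. l i) t) \<le> \<bar>B1 + B2\<bar> * ?E" .
  qed simp
qed

section \<open>Periodic entire functions of small growth\<close>

lemma periodic_of_int:
  fixes T :: "complex \<Rightarrow> 'a"
  assumes "\<And>t. T (t + 1) = T t"
  shows "T (t + of_int k) = T t"
proof (induction k rule: int_induct[where k = 0])
  case (step1 i)
  thus ?case using assms[of "t + of_int i"] by (simp add: add_ac)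
next
  case (step2 i)
  thus ?case using assms[of "t + of_int (i - 1)"] by (simp add: add_ac)
qed simp

definition trig_degree2 :: "(complex \<Rightarrow> complex) \<Rightarrow> bool" where
  "trig_degree2 T \<longleftrightarrow> (\<exists>\<alpha> \<beta> \<gamma>. \<forall>t. T t = \<alpha> + \<beta> * cos (2 * of_real pi * t) + \<gamma> * sin (2 * of_real pi * t))"

text \<open>With w = exp(2 pi i t), periodicity makes j(w) = w^2 T(t) a function on the punctured
  plane, and exp(4 pi |Im t|) becomes |w|^2 or |w|^(-2). So j tends to 0 at the origin and is
  o(|w|^4) at infinity: a polynomial containing only w, w^2 and w^3.\<close>

lemma periodic_entire_trig_degree2:
  assumes hol: "T holomorphic_on UNIV" and per: "\<And>t. T (t + 1) = T t"
    and B: "B \<ge> 0" "\<And>t. Re t \<ge> 0 \<Longrightarrow> Re t \<le> 1 \<Longrightarrow> \<bar>Im t\<bar> \<ge> 1 \<Longrightarrow>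
      norm (T t) \<le> B * (exp (4 * pi * \<bar>Im t\<bar>) / sqrt \<bar>Im t\<bar>)"
  shows "trig_degree2 T"
proof -
  define j where "j = (\<lambda>w. if w = 0 then 0 else w\<^sup>2 * T (Ln w / (2 * of_real pi * \<i>)))"
  have j_exp: "j (exp (2 * of_real pi * \<i> * t)) = (exp (2 * of_real pi * \<i> * t))\<^sup>2 * T t" for t
  proof -
    obtain n :: int where n: "Ln (exp (2 * of_real pi * \<i> * t)) = 2 * of_real pi * \<i> * t + (of_int (2 * n) * pi) * \<i>"
      using exp_eq[of "Ln (exp (2 * of_real pi * \<i> * t))" "2 * of_real pi * \<i> * t"] by auto
    hence "Ln (exp (2 * of_real pi * \<i> * t)) / (2 * of_real pi * \<i>) = t + of_int n"
      by (simp add: field_simps)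
    thus ?thesis by (simp add: j_def periodic_of_int[of T, OF per])
  qed
  have T_bound: "norm (T t) \<le> B * (exp (4 * pi * \<bar>Im t\<bar>) / sqrt \<bar>Im t\<bar>)" if "\<bar>Im t\<bar> \<ge> 1" for t
  proof -
    have "T t = T (t + of_int (- \<lfloor>Re t\<rfloor>))" using periodic_of_int[of T, OF per] by metis
    also have "norm \<dots> \<le> B * (exp (4 * pi * \<bar>Im t\<bar>) / sqrt \<bar>Im t\<bar>)"
      using B(2)[of "t + of_int (- \<lfloor>Re t\<rfloor>)"] that by (simp del: of_int_minus) linarith
    finally show ?thesis .
  qed
  have j_bound: "norm (j w) \<le> (norm w)\<^sup>2 * (B * (exp (2 * \<bar>ln (norm w)\<bar>) / sqrt (\<bar>ln (norm w)\<bar> / (2 * pi))))"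
    if "w \<noteq> 0" "\<bar>ln (norm w)\<bar> \<ge> 2 * pi" for w
  proof -
    have Im: "\<bar>Im (Ln w / (2 * of_real pi * \<i>))\<bar> = \<bar>ln (norm w)\<bar> / (2 * pi)"
      using that(1) by (simp add: Im_divide Re_Ln power2_eq_square abs_mult field_simps)
    have "\<bar>Im (Ln w / (2 * of_real pi * \<i>))\<bar> \<ge> 1" unfolding Im using that(2) by (simp add: field_simps)
    from mult_left_mono[OF T_bound[OF this], of "(norm w)\<^sup>2"] show ?thesis
      unfolding Im using that(1) by (simp add: j_def norm_mult norm_power)
  qed
  have j_diff: "j field_differentiable at w0" if "w0 \<noteq> 0" for w0
  proof -
    \<comment> \<open>Near w0 the logarithm is taken as Ln(w/w0) + Ln w0, which keeps away from the
      branch cut; by periodicity T does not see the change of branch.\<close>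
    let ?g = "\<lambda>w. w\<^sup>2 * T ((Ln (w / w0) + Ln w0) / (2 * of_real pi * \<i>))"
    have off: "w / w0 \<notin> \<real>\<^sub>\<le>\<^sub>0" if "w \<in> ball w0 (norm w0)" for w
    proof
      assume "w / w0 \<in> \<real>\<^sub>\<le>\<^sub>0"
      then obtain x where x: "w / w0 = of_real x" "x \<le> 0"
        by (metis complex_nonpos_Reals_iff complex_eq_iff Re_complex_of_real Im_complex_of_real)
      hence "w = of_real x * w0" using \<open>w0 \<noteq> 0\<close> by (simp add: field_simps)
      hence "w0 - w = of_real (1 - x) * w0" by (simp add: algebra_simps)
      hence "norm (w0 - w) = (1 - x) * norm w0" using x by (simp add: norm_mult del: of_real_diff)
      thus False using that x mult_right_mono[of 1 "1 - x" "norm w0"] by (simp add: dist_norm)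
    qed
    have "?g holomorphic_on ball w0 (norm w0)"
    proof (intro holomorphic_intros)
      have "(T \<circ> (\<lambda>w. (Ln (w / w0) + Ln w0) / (2 * of_real pi * \<i>))) holomorphic_on ball w0 (norm w0)"
        using that off
        by (intro holomorphic_on_compose holomorphic_intros holomorphic_on_subset[OF hol]) auto
      thus "(\<lambda>w. T ((Ln (w / w0) + Ln w0) / (2 * of_real pi * \<i>))) holomorphic_on ball w0 (norm w0)"
        by (simp add: o_def)
    qed
    moreover have "?g w = j w" if "w \<in> ball w0 (norm w0)" for w
    proof -
      have "w \<noteq> 0" using that by auto
      let ?t = "(Ln (w / w0) + Ln w0) / (2 * of_real pi * \<i>)"
      have "exp (2 * of_real pi * \<i> * ?t) = w"
        using \<open>w \<noteq> 0\<close> \<open>w0 \<noteq> 0\<close> by (simp add: exp_add)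
      thus ?thesis using j_exp[of ?t] by simp
    qed
    ultimately have "j holomorphic_on ball w0 (norm w0)"
      by (rule holomorphic_transform)
    thus ?thesis using that by (intro holomorphic_on_imp_differentiable_at[where s = "ball w0 (norm w0)"]) auto
  qed
  have lim0: "(j \<longlongrightarrow> 0) (at 0)"
  proof (rule Lim_null_comparison)
    have "filterlim norm (at_right 0) (at (0 :: complex))"
      unfolding filterlim_at by (auto intro!: tendsto_eq_intros simp: eventually_at_filter)
    moreover have "((\<lambda>x. x\<^sup>2 * (B * (exp (2 * \<bar>ln x\<bar>) / sqrt (\<bar>ln x\<bar> / (2 * pi))))) \<longlongrightarrow> 0) (at_right 0)"
      by real_asymp
    ultimately show "((\<lambda>w. (norm w)\<^sup>2 * (B * (exp (2 * \<bar>ln (norm w)\<bar>) / sqrt (\<bar>ln (norm w)\<bar> / (2 * pi))))) \<longlongrightarrow> 0) (at (0::complex))"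
      by (rule filterlim_compose[rotated])
    have "\<forall>\<^sub>F x in at_right 0. \<bar>ln x\<bar> \<ge> 2 * pi" by real_asymp
    hence "\<forall>\<^sub>F w in at (0::complex). \<bar>ln (norm w)\<bar> \<ge> 2 * pi"
      using \<open>filterlim norm (at_right 0) (at (0 :: complex))\<close> by (rule eventually_compose_filterlim)
    thus "\<forall>\<^sub>F w in at 0. norm (j w) \<le> (norm w)\<^sup>2 * (B * (exp (2 * \<bar>ln (norm w)\<bar>) / sqrt (\<bar>ln (norm w)\<bar> / (2 * pi))))"
      using eventually_neq_at_within[of 0 0 UNIV] by eventually_elim (use j_bound in auto)
  qed
  have j_hol: "j holomorphic_on UNIV"
  proof (rule no_isolated_singularity'[where K = "{0}"])
    show "(j \<longlongrightarrow> j z) (at z within UNIV)" if "z \<in> {0}" for z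
      using lim0 that by (simp add: j_def)
    show "j holomorphic_on (UNIV - {0})"
      using j_diff by (auto simp: holomorphic_on_def intro: field_differentiable_at_within)
  qed auto
  define c where "c = (\<lambda>k. (deriv ^^ k) j 0 / fact k)"
  have large: "norm (j w) \<le> B * (norm w) ^ 4 / sqrt (ln (norm w) / (2 * pi))" if "norm w \<ge> exp (2 * pi)" for w
  proof -
    have "ln (norm w) \<ge> 2 * pi"
      using that by (metis exp_gt_zero ln_exp ln_le_cancel_iff order_less_le_trans)
    moreover have "norm w > 0" using that exp_gt_zero order_less_le_trans by blast
    moreover have "exp (2 * ln (norm w)) = (norm w)\<^sup>2"
      using \<open>norm w > 0\<close> exp_double[of "ln (norm w)"] by simp
    moreover have "\<bar>ln (norm w)\<bar> = ln (norm w)"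
      using \<open>ln (norm w) \<ge> 2 * pi\<close> pi_gt_zero by (intro abs_of_nonneg) linarith
    ultimately show ?thesis
      using j_bound[of w] by (simp add: power2_eq_square power4_eq_xxxx mult_ac)
  qed
  have poly: "j \<xi> = (\<Sum>k\<le>4. c k * \<xi> ^ k)" for \<xi>
    unfolding c_def
  proof (rule Liouville_polynomial[OF j_hol, where A = "exp (2 * pi)" and B = B])
    fix z :: complex assume z: "exp (2 * pi) \<le> norm z"
    have "ln (norm z) \<ge> 2 * pi"
      using z by (metis exp_gt_zero ln_exp ln_le_cancel_iff order_less_le_trans)
    hence "sqrt (ln (norm z) / (2 * pi)) \<ge> 1" by (simp add: field_simps)
    hence "B * (norm z) ^ 4 / sqrt (ln (norm z) / (2 * pi)) \<le> B * (norm z) ^ 4 / 1"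
      using B(1) by (intro divide_left_mono mult_pos_pos) (linarith | simp)+
    thus "norm (j z) \<le> B * norm z ^ 4" using large[OF z] by simp
  qed
  have c0: "c 0 = 0" by (simp add: c_def j_def)
  \<comment> \<open>The Liouville bound alone allows degree 4; the factor 1/sqrt(ln |w|) is what
    kills the top coefficient.\<close>
  have "c 4 = 0"
  proof -
    have eq: "\<forall>\<^sub>F x in at_top. c 1 * of_real (1 / x ^ 3) + c 2 * of_real (1 / x\<^sup>2) + c 3 * of_real (1 / x) + c 4
        = j (of_real x) / of_real (x ^ 4)"
      using eventually_gt_at_top[of "0::real"]
    proof eventually_elim
      case (elim x)
      have "{..4} = {0, 1, 2, 3, 4::nat}" by auto
      thus ?case using elim c0 by (simp add: poly field_simps power2_eq_square power3_eq_cube power4_eq_xxxx)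
    qed
    have real_lims: "((\<lambda>x::real. 1 / x ^ 3) \<longlongrightarrow> 0) at_top" "((\<lambda>x::real. 1 / x\<^sup>2) \<longlongrightarrow> 0) at_top"
      "((\<lambda>x::real. 1 / x) \<longlongrightarrow> 0) at_top" by real_asymp+
    have "((\<lambda>x. c 1 * of_real (1 / x ^ 3) + c 2 * of_real (1 / x\<^sup>2) + c 3 * of_real (1 / x) + c 4)
        \<longlongrightarrow> c 1 * of_real 0 + c 2 * of_real 0 + c 3 * of_real 0 + c 4) at_top"
      by (intro tendsto_intros real_lims)
    hence lim: "((\<lambda>x. j (of_real x) / of_real (x ^ 4)) \<longlongrightarrow> c 4) at_top"
      using eq by (simp add: tendsto_cong)
    have "((\<lambda>x. j (of_real x) / of_real (x ^ 4)) \<longlongrightarrow> 0) at_top"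
    proof (rule Lim_null_comparison)
      show "((\<lambda>x. B / sqrt (ln x / (2 * pi))) \<longlongrightarrow> 0) at_top" by real_asymp
      show "\<forall>\<^sub>F x in at_top. norm (j (of_real x) / of_real (x ^ 4)) \<le> B / sqrt (ln x / (2 * pi))"
        using eventually_ge_at_top[of "exp (2 * pi)"]
      proof eventually_elim
        case (elim x)
        have "x > 0" using elim exp_gt_zero order_less_le_trans by blast
        thus ?case using large[of "of_real x"] elim by (simp add: norm_divide norm_power field_simps)
      qed
    qed
    thus ?thesis using lim tendsto_unique trivial_limit_at_top_linorder by blast
  qed
  have "T t = c 2 + (c 1 + c 3) * cos (2 * of_real pi * t) + (\<i> * (c 3 - c 1)) * sin (2 * of_real pi * t)" for t
  proof -
    define w where "w = exp (2 * of_real pi * \<i> * t)"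
    have "w \<noteq> 0" by (simp add: w_def)
    have w: "w = cos (2 * of_real pi * t) + \<i> * sin (2 * of_real pi * t)"
      using exp_Euler[of "2 * of_real pi * t"] by (simp add: w_def mult_ac)
    have iw: "inverse w = cos (2 * of_real pi * t) - \<i> * sin (2 * of_real pi * t)"
      using exp_Euler[of "- (2 * of_real pi * t)"] by (simp add: w_def mult_ac flip: exp_minus)
    have "{..4} = {0, 1, 2, 3, 4::nat}" by auto
    hence "w\<^sup>2 * T t = c 1 * w + c 2 * w\<^sup>2 + c 3 * w ^ 3"
      using j_exp[of t] poly[of w] c0 \<open>c 4 = 0\<close> by (simp add: w_def)
    also have "\<dots> = w\<^sup>2 * (c 1 * inverse w + c 2 + c 3 * w)"
      using \<open>w \<noteq> 0\<close> by (simp add: field_simps power2_eq_square power3_eq_cube)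
    finally have "T t = c 1 * inverse w + c 2 + c 3 * w"
      using \<open>w \<noteq> 0\<close> by (simp only: mult_cancel_left) auto
    thus ?thesis unfolding iw unfolding w by (simp add: algebra_simps)
  qed
  thus ?thesis unfolding trig_degree2_def by blast
qed

lemma bilateral_series_trig_degree2:
  fixes u l :: "nat \<Rightarrow> real"
  assumes ul: "\<And>i. i < 4 \<Longrightarrow> u i \<le> l i" and "u 0 + 1 \<le> l 0"
    and balanced: "(\<Sum>i<4. l i) - (\<Sum>i<4. u i) = 2"
  shows "trig_degree2 (bilateral_series (\<lambda>i. u i) (\<lambda>i. l i))"
proof -
  have bal: "(\<Sum>i<4. of_real (l i)) - (\<Sum>i<4. of_real (u i)) = (2 :: complex)"
    using arg_cong[OF balanced, of complex_of_real] by simp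
  obtain B where "B \<ge> 0" "\<And>t. Re t \<ge> 0 \<Longrightarrow> Re t \<le> 1 \<Longrightarrow> \<bar>Im t\<bar> \<ge> 1 \<Longrightarrow>
      norm (bilateral_series (\<lambda>i. u i) (\<lambda>i. l i) t) \<le> B * (exp (4 * pi * \<bar>Im t\<bar>) / sqrt \<bar>Im t\<bar>)"
    using bilateral_series_growth[of u l] assms by blast
  thus ?thesis
    using bilateral_series_holomorphic[OF bal] bilateral_series_periodic[OF bal]
    by (intro periodic_entire_trig_degree2) auto
qed

section \<open>Nonterminating Gauss and Saalschuetz sums\<close>

text \<open>Finite partial sums over k are interchanged with the sum over l, and Tannery's theorem
  passes to the limit.\<close>

lemma suminf_swap_bounded:
  fixes \<alpha> \<beta> :: "nat \<Rightarrow> complex"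
  assumes \<alpha>: "summable (\<lambda>k. norm (\<alpha> k))" and \<beta>: "summable (\<lambda>l. norm (\<beta> l))"
    and B: "\<And>k l. norm (X k l) \<le> B"
  shows "(\<Sum>k. \<alpha> k * (\<Sum>l. \<beta> l * X k l)) = (\<Sum>l. \<beta> l * (\<Sum>k. \<alpha> k * X k l))"
proof -
  have summ: "summable (\<lambda>n. \<phi> n * Y n)"
    if "summable (\<lambda>n. norm (\<phi> n))" "\<And>n. norm (Y n) \<le> B" for \<phi> Y :: "nat \<Rightarrow> complex"
  proof (rule summable_comparison_test')
    show "summable (\<lambda>n. B * norm (\<phi> n))" using that(1) by (rule summable_mult)
    show "norm (\<phi> n * Y n) \<le> B * norm (\<phi> n)" for n
      using mult_left_mono[OF that(2)[of n], of "norm (\<phi> n)"] by (simp add: norm_mult mult.commute)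
  qed
  have "B \<ge> 0" using B[of 0 0] norm_ge_zero order_trans by blast
  define a where "a = (\<lambda>l m. \<beta> l * (\<Sum>k<m. \<alpha> k * X k l))"
  have lim: "(\<lambda>m. a l m) \<longlonglongrightarrow> \<beta> l * (\<Sum>k. \<alpha> k * X k l)" for l
    unfolding a_def using summ[OF \<alpha> B] by (intro tendsto_mult tendsto_const summable_LIMSEQ)
  have bound: "norm (a l m) \<le> (B * (\<Sum>k. norm (\<alpha> k))) * norm (\<beta> l)" for l m
  proof -
    have "norm (\<Sum>k<m. \<alpha> k * X k l) \<le> (\<Sum>k<m. B * norm (\<alpha> k))"
      using mult_left_mono[OF B[of _ l], of "norm (\<alpha> _)"]
      by (intro order_trans[OF norm_sum] sum_mono) (simp add: norm_mult mult.commute)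
    also have "\<dots> \<le> B * (\<Sum>k. norm (\<alpha> k))"
      unfolding sum_distrib_left[symmetric] using \<open>B \<ge> 0\<close> \<alpha> by (intro mult_left_mono sum_le_suminf) auto
    finally show ?thesis
      unfolding a_def norm_mult by (subst mult.commute) (rule mult_right_mono, auto)
  qed
  have "(\<lambda>m. \<Sum>l. a l m) \<longlonglongrightarrow> (\<Sum>l. \<beta> l * (\<Sum>k. \<alpha> k * X k l))"
    by (rule tannerys_theorem[OF lim always_eventually summable_mult[OF \<beta>, of "B * (\<Sum>k. norm (\<alpha> k))"], THEN conjunct2, THEN conjunct2])
       (auto simp: bound)
  also have "(\<lambda>m. \<Sum>l. a l m) = (\<lambda>m. \<Sum>k<m. \<alpha> k * (\<Sum>l. \<beta> l * X k l))"
  proof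
    fix m
    have "(\<Sum>l. a l m) = (\<Sum>l. \<Sum>k<m. \<alpha> k * (\<beta> l * X k l))"
      by (simp add: a_def sum_distrib_left mult_ac)
    also have "\<dots> = (\<Sum>k<m. \<Sum>l. \<alpha> k * (\<beta> l * X k l))"
      by (intro suminf_sum summable_mult summ[OF \<beta> B])
    finally show "(\<Sum>l. a l m) = (\<Sum>k<m. \<alpha> k * (\<Sum>l. \<beta> l * X k l))"
      using summ[OF \<beta> B] by (simp add: suminf_mult)
  qed
  finally show ?thesis by (rule sums_unique[symmetric, unfolded sums_def])
qed

section \<open>Asymptotics of Gamma functions under integer shifts\<close>

lemma pochhammer_conv_rGamma_series:
  "pochhammer z (Suc n) = rGamma_series z n * (fact n * exp (z * of_real (ln (of_nat n))))" for z :: complex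
  by (simp add: rGamma_series_def)

lemma rGamma_shift_limit_aux:
  fixes s :: complex
  assumes "s \<notin> \<int>\<^sub>\<le>\<^sub>0"
  shows "(\<lambda>n. rGamma (s + of_nat (Suc n)) * (fact n * exp (s * of_real (ln (of_nat n))))) \<longlonglongrightarrow> 1"
proof -
  have nz: "rGamma s \<noteq> 0" using assms by (simp add: rGamma_eq_zero_iff)
  have "(\<lambda>n. rGamma s / rGamma_series s n) \<longlonglongrightarrow> rGamma s / rGamma s"
    using nz by (intro tendsto_intros)
  moreover have "rGamma s / rGamma_series s n
      = rGamma (s + of_nat (Suc n)) * (fact n * exp (s * of_real (ln (of_nat n))))" for n
  proof -
    have "pochhammer s (Suc n) \<noteq> 0" using assms pochhammer_eq_0_imp_nonpos_Int by blast
    hence "rGamma_series s n \<noteq> 0" by (simp add: rGamma_series_def)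
    thus ?thesis
      using pochhammer_rGamma[of s "Suc n"]
      by (simp add: pochhammer_conv_rGamma_series divide_eq_eq mult_ac del: of_nat_Suc)
  qed
  ultimately show ?thesis using nz by simp
qed

text \<open>This is Gamma(s+n+1) ~ n! n^s. Nonpositive integers s, excluded in the auxiliary lemma,
  are reached by descending from s+1 to s.\<close>

lemma rGamma_shift_limit:
  fixes s :: complex
  shows "(\<lambda>n. rGamma (s + of_nat (Suc n)) * (fact n * exp (s * of_real (ln (of_nat n))))) \<longlonglongrightarrow> 1"
proof -
  obtain m :: nat where m: "real m > - Re s" using reals_Archimedean2 by blast
  have "s + of_nat m \<notin> \<int>\<^sub>\<le>\<^sub>0" using m by (intro Re_pos_not_nonpos_Int) simp
  thus ?thesis
  proof (induction m arbitrary: s)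
    case 0
    thus ?case using rGamma_shift_limit_aux[of s] by simp
  next
    case (Suc m)
    let ?t = "\<lambda>s n. rGamma (s + of_nat (Suc n)) * (fact n * exp (s * of_real (ln (of_nat n)))) :: complex"
    have lim0: "(\<lambda>n. (s + 1) * of_real (1 / real n)) \<longlonglongrightarrow> (s + 1) * of_real 0"
      by (intro tendsto_intros lim_1_over_n)
    have "s + 1 + of_nat m \<notin> \<int>\<^sub>\<le>\<^sub>0" using Suc.prems by (simp add: add_ac)
    hence "(\<lambda>n. ?t (s + 1) n) \<longlonglongrightarrow> 1" by (rule Suc.IH)
    from tendsto_mult[OF this tendsto_add[OF tendsto_const[of 1] lim0]]
    have "(\<lambda>n. ?t (s + 1) n * (1 + (s + 1) * of_real (1 / real n))) \<longlonglongrightarrow> 1 * (1 + (s + 1) * of_real 0)" .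
    moreover have "\<forall>\<^sub>F n in sequentially. ?t (s + 1) n * (1 + (s + 1) * of_real (1 / real n)) = ?t s n"
      using eventually_gt_at_top[of 0]
    proof eventually_elim
      case (elim n)
      have regroup: "r = r' * y \<Longrightarrow> x = x' * m \<Longrightarrow> m * z = y \<Longrightarrow> r' * (p * x) * z = r * (p * x')"
        for r r' x x' y z p m :: complex by algebra
      have "rGamma (s + of_nat (Suc n)) = rGamma (s + 1 + of_nat (Suc n)) * (s + of_nat (Suc n))"
        using rGamma_Suc[of s "Suc n"] by (simp add: add_ac)
      moreover have "exp ((s + 1) * of_real (ln (of_nat n))) = exp (s * of_real (ln (of_nat n))) * of_nat n"
        using elim by (simp add: distrib_right exp_add exp_of_real)
      moreover have "of_nat n * (1 + (s + 1) * of_real (1 / real n)) = s + of_nat (Suc n)"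
        using elim by (simp add: field_simps)
      ultimately show ?case by (rule regroup)
    qed
    ultimately show ?case by (simp only: tendsto_cong) simp
  qed
qed

lemma Gamma_shift_limit:
  fixes s :: complex
  shows "(\<lambda>n. Gamma (s + of_nat (Suc n)) / (fact n * exp (s * of_real (ln (of_nat n))))) \<longlonglongrightarrow> 1"
  using tendsto_inverse[OF rGamma_shift_limit[of s]]
  by (simp add: rGamma_inverse_Gamma divide_inverse mult_ac)

text \<open>Up to the factor \<open>Gamma \<gamma>\<close> this is the Euler Beta function.\<close>

definition beta_kernel :: "complex \<Rightarrow> complex \<Rightarrow> complex" where
  "beta_kernel \<gamma> s = Gamma s * rGamma (\<gamma> + s)"

lemma beta_kernel_plus1:
  assumes "s \<notin> \<int>\<^sub>\<le>\<^sub>0"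
  shows "beta_kernel \<gamma> (s + 1) * (\<gamma> + s) = s * beta_kernel \<gamma> s"
  using Gamma_plus1[OF assms] rGamma_plus1[of "\<gamma> + s"]
  by (simp add: beta_kernel_def add.assoc[symmetric] mult_ac)

lemma beta_kernel_limit:
  "(\<lambda>n. beta_kernel \<gamma> (s + of_nat (Suc n)) * exp (\<gamma> * of_real (ln (of_nat n)))) \<longlonglongrightarrow> 1"
proof -
  have "(\<lambda>n. Gamma (s + of_nat (Suc n)) / (fact n * exp (s * of_real (ln (of_nat n))))
      * (rGamma (\<gamma> + s + of_nat (Suc n)) * (fact n * exp ((\<gamma> + s) * of_real (ln (of_nat n)))))) \<longlonglongrightarrow> 1 * 1"
    by (intro tendsto_mult Gamma_shift_limit rGamma_shift_limit)
  moreover have "Gamma (s + of_nat (Suc n)) / (fact n * exp (s * of_real (ln (of_nat n))))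
      * (rGamma (\<gamma> + s + of_nat (Suc n)) * (fact n * exp ((\<gamma> + s) * of_real (ln (of_nat n)))))
      = beta_kernel \<gamma> (s + of_nat (Suc n)) * exp (\<gamma> * of_real (ln (of_nat n)))" for n
    by (simp add: beta_kernel_def exp_add distrib_right add_ac del: of_nat_Suc)
  ultimately show ?thesis by simp
qed

lemma beta_kernel_bound:
  obtains B where "\<And>n. norm (beta_kernel \<gamma> (s + of_nat (Suc n))) * exp (Re \<gamma> * ln (of_nat n)) \<le> B"
proof -
  have "Bseq (\<lambda>n. beta_kernel \<gamma> (s + of_nat (Suc n)) * exp (\<gamma> * of_real (ln (of_nat n))))"
    using beta_kernel_limit[of \<gamma> s] by (intro convergent_imp_Bseq) (auto simp: convergent_def)
  then obtain B where "\<And>n. norm (beta_kernel \<gamma> (s + of_nat (Suc n)) * exp (\<gamma> * of_real (ln (of_nat n)))) \<le> B"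
    by (auto elim!: BseqE)
  thus thesis by (intro that[of B]) (simp add: norm_mult)
qed

lemma beta_kernel_bounded:
  assumes "Re \<gamma> \<ge> 0"
  obtains B where "\<And>n. norm (beta_kernel \<gamma> (s + of_nat n)) \<le> B"
proof -
  obtain B where B: "\<And>n. norm (beta_kernel \<gamma> (s + of_nat (Suc n))) * exp (Re \<gamma> * ln (of_nat n)) \<le> B"
    using beta_kernel_bound by blast
  have "norm (beta_kernel \<gamma> (s + of_nat n)) \<le> max B (norm (beta_kernel \<gamma> s))" for n
  proof (cases n)
    case (Suc m)
    \<comment> \<open>For m = 0 this relies on ln 0 = 0, which makes the exponential 1.\<close>
    have "1 \<le> exp (Re \<gamma> * ln (of_nat m))"
      using assms by (cases "m = 0") (auto intro!: mult_nonneg_nonneg)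
    hence "norm (beta_kernel \<gamma> (s + of_nat (Suc m))) \<le> B"
      using B[of m] mult_left_mono[of 1 "exp (Re \<gamma> * ln (of_nat m))" "norm (beta_kernel \<gamma> (s + of_nat (Suc m)))"]
      by simp
    thus ?thesis using Suc by simp
  qed simp
  thus thesis by (rule that)
qed

section \<open>Gauss's theorem for 2F1(a,b;e;1) / Gamma(e)\<close>

definition gauss_term :: "complex \<Rightarrow> complex \<Rightarrow> complex \<Rightarrow> nat \<Rightarrow> complex" where
  "gauss_term a b e k = pochhammer a k * pochhammer b k / fact k * rGamma (e + of_nat k)"

lemma gauss_term_Suc:
  "gauss_term a b e (Suc k) * ((1 + of_nat k) * (e + of_nat k)) = gauss_term a b e k * ((a + of_nat k) * (b + of_nat k))"
proof -
  have cancel: "(pa * xa) * (pb * xb) / (N * F) * r1 * (N * y) = pa * pb / F * (r1 * y) * (xa * xb)"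
    if "N \<noteq> 0" for pa xa pb xb N F r1 y :: complex
    using that by (cases "F = 0") (simp_all add: field_simps)
  have "(1 + of_nat k :: complex) = of_nat (Suc k)" by simp
  thus ?thesis
    unfolding gauss_term_def pochhammer_Suc fact_Suc
    using cancel[of "of_nat (Suc k)"] rGamma_Suc[of e k] of_nat_neq_0[of k, where 'a = complex]
    by (simp del: of_nat_Suc)
qed

lemma gauss_term_rec:
  "gauss_term a b e (Suc k) * (\<Prod>i<2. [1, e] ! i + of_nat k) = gauss_term a b e k * (\<Prod>i<2. [a, b] ! i + of_nat k)"
  using gauss_term_Suc[of a b e k] by (simp add: numeral_2_eq_2 lessThan_Suc mult_ac)

lemma gauss_term_summable:
  assumes "Re (e - a - b) > 0"
  shows "summable (\<lambda>k. norm (gauss_term a b e k))"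
  by (rule hypergeometric_summable[where l = "\<lambda>i. [1, e] ! i" and u = "\<lambda>i. [a, b] ! i" and k = 2])
     (use assms gauss_term_rec in \<open>auto simp: numeral_2_eq_2 lessThan_Suc\<close>)

lemma gauss_term_null:
  assumes "Re (e - a - b) > 0"
  shows "(\<lambda>k. of_nat k * gauss_term a b e k) \<longlonglongrightarrow> 0"
proof -
  define p where "p = 1 + Re (e - a - b) / 2"
  have p: "p > 1" using assms by (simp add: p_def)
  obtain B N where BN: "N > 0" "\<And>n. n \<ge> N \<Longrightarrow> norm (gauss_term a b e n) \<le> B * real n powr (- p)"
  proof (rule hypergeometric_term_decay[where p = p, OF gauss_term_rec])
    show "p < Re ((\<Sum>i<2. [1, e] ! i) - (\<Sum>i<2. [a, b] ! i))"
      using assms by (simp add: numeral_2_eq_2 lessThan_Suc p_def)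
  qed (use p in auto)
  show ?thesis
  proof (rule Lim_null_comparison)
    have "((\<lambda>x. B * x powr (1 - p)) \<longlongrightarrow> 0) at_top" using p by real_asymp
    thus "(\<lambda>n. B * real n powr (1 - p)) \<longlonglongrightarrow> 0"
      by (rule filterlim_compose[OF _ filterlim_real_sequentially])
    show "\<forall>\<^sub>F n in sequentially. norm (of_nat n * gauss_term a b e n) \<le> B * real n powr (1 - p)"
      using eventually_ge_at_top[of N]
    proof eventually_elim
      case (elim n)
      have "norm (of_nat n * gauss_term a b e n) \<le> real n * (B * real n powr (- p))"
        using BN elim by (simp add: norm_mult mult_left_mono)
      also have "\<dots> = B * real n powr (1 - p)"
        using BN elim by (simp add: powr_diff powr_minus field_simps)
      finally show ?case .
    qed
  qed
qed

text \<open>The combination of summands telescopes with G(k) equal to -k times the k-th term, and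
  \<open>gauss_term_null\<close> removes the boundary term. The relation allows e to be raised to
  where the first term dominates the sum.\<close>

lemma gauss_contiguous:
  assumes "Re (e - a - b) > 0"
  shows "(e - a - b) * suminf (gauss_term a b e) = (e - a) * (e - b) * suminf (gauss_term a b (e + 1))"
proof -
  define G where "G = (\<lambda>k. - of_nat k * gauss_term a b e k)"
  have "(\<lambda>k. - (of_nat k * gauss_term a b e k)) \<longlonglongrightarrow> - 0"
    by (intro tendsto_minus gauss_term_null assms)
  hence "G \<longlonglongrightarrow> 0" by (simp add: G_def)
  hence sums: "(\<lambda>k. G (Suc k) - G k) sums (0 - G 0)" by (rule telescope_sums)
  have eq: "(e - a - b) * gauss_term a b e k - (e - a) * (e - b) * gauss_term a b (e + 1) k = G (Suc k) - G k" for k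
  proof -
    let ?w = "gauss_term a b (e + 1) k"
    have "rGamma (e + of_nat k) = rGamma (e + 1 + of_nat k) * (e + of_nat k)"
      using rGamma_Suc[of e k] by (simp add: add_ac)
    hence w: "gauss_term a b e k = ?w * (e + of_nat k)" by (simp add: gauss_term_def)
    have "(1 + of_nat k :: complex) \<noteq> 0" using of_nat_neq_0[of k, where 'a = complex] by simp
    moreover have "gauss_term a b e (Suc k) * (1 + of_nat k) = ?w * ((a + of_nat k) * (b + of_nat k))"
    proof -
      have "pa * xa * (pb * xb) / (N * F) * r * N = pa * pb / F * r * (xa * xb)"
        if "N \<noteq> 0" for pa xa pb xb N F r :: complex
        using that by (cases "F = 0") (simp_all add: field_simps)
      from this[of "of_nat (Suc k)"] show ?thesis
        unfolding gauss_term_def pochhammer_Suc fact_Suc using of_nat_neq_0[of k, where 'a = complex]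
        by (simp add: add_ac)
    qed
    ultimately show ?thesis
      unfolding G_def w by (simp add: algebra_simps)
  qed
  have "(\<lambda>k. (e - a - b) * gauss_term a b e k - (e - a) * (e - b) * gauss_term a b (e + 1) k) sums
      ((e - a - b) * suminf (gauss_term a b e) - (e - a) * (e - b) * suminf (gauss_term a b (e + 1)))"
    using assms
    by (intro sums_diff sums_mult summable_sums summable_norm_cancel[OF gauss_term_summable]) auto
  hence "(e - a - b) * suminf (gauss_term a b e) - (e - a) * (e - b) * suminf (gauss_term a b (e + 1)) = 0 - G 0"
    using sums unfolding eq by (rule sums_unique2)
  thus ?thesis by (simp add: G_def)
qed

text \<open>After the scaling only the term k = 0 survives in the limit. Re e > 0 makes the
  Pochhammer symbol of e+k at least as large in norm as that of e, which gives a majorant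
  independent of n.\<close>

lemma gauss_limit:
  assumes "Re (e - a - b) > 0" "Re e > 0"
  shows "(\<lambda>n. suminf (gauss_term a b (e + of_nat (Suc n))) * (fact n * exp (e * of_real (ln (of_nat n))))) \<longlonglongrightarrow> 1"
proof -
  define x where "x = (\<lambda>n. fact n * exp (e * of_real (ln (of_nat n))) :: complex)"
  define t where "t = (\<lambda>k n. gauss_term a b (e + of_nat (Suc n)) k * x n)"
  have notin: "e + of_nat k \<notin> \<int>\<^sub>\<le>\<^sub>0" for k
    using assms by (intro Re_pos_not_nonpos_Int) auto
  have poch_nz: "pochhammer (e + of_nat k) n \<noteq> 0" for k n
    using notin pochhammer_eq_0_imp_nonpos_Int by blast
  have "(\<lambda>n. Gamma_series e n) \<longlonglongrightarrow> Gamma e" by (rule Gamma_series_LIMSEQ)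
  hence "Bseq (\<lambda>n. Gamma_series e n)" by (intro convergent_imp_Bseq) (auto simp: convergent_def)
  then obtain B where B: "\<And>n. norm (Gamma_series e n) \<le> B" by (auto elim!: BseqE)
  have bound: "norm (t k n) \<le> B * norm (gauss_term a b e k)" for k n
  proof -
    have "rGamma (e + of_nat k) = pochhammer (e + of_nat k) (Suc n) * rGamma (e + of_nat k + of_nat (Suc n))"
      by (rule pochhammer_rGamma)
    hence "rGamma (e + of_nat (Suc n) + of_nat k) = rGamma (e + of_nat k) / pochhammer (e + of_nat k) (Suc n)"
      using poch_nz[of k "Suc n"] by (simp add: field_simps add_ac)
    hence "gauss_term a b (e + of_nat (Suc n)) k = gauss_term a b e k / pochhammer (e + of_nat k) (Suc n)"
      by (simp add: gauss_term_def)
    hence "norm (t k n) = norm (gauss_term a b e k) * (norm (x n) / norm (pochhammer (e + of_nat k) (Suc n)))"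
      by (simp add: t_def norm_mult norm_divide)
    moreover have "norm (x n) / norm (pochhammer (e + of_nat k) (Suc n)) \<le> norm (x n) / norm (pochhammer e (Suc n))"
    proof (rule divide_left_mono)
      show "norm (pochhammer e (Suc n)) \<le> norm (pochhammer (e + of_nat k) (Suc n))"
        unfolding pochhammer_prod prod_norm[symmetric]
      proof (intro prod_mono conjI)
        fix i
        show "norm (e + of_nat i) \<le> norm (e + of_nat k + of_nat i)"
          unfolding cmod_def using assms(2) by (intro real_sqrt_le_mono add_mono) (auto intro!: power_mono)
      qed auto
      show "0 < norm (pochhammer (e + of_nat k) (Suc n)) * norm (pochhammer e (Suc n))"
        using poch_nz[of k "Suc n"] poch_nz[of 0 "Suc n"] by simp
    qed simp
    moreover have "norm (x n) / norm (pochhammer e (Suc n)) = norm (Gamma_series e n)"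
      by (simp add: x_def Gamma_series_def norm_divide)
    ultimately have "norm (t k n) = norm (gauss_term a b e k) * (norm (x n) / norm (pochhammer (e + of_nat k) (Suc n)))"
      "norm (x n) / norm (pochhammer (e + of_nat k) (Suc n)) \<le> B"
      using B[of n] by simp_all
    thus ?thesis
      by (metis mult.commute mult_left_mono norm_ge_zero)
  qed
  have lim: "(\<lambda>n. t k n) \<longlonglongrightarrow> (if k = 0 then 1 else 0)" for k
  proof (cases "k = 0")
    case True
    thus ?thesis using rGamma_shift_limit[of e] by (simp add: t_def gauss_term_def x_def)
  next
    case False
    have real_lim: "(\<lambda>n. exp (- (real k * ln (real n)))) \<longlonglongrightarrow> 0"
      using False by real_asymp
    have "(\<lambda>n. of_real (exp (- (real k * ln (real n)))) :: complex) \<longlonglongrightarrow> of_real 0"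
      by (intro tendsto_of_real real_lim)
    hence "(\<lambda>n. pochhammer a k * pochhammer b k / fact k *
        (rGamma (e + of_nat k + of_nat (Suc n)) * (fact n * exp ((e + of_nat k) * of_real (ln (of_nat n)))))
        * of_real (exp (- (real k * ln (real n))))) \<longlonglongrightarrow> pochhammer a k * pochhammer b k / fact k * 1 * of_real 0"
      by (intro tendsto_mult tendsto_const rGamma_shift_limit)
    moreover have "pochhammer a k * pochhammer b k / fact k *
        (rGamma (e + of_nat k + of_nat (Suc n)) * (fact n * exp ((e + of_nat k) * of_real (ln (of_nat n)))))
        * of_real (exp (- (real k * ln (real n)))) = t k n" for n
    proof -
      have "exp ((e + of_nat k) * of_real (ln (of_nat n))) * of_real (exp (- (real k * ln (real n))))
          = exp (e * of_real (ln (of_nat n)))"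
        by (simp add: exp_of_real[symmetric] exp_add[symmetric] algebra_simps)
      thus ?thesis
        by (simp add: t_def gauss_term_def x_def add_ac mult_ac)
    qed
    ultimately have "t k \<longlonglongrightarrow> pochhammer a k * pochhammer b k / fact k * 1 * of_real 0"
      by (simp only:)
    thus ?thesis using False by simp
  qed
  have "summable (\<lambda>k. B * norm (gauss_term a b e k))"
    by (intro summable_mult gauss_term_summable assms)
  hence "(\<lambda>n. suminf (\<lambda>k. t k n)) \<longlonglongrightarrow> suminf (\<lambda>k. if k = 0 then 1 else 0 :: complex)"
    by (rule tannerys_theorem[OF lim always_eventually, THEN conjunct2, THEN conjunct2, rotated])
       (auto simp: bound)
  moreover have "suminf (\<lambda>k. if k = 0 then 1 else 0 :: complex) = 1"
    by (subst suminf_finite[of "{0}"]) auto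
  moreover have "suminf (\<lambda>k. t k n) = suminf (gauss_term a b (e + of_nat (Suc n))) * x n" for n
    unfolding t_def using assms
    by (intro suminf_mult2[symmetric] summable_norm_cancel[OF gauss_term_summable]) auto
  ultimately show ?thesis by (simp add: x_def)
qed

lemma exp_ln_nat_add:
  "exp (x * of_real (ln (of_nat n))) * exp (y * of_real (ln (of_nat n))) = exp ((x + y) * of_real (ln (of_nat n)))"
  for x y :: complex
  by (simp add: exp_add distrib_right)

text \<open>Both sides obey the same recurrence in e and behave alike as e is raised by integers, so
  their difference D vanishes. The limit is taken for Re e > 0; the shift at the end transports D =
  0 back to any e.\<close>

theorem gauss_summation:
  assumes "Re (e - a - b) > 0"
  shows "suminf (gauss_term a b e) = Gamma (e - a - b) * rGamma (e - a) * rGamma (e - b)"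
proof -
  define D where "D = (\<lambda>e. suminf (gauss_term a b e) - Gamma (e - a - b) * rGamma (e - a) * rGamma (e - b))"
  have D_rec: "(e - a - b) * D e = (e - a) * (e - b) * D (e + 1)" if "Re (e - a - b) > 0" for e
  proof -
    have "Gamma (e + 1 - a - b) = (e - a - b) * Gamma (e - a - b)"
      using Gamma_plus1[OF Re_pos_not_nonpos_Int[OF that]] by (simp add: algebra_simps)
    moreover have "rGamma (e - a) = (e - a) * rGamma (e + 1 - a)" "rGamma (e - b) = (e - b) * rGamma (e + 1 - b)"
      using rGamma_plus1[of "e - a"] rGamma_plus1[of "e - b"] by (simp_all add: algebra_simps)
    ultimately show ?thesis
      using gauss_contiguous[OF that] unfolding D_def by algebra
  qed
  have D_shift: "pochhammer (e - a - b) n * D e = pochhammer (e - a) n * pochhammer (e - b) n * D (e + of_nat n)"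
    if "Re (e - a - b) > 0" for e n
  proof (induction n)
    case (Suc n)
    have "pochhammer (e - a - b) (Suc n) * D e = (e - a - b + of_nat n) * (pochhammer (e - a - b) n * D e)"
      by (simp add: pochhammer_Suc)
    also have "\<dots> = pochhammer (e - a) n * pochhammer (e - b) n * ((e + of_nat n - a - b) * D (e + of_nat n))"
      unfolding Suc.IH by (simp add: algebra_simps)
    also have "(e + of_nat n - a - b) * D (e + of_nat n)
        = (e + of_nat n - a) * (e + of_nat n - b) * D (e + of_nat n + 1)"
      using that by (intro D_rec) simp
    finally show ?case by (simp add: pochhammer_Suc algebra_simps)
  qed simp
  have D_zero: "D e = 0" if e: "Re (e - a - b) > 0" "Re e > 0" for e
  proof -
    let ?x = "\<lambda>z n. exp (z * of_real (ln (of_nat n))) :: complex"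
    have notin: "e \<notin> \<int>\<^sub>\<le>\<^sub>0" "e - a - b \<notin> \<int>\<^sub>\<le>\<^sub>0" using e by (auto intro!: Re_pos_not_nonpos_Int)
    have series: "rGamma_series (e - a - b) n * D e
        = rGamma_series (e - a) n * rGamma_series (e - b) n * (D (e + of_nat (Suc n)) * (fact n * ?x e n))" for n
    proof -
      have "rGamma_series (e - a - b) n * (fact n * ?x (e - a - b) n) * D e
          = rGamma_series (e - a) n * (fact n * ?x (e - a) n) * (rGamma_series (e - b) n * (fact n * ?x (e - b) n))
            * D (e + of_nat (Suc n))"
        using D_shift[OF e(1), of "Suc n"] by (simp only: pochhammer_conv_rGamma_series)
      moreover have "?x (e - a) n * ?x (e - b) n = ?x (e - a - b) n * ?x e n"
        unfolding exp_ln_nat_add by (simp add: algebra_simps)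
      ultimately have "(fact n * ?x (e - a - b) n) * (rGamma_series (e - a - b) n * D e)
          = (fact n * ?x (e - a - b) n) * (rGamma_series (e - a) n * rGamma_series (e - b) n
              * (D (e + of_nat (Suc n)) * (fact n * ?x e n)))"
        by algebra
      thus ?thesis by (subst (asm) mult_cancel_left) simp
    qed
    let ?t = "\<lambda>n. suminf (gauss_term a b (e + of_nat (Suc n))) * (fact n * ?x e n)
        - Gamma (e - a - b + of_nat (Suc n)) / (fact n * ?x (e - a - b) n)
          * (rGamma (e - a + of_nat (Suc n)) * (fact n * ?x (e - a) n))
          * (rGamma (e - b + of_nat (Suc n)) * (fact n * ?x (e - b) n))"
    have "?t \<longlonglongrightarrow> 1 - 1 * 1 * 1"
      by (intro tendsto_diff tendsto_mult gauss_limit Gamma_shift_limit rGamma_shift_limit e)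
    also have "?t = (\<lambda>n. D (e + of_nat (Suc n)) * (fact n * ?x e n))"
    proof
      fix n
      have "?x (e - a) n * ?x (e - b) n = ?x (e - a - b) n * ?x e n"
        unfolding exp_ln_nat_add by (simp add: algebra_simps)
      hence "G / (fact n * ?x (e - a - b) n) * (ra * (fact n * ?x (e - a) n)) * (rb * (fact n * ?x (e - b) n))
          = G * ra * rb * (fact n * ?x e n)" for G ra rb
        by (simp add: field_simps)
      thus "?t n = D (e + of_nat (Suc n)) * (fact n * ?x e n)"
        by (simp only: D_def left_diff_distrib) (simp add: algebra_simps)
    qed
    finally have "(\<lambda>n. D (e + of_nat (Suc n)) * (fact n * ?x e n)) \<longlonglongrightarrow> 0" by simp
    hence "(\<lambda>n. rGamma_series (e - a - b) n * D e) \<longlonglongrightarrow> rGamma (e - a) * rGamma (e - b) * 0"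
      unfolding series by (intro tendsto_mult rGamma_series_LIMSEQ)
    moreover have "(\<lambda>n. rGamma_series (e - a - b) n * D e) \<longlonglongrightarrow> rGamma (e - a - b) * D e"
      by (intro tendsto_intros)
    ultimately have "rGamma (e - a - b) * D e = 0" using LIMSEQ_unique by fastforce
    thus ?thesis using notin by (simp add: rGamma_eq_zero_iff)
  qed
  obtain n :: nat where n: "real n > - Re e" using reals_Archimedean2 by blast
  have "pochhammer (e - a - b) n * D e = 0"
    unfolding D_shift[OF assms] using n assms by (subst D_zero) auto
  moreover have "pochhammer (e - a - b) n \<noteq> 0"
    using Re_pos_not_nonpos_Int[OF assms] pochhammer_eq_0_imp_nonpos_Int by blast
  ultimately have "D e = 0" by simp
  thus ?thesis by (simp add: D_def)
qed

section \<open>The nonterminating Saalschuetz formula\<close>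

text \<open>Up to Gamma factors the balanced series 3F2(a, b, s; e, 1+a+b-e+s; 1), whose lower
  parameters exceed the upper ones by 1.\<close>

definition beta_series :: "complex \<Rightarrow> complex \<Rightarrow> complex \<Rightarrow> complex \<Rightarrow> complex" where
  "beta_series a b e s = (\<Sum>k. gauss_term a b e k * beta_kernel (1 + a + b - e) (s + of_nat k))"

lemma not_nonpos_Int_add_nat: "s \<notin> \<int>\<^sub>\<le>\<^sub>0 \<Longrightarrow> s + of_nat k \<notin> \<int>\<^sub>\<le>\<^sub>0" for s :: complex
proof
  assume s: "s \<notin> \<int>\<^sub>\<le>\<^sub>0" and "s + of_nat k \<in> \<int>\<^sub>\<le>\<^sub>0"
  then obtain n where "s + of_nat k = of_int n" "n \<le> 0" by (auto elim!: nonpos_Ints_cases)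
  hence "s = of_int (n - int k)" by (simp add: algebra_simps)
  moreover have "(of_int (n - int k) :: complex) \<in> \<int>\<^sub>\<le>\<^sub>0"
    using \<open>n \<le> 0\<close> by (intro nonpos_Ints_of_int) simp
  ultimately show False using s by metis
qed

context
  fixes a b e :: complex
  assumes \<gamma>: "0 < Re (1 + a + b - e)" "Re (1 + a + b - e) < 1"
begin

lemma gauss_term_summable': "summable (\<lambda>k. norm (gauss_term a b e k))"
  using \<gamma> by (intro gauss_term_summable) simp

text \<open>With gamma = 1+a+b-e, the bound Re gamma < 1 makes the Gauss terms summable and Re gamma
  > 0 keeps the kernel bounded.\<close>

lemma beta_series_summable:
  "summable (\<lambda>k. norm (gauss_term a b e k * beta_kernel (1 + a + b - e) (s + of_nat k)))"
proof -
  obtain B where B: "\<And>n. norm (beta_kernel (1 + a + b - e) (s + of_nat n)) \<le> B"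
    using beta_kernel_bounded[of "1 + a + b - e" s] \<gamma> by auto
  show ?thesis
  proof (rule summable_comparison_test')
    show "summable (\<lambda>k. B * norm (gauss_term a b e k))" by (intro summable_mult gauss_term_summable')
    show "norm (norm (gauss_term a b e k * beta_kernel (1 + a + b - e) (s + of_nat k))) \<le> B * norm (gauss_term a b e k)" for k
      using mult_left_mono[OF B[of k], of "norm (gauss_term a b e k)"] by (simp add: norm_mult mult.commute)
  qed
qed

text \<open>The powers of k cancel exactly: k^2 from the prefactor, k^(a+b-e-1) from the Gauss term
  and k^(-(1+a+b-e)) from the kernel. So the limit need not be 0, and it becomes the inhomogeneity
  of the recurrence in s.\<close>

lemma beta_series_boundary:
  "(\<lambda>k. of_nat k * (of_nat k + e - 1) * gauss_term a b e k * beta_kernel (1 + a + b - e) (s + of_nat k))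
     \<longlonglongrightarrow> rGamma a * rGamma b"
proof -
  let ?\<gamma> = "1 + a + b - e"
  let ?x = "\<lambda>z n. exp (z * of_real (ln (of_nat n))) :: complex"
  let ?G = "\<lambda>k. of_nat k * (of_nat k + e - 1) * gauss_term a b e k * beta_kernel ?\<gamma> (s + of_nat k)"
  have lim0: "(\<lambda>n. e * of_real (1 / real n)) \<longlonglongrightarrow> e * of_real 0"
    by (intro tendsto_intros lim_1_over_n)
  have "(\<lambda>n. rGamma_series a n * rGamma_series b n
      * (rGamma (e + of_nat (Suc n)) * (fact n * ?x e n))
      * (beta_kernel ?\<gamma> (s + of_nat (Suc n)) * ?x ?\<gamma> n)
      * (1 + e * of_real (1 / real n))) \<longlonglongrightarrow> rGamma a * rGamma b * 1 * 1 * (1 + e * of_real 0)"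
    by (intro tendsto_mult tendsto_add tendsto_const lim0 rGamma_series_LIMSEQ rGamma_shift_limit beta_kernel_limit)
  moreover have "\<forall>\<^sub>F n in sequentially. rGamma_series a n * rGamma_series b n
      * (rGamma (e + of_nat (Suc n)) * (fact n * ?x e n))
      * (beta_kernel ?\<gamma> (s + of_nat (Suc n)) * ?x ?\<gamma> n)
      * (1 + e * of_real (1 / real n)) = ?G (Suc n)"
    using eventually_gt_at_top[of 0]
  proof eventually_elim
    case (elim n)
    have regroup: "ra * rb * (r * (F * xe)) * (h * xg) * z
        = m * y * ((ra * (F * xa)) * (rb * (F * xb)) / (m * F) * r) * h"
      if "xe * xg = xa * xb * N" "N * z = y" "F \<noteq> 0" "m \<noteq> 0" for ra rb r F xe h xg z m y xa xb N :: complex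
    proof -
      have "m * y * ((ra * (F * xa)) * (rb * (F * xb)) / (m * F) * r) * h = y * ra * xa * rb * F * xb * r * h"
        using that(3,4) by (simp add: field_simps)
      also have "\<dots> = ra * rb * (r * (F * xe)) * (h * xg) * z"
        using that(1,2) by algebra
      finally show ?thesis ..
    qed
    have "?x e n * ?x ?\<gamma> n = ?x (a + b) n * ?x 1 n"
      unfolding exp_ln_nat_add by (simp add: algebra_simps)
    also have "?x (a + b) n = ?x a n * ?x b n" unfolding exp_ln_nat_add ..
    also have "?x 1 n = of_nat n" using elim by (simp add: exp_of_real)
    finally have 1: "?x e n * ?x ?\<gamma> n = ?x a n * ?x b n * of_nat n" .
    have 2: "of_nat n * (1 + e * of_real (1 / real n)) = of_nat (Suc n) + e - 1"
      using elim by (simp add: field_simps)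
    show ?case
      using regroup[OF 1 2, of "fact n" "of_nat (Suc n)"]
      unfolding gauss_term_def pochhammer_conv_rGamma_series fact_Suc by (simp del: of_nat_Suc)
  qed
  ultimately have "(\<lambda>n. ?G (Suc n)) \<longlonglongrightarrow> rGamma a * rGamma b"
    by (simp only: tendsto_cong) simp
  thus ?thesis by (rule LIMSEQ_imp_Suc)
qed

text \<open>The summands telescope with the sequence of \<open>beta_series_boundary\<close>, whose
  limit is the right-hand side.\<close>

lemma beta_series_contiguous:
  assumes s: "s \<notin> \<int>\<^sub>\<le>\<^sub>0" and \<gamma>s: "1 + a + b - e + s \<notin> \<int>\<^sub>\<le>\<^sub>0"
  shows "(s + 1 + a - e) * (s + 1 + b - e) * beta_series a b e (s + 1) - s * (s + 1 - e) * beta_series a b e s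
     = rGamma a * rGamma b"
proof -
  let ?H = "beta_kernel (1 + a + b - e)"
  define G where "G = (\<lambda>k. of_nat k * (of_nat k + e - 1) * gauss_term a b e k * ?H (s + of_nat k))"
  have "(\<lambda>k. G (Suc k) - G k) sums (rGamma a * rGamma b - G 0)"
    by (rule telescope_sums) (use beta_series_boundary[of s] in \<open>simp add: G_def\<close>)
  moreover have eq: "(s + 1 + a - e) * (s + 1 + b - e) * (gauss_term a b e k * ?H (s + 1 + of_nat k))
      - s * (s + 1 - e) * (gauss_term a b e k * ?H (s + of_nat k)) = G (Suc k) - G k" for k
  proof -
    define w where "w = gauss_term a b e k"
    define h where "h = ?H (s + 1 + of_nat k)"
    define h0 where "h0 = ?H (s + of_nat k)"
    define x where "x = (of_nat k :: complex)"
    have h: "h * (1 + a + b - e + (s + x)) = (s + x) * h0"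
      using beta_kernel_plus1[OF not_nonpos_Int_add_nat[OF s, of k], of "1 + a + b - e"] by (simp add: h_def h0_def x_def add_ac)
    have "s + x \<noteq> 0" using not_nonpos_Int_add_nat[OF s, of k] by (auto simp: x_def)
    have "gauss_term a b e (Suc k) * ((1 + x) * (e + x)) = w * ((a + x) * (b + x))"
      using gauss_term_Suc[of a b e k] by (simp add: w_def x_def)
    moreover have "G (Suc k) = gauss_term a b e (Suc k) * ((1 + x) * (e + x)) * h"
      by (simp add: G_def h_def x_def algebra_simps)
    ultimately have "G (Suc k) = w * ((a + x) * (b + x)) * h" by simp
    moreover have "G k = x * (x + e - 1) * w * h0" by (simp add: G_def w_def h0_def x_def)
    moreover have "(s + x) * ((s + 1 + a - e) * (s + 1 + b - e) * (w * h) - s * (s + 1 - e) * (w * h0))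
        = (s + x) * (w * ((a + x) * (b + x)) * h - x * (x + e - 1) * w * h0)"
      using h by algebra
    ultimately show ?thesis
      using \<open>s + x \<noteq> 0\<close> by (simp only: w_def[symmetric] h_def[symmetric] h0_def[symmetric] mult_cancel_left) simp
  qed
  moreover have "(\<lambda>k. (s + 1 + a - e) * (s + 1 + b - e) * (gauss_term a b e k * ?H (s + 1 + of_nat k))
      - s * (s + 1 - e) * (gauss_term a b e k * ?H (s + of_nat k)))
      sums ((s + 1 + a - e) * (s + 1 + b - e) * beta_series a b e (s + 1) - s * (s + 1 - e) * beta_series a b e s)"
    unfolding beta_series_def
    by (intro sums_diff sums_mult summable_sums summable_norm_cancel[OF beta_series_summable])
  ultimately have "(s + 1 + a - e) * (s + 1 + b - e) * beta_series a b e (s + 1) - s * (s + 1 - e) * beta_series a b e s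
      = rGamma a * rGamma b - G 0"
    using sums_unique2 by (simp only: eq)
  thus ?thesis by (simp add: G_def)
qed

lemma beta_series_limit:
  "(\<lambda>n. beta_series a b e (s + of_nat (Suc n)) * exp ((1 + a + b - e) * of_real (ln (of_nat n))))
     \<longlonglongrightarrow> suminf (gauss_term a b e)"
proof -
  let ?\<gamma> = "1 + a + b - e"
  let ?x = "\<lambda>n. exp (?\<gamma> * of_real (ln (of_nat n))) :: complex"
  define t where "t = (\<lambda>k n. gauss_term a b e k * beta_kernel ?\<gamma> (s + of_nat (Suc n) + of_nat k) * ?x n)"
  obtain B where B: "\<And>n. norm (beta_kernel ?\<gamma> (s + of_nat (Suc n))) * exp (Re ?\<gamma> * ln (of_nat n)) \<le> B"
    using beta_kernel_bound by blast
  have bound: "norm (t k n) \<le> B * norm (gauss_term a b e k)" for k n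
  proof -
    let ?h = "beta_kernel ?\<gamma> (s + of_nat (Suc n) + of_nat k)"
    have eq: "s + of_nat (Suc n) + of_nat k = s + of_nat (Suc (n + k))" by simp
    have "ln (real n) \<le> ln (real (n + k))" by (cases "n = 0"; cases "k = 0") auto
    hence "exp (Re ?\<gamma> * ln (of_nat n)) \<le> exp (Re ?\<gamma> * ln (of_nat (n + k)))"
      using \<gamma> by (simp add: mult_left_mono)
    hence "norm ?h * exp (Re ?\<gamma> * ln (of_nat n)) \<le> norm ?h * exp (Re ?\<gamma> * ln (of_nat (n + k)))"
      by (intro mult_left_mono) auto
    also have "\<dots> \<le> B" unfolding eq by (rule B)
    finally have "norm (gauss_term a b e k) * (norm ?h * exp (Re ?\<gamma> * ln (of_nat n))) \<le> norm (gauss_term a b e k) * B"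
      by (intro mult_left_mono) auto
    thus ?thesis by (simp add: t_def norm_mult mult_ac)
  qed
  have lim: "(\<lambda>n. t k n) \<longlonglongrightarrow> gauss_term a b e k" for k
  proof -
    have real_lim: "(\<lambda>n. ln (real n) - ln (real n + real k)) \<longlonglongrightarrow> 0" by real_asymp
    have "(\<lambda>n. exp (?\<gamma> * of_real (ln (real n) - ln (real n + real k)))) \<longlonglongrightarrow> exp (?\<gamma> * of_real 0)"
      by (intro tendsto_intros real_lim)
    hence "(\<lambda>n. gauss_term a b e k * (beta_kernel ?\<gamma> (s + of_nat (Suc (n + k))) * ?x (n + k))
        * exp (?\<gamma> * of_real (ln (real n) - ln (real n + real k)))) \<longlonglongrightarrow> gauss_term a b e k * 1 * exp (?\<gamma> * of_real 0)"
      by (intro tendsto_mult tendsto_const LIMSEQ_ignore_initial_segment[OF beta_kernel_limit])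
    moreover have "gauss_term a b e k * (beta_kernel ?\<gamma> (s + of_nat (Suc (n + k))) * ?x (n + k))
        * exp (?\<gamma> * of_real (ln (real n) - ln (real n + real k))) = t k n" for n
    proof -
      have "?x (n + k) * exp (?\<gamma> * of_real (ln (real n) - ln (real n + real k))) = ?x n"
        by (simp add: exp_add[symmetric] right_diff_distrib of_real_diff)
      thus ?thesis by (simp add: t_def mult.assoc add_ac)
    qed
    ultimately show ?thesis by simp
  qed
  have "summable (\<lambda>k. B * norm (gauss_term a b e k))"
    by (intro summable_mult gauss_term_summable')
  hence "(\<lambda>n. suminf (\<lambda>k. t k n)) \<longlonglongrightarrow> suminf (gauss_term a b e)"
    by (rule tannerys_theorem[OF lim always_eventually, THEN conjunct2, THEN conjunct2, rotated])
       (auto simp: bound)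
  moreover have "suminf (\<lambda>k. t k n) = beta_series a b e (s + of_nat (Suc n)) * ?x n" for n
    unfolding t_def beta_series_def
    by (intro suminf_mult2[symmetric] summable_norm_cancel[OF beta_series_summable])
  ultimately show ?thesis by simp
qed

end

definition cos_pi :: "complex \<Rightarrow> complex" where
  "cos_pi z = cos (of_real pi * z)"

lemma sin_pi_diff: "sin_pi (x - y) = sin_pi x * cos_pi y - cos_pi x * sin_pi y"
  by (simp add: sin_pi_def cos_pi_def right_diff_distrib sin_diff)

lemma cos_pi_diff: "cos_pi (x - y) = cos_pi x * cos_pi y + sin_pi x * sin_pi y"
  by (simp add: sin_pi_def cos_pi_def right_diff_distrib cos_diff)

lemma sin_pi_add: "sin_pi (x + y) = sin_pi x * cos_pi y + cos_pi x * sin_pi y"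
  by (simp add: sin_pi_def cos_pi_def distrib_left sin_add)

lemma cos_pi_add: "cos_pi (x + y) = cos_pi x * cos_pi y - sin_pi x * sin_pi y"
  by (simp add: sin_pi_def cos_pi_def distrib_left cos_add)

lemma sin_pi_minus [simp]: "sin_pi (- x) = - sin_pi x"
  and cos_pi_minus [simp]: "cos_pi (- x) = cos_pi x"
  by (simp_all add: sin_pi_def cos_pi_def)

lemma sin_cos_pi_squared: "sin_pi x * sin_pi x + cos_pi x * cos_pi x = 1"
  using sin_cos_squared_add[of "of_real pi * x"] by (simp add: sin_pi_def cos_pi_def power2_eq_square)

lemma rGamma_reflection_sin_pi: "rGamma z * rGamma (1 - z) = sin_pi z / of_real pi"
  by (simp add: rGamma_reflection_complex sin_pi_def)

text \<open>The leading coefficient of the left side of the Saalschuetz formula for large s. Gauss's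
  theorem and reflection reduce it to sin(e-a) sin(e-b) - sin a sin b = sin e sin(e-a-b), all
  arguments times pi.\<close>

lemma gauss_constants:
  assumes "0 < Re (1 + a + b - e)" "Re (1 + a + b - e) < 1"
  shows "rGamma (1 + a - e) * rGamma (1 + b - e) * suminf (gauss_term a b e)
      - rGamma a * rGamma b * suminf (gauss_term (1 + a - e) (1 + b - e) (2 - e))
     = rGamma (1 + a + b - e) * (sin_pi e / of_real pi)"
proof -
  let ?z = "e - a - b"
  have z: "Re ?z > 0" using assms by simp
  have g1: "suminf (gauss_term a b e) = Gamma ?z * rGamma (e - a) * rGamma (e - b)"
    by (rule gauss_summation[OF z])
  have g2: "suminf (gauss_term (1 + a - e) (1 + b - e) (2 - e)) = Gamma ?z * rGamma (1 - a) * rGamma (1 - b)"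
    using gauss_summation[of "2 - e" "1 + a - e" "1 + b - e"] z by (simp add: algebra_simps)
  have r: "rGamma (e - a) * rGamma (1 + a - e) = sin_pi (e - a) / of_real pi"
    "rGamma (e - b) * rGamma (1 + b - e) = sin_pi (e - b) / of_real pi"
    using rGamma_reflection_sin_pi[of "e - a"] rGamma_reflection_sin_pi[of "e - b"] by (simp_all add: algebra_simps)
  have trig: "sin_pi (e - a) * sin_pi (e - b) - sin_pi a * sin_pi b = sin_pi e * sin_pi ?z"
    unfolding sin_pi_diff cos_pi_diff
    using sin_cos_pi_squared[of a] sin_cos_pi_squared[of b] sin_cos_pi_squared[of e] by algebra
  have refl: "Gamma ?z * (sin_pi ?z / of_real pi) = rGamma (1 + a + b - e)"
  proof -
    have "Gamma ?z * rGamma ?z = 1"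
      using Re_pos_not_nonpos_Int[OF z] by (simp add: rGamma_inverse_Gamma Gamma_eq_zero_iff)
    hence "Gamma ?z * (rGamma ?z * rGamma (1 - ?z)) = rGamma (1 - ?z)"
      by (simp only: mult.assoc[symmetric] mult_1_left)
    also have "1 - ?z = 1 + a + b - e" by simp
    also have "rGamma ?z * rGamma (1 + a + b - e) = sin_pi ?z / of_real pi"
      using rGamma_reflection_sin_pi[of ?z] by (simp only: \<open>1 - ?z = 1 + a + b - e\<close>)
    finally show ?thesis .
  qed
  have "rGamma (1 + a - e) * rGamma (1 + b - e) * suminf (gauss_term a b e)
      - rGamma a * rGamma b * suminf (gauss_term (1 + a - e) (1 + b - e) (2 - e))
      = Gamma ?z * ((rGamma (e - a) * rGamma (1 + a - e)) * (rGamma (e - b) * rGamma (1 + b - e))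
          - (rGamma a * rGamma (1 - a)) * (rGamma b * rGamma (1 - b)))"
    unfolding g1 g2 by (simp add: algebra_simps)
  also have "\<dots> = Gamma ?z * (sin_pi (e - a) * sin_pi (e - b) - sin_pi a * sin_pi b) / (of_real pi * of_real pi)"
    unfolding r rGamma_reflection_sin_pi by (simp add: field_simps)
  also have "\<dots> = (Gamma ?z * (sin_pi ?z / of_real pi)) * (sin_pi e / of_real pi)"
    unfolding trig by (simp add: field_simps)
  finally show ?thesis unfolding refl .
qed

text \<open>The second series obeys the recurrence of the first with another inhomogeneity, and the
  weights make the two cancel. The combination and the Gamma product then satisfy one homogeneous
  recurrence in s with the same leading asymptotics under s -> s+n, so their difference is
  0.\<close>

theorem nonterminating_saalschuetz:
  assumes \<gamma>: "0 < Re (1 + a + b - e)" "Re (1 + a + b - e) < 1"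
    and "s \<notin> \<int>\<^sub>\<le>\<^sub>0" "s + 1 - e \<notin> \<int>\<^sub>\<le>\<^sub>0" "1 + a + b - e + s \<notin> \<int>\<^sub>\<le>\<^sub>0" "1 + a + b - e + (s + 1 - e) \<notin> \<int>\<^sub>\<le>\<^sub>0"
  shows "rGamma (1 + a - e) * rGamma (1 + b - e) * beta_series a b e s
      - rGamma a * rGamma b * beta_series (1 + a - e) (1 + b - e) (2 - e) (s + 1 - e)
     = rGamma (1 + a + b - e) * (sin_pi e / of_real pi)
       * (Gamma s * Gamma (s + 1 - e) * rGamma (s + 1 + a - e) * rGamma (s + 1 + b - e))"
proof -
  let ?\<gamma> = "1 + a + b - e"
  let ?x = "\<lambda>z n. exp (z * of_real (ln (of_nat n))) :: complex"
  define \<sigma> where "\<sigma> = rGamma ?\<gamma> * (sin_pi e / of_real pi)"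
  define R where "R = (\<lambda>s. Gamma s * Gamma (s + 1 - e) * rGamma (s + 1 + a - e) * rGamma (s + 1 + b - e))"
  define W where "W = (\<lambda>s. rGamma (1 + a - e) * rGamma (1 + b - e) * beta_series a b e s
      - rGamma a * rGamma b * beta_series (1 + a - e) (1 + b - e) (2 - e) (s + 1 - e))"
  define D where "D = (\<lambda>s. W s - \<sigma> * R s)"
  define good where "good = (\<lambda>s. s \<notin> \<int>\<^sub>\<le>\<^sub>0 \<and> s + 1 - e \<notin> \<int>\<^sub>\<le>\<^sub>0 \<and> ?\<gamma> + s \<notin> \<int>\<^sub>\<le>\<^sub>0 \<and> ?\<gamma> + (s + 1 - e) \<notin> \<int>\<^sub>\<le>\<^sub>0)"
  have good_shift: "good (s + of_nat n)" if "good s" for s n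
    using that not_nonpos_Int_add_nat[of s n] not_nonpos_Int_add_nat[of "s + 1 - e" n]
      not_nonpos_Int_add_nat[of "?\<gamma> + s" n] not_nonpos_Int_add_nat[of "?\<gamma> + (s + 1 - e)" n]
    by (simp add: good_def algebra_simps)
  have \<gamma>2: "1 + (1 + a - e) + (1 + b - e) - (2 - e) = ?\<gamma>" by simp
  have \<gamma>': "0 < Re (1 + (1 + a - e) + (1 + b - e) - (2 - e))" "Re (1 + (1 + a - e) + (1 + b - e) - (2 - e)) < 1"
    unfolding \<gamma>2 by (fact \<gamma>)+
  have D_rec: "(s + 1 + a - e) * (s + 1 + b - e) * D (s + 1) = s * (s + 1 - e) * D s" if "good s" for s
  proof -
    have 1: "(s + 1 + a - e) * (s + 1 + b - e) * beta_series a b e (s + 1)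
        - s * (s + 1 - e) * beta_series a b e s = rGamma a * rGamma b"
      using that by (intro beta_series_contiguous \<gamma>) (auto simp: good_def)
    have 2: "(s + 1 + a - e) * (s + 1 + b - e) * beta_series (1 + a - e) (1 + b - e) (2 - e) (s + 1 + 1 - e)
        - s * (s + 1 - e) * beta_series (1 + a - e) (1 + b - e) (2 - e) (s + 1 - e)
        = rGamma (1 + a - e) * rGamma (1 + b - e)"
      using beta_series_contiguous[OF \<gamma>', of "s + 1 - e"] that
      by (simp add: good_def algebra_simps)
    have "Gamma (s + 1) = s * Gamma s" "Gamma (s + 1 + 1 - e) = (s + 1 - e) * Gamma (s + 1 - e)"
      using Gamma_plus1[of s] Gamma_plus1[of "s + 1 - e"] that by (auto simp: good_def algebra_simps)
    moreover have "rGamma (s + 1 + a - e) = (s + 1 + a - e) * rGamma (s + 1 + 1 + a - e)"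
      "rGamma (s + 1 + b - e) = (s + 1 + b - e) * rGamma (s + 1 + 1 + b - e)"
      using rGamma_plus1[of "s + 1 + a - e"] rGamma_plus1[of "s + 1 + b - e"] by (simp_all add: algebra_simps)
    ultimately show ?thesis
      using 1 2 unfolding D_def W_def R_def by algebra
  qed
  have D_shift: "pochhammer (s + 1 + a - e) n * pochhammer (s + 1 + b - e) n * D (s + of_nat n)
      = pochhammer s n * pochhammer (s + 1 - e) n * D s" if "good s" for s n
  proof (induction n)
    case (Suc n)
    have "(s + of_nat n + 1 + a - e) * (s + of_nat n + 1 + b - e) * D (s + of_nat n + 1)
        = (s + of_nat n) * (s + of_nat n + 1 - e) * D (s + of_nat n)"
      by (intro D_rec good_shift that)
    moreover have "D (s + of_nat (Suc n)) = D (s + of_nat n + 1)" by (simp add: add_ac)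
    ultimately show ?case
      using Suc.IH unfolding pochhammer_Suc by algebra
  qed simp
  have "good s" using assms by (simp add: good_def)
  have series: "rGamma_series s n * rGamma_series (s + 1 - e) n * D s
      = rGamma_series (s + 1 + a - e) n * rGamma_series (s + 1 + b - e) n * (D (s + of_nat (Suc n)) * ?x ?\<gamma> n)" for n
  proof -
    have "rGamma_series (s + 1 + a - e) n * (fact n * ?x (s + 1 + a - e) n)
          * (rGamma_series (s + 1 + b - e) n * (fact n * ?x (s + 1 + b - e) n)) * D (s + of_nat (Suc n))
        = rGamma_series s n * (fact n * ?x s n) * (rGamma_series (s + 1 - e) n * (fact n * ?x (s + 1 - e) n)) * D s"
      using D_shift[OF \<open>good s\<close>, of "Suc n"] by (simp only: pochhammer_conv_rGamma_series)
    moreover have "?x (s + 1 + a - e) n * ?x (s + 1 + b - e) n = ?x s n * ?x (s + 1 - e) n * ?x ?\<gamma> n"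
      unfolding exp_ln_nat_add by (simp add: algebra_simps)
    ultimately have "(fact n * ?x s n * (fact n * ?x (s + 1 - e) n)) * (rGamma_series s n * rGamma_series (s + 1 - e) n * D s)
        = (fact n * ?x s n * (fact n * ?x (s + 1 - e) n))
          * (rGamma_series (s + 1 + a - e) n * rGamma_series (s + 1 + b - e) n * (D (s + of_nat (Suc n)) * ?x ?\<gamma> n))"
      by algebra
    thus ?thesis by (subst (asm) mult_cancel_left) simp
  qed
  have W_lim: "(\<lambda>n. W (s + of_nat (Suc n)) * ?x ?\<gamma> n) \<longlonglongrightarrow> \<sigma>"
  proof -
    have "(\<lambda>n. rGamma (1 + a - e) * rGamma (1 + b - e) * (beta_series a b e (s + of_nat (Suc n)) * ?x ?\<gamma> n)
        - rGamma a * rGamma b * (beta_series (1 + a - e) (1 + b - e) (2 - e) (s + 1 - e + of_nat (Suc n))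
            * ?x (1 + (1 + a - e) + (1 + b - e) - (2 - e)) n))
        \<longlonglongrightarrow> rGamma (1 + a - e) * rGamma (1 + b - e) * suminf (gauss_term a b e)
          - rGamma a * rGamma b * suminf (gauss_term (1 + a - e) (1 + b - e) (2 - e))"
      by (intro tendsto_diff tendsto_mult tendsto_const beta_series_limit \<gamma> \<gamma>')
    moreover have "s + 1 - e + of_nat (Suc n) = s + of_nat (Suc n) + 1 - e" for n by simp
    ultimately show ?thesis
      unfolding gauss_constants[OF \<gamma>] \<gamma>2 W_def \<sigma>_def left_diff_distrib by (simp only: mult.assoc)
  qed
  have R_lim: "(\<lambda>n. R (s + of_nat (Suc n)) * ?x ?\<gamma> n) \<longlonglongrightarrow> 1"
  proof -
    let ?t = "\<lambda>n. Gamma (s + of_nat (Suc n)) / (fact n * ?x s n)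
        * (Gamma (s + 1 - e + of_nat (Suc n)) / (fact n * ?x (s + 1 - e) n))
        * (rGamma (s + 1 + a - e + of_nat (Suc n)) * (fact n * ?x (s + 1 + a - e) n))
        * (rGamma (s + 1 + b - e + of_nat (Suc n)) * (fact n * ?x (s + 1 + b - e) n))"
    have "?t \<longlonglongrightarrow> 1 * 1 * 1 * 1"
      by (intro tendsto_mult Gamma_shift_limit rGamma_shift_limit)
    also have "?t = (\<lambda>n. R (s + of_nat (Suc n)) * ?x ?\<gamma> n)"
    proof
      fix n
      have regroup: "G1 / (F * x1) * (G2 / (F * x2)) * (r3 * (F * x3)) * (r4 * (F * x4)) = G1 * G2 * r3 * r4 * x"
        if "x3 * x4 = x1 * x2 * x" "x1 \<noteq> 0" "x2 \<noteq> 0" "F \<noteq> 0" for G1 G2 r3 r4 F x1 x2 x3 x4 x :: complex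
      proof -
        have "G1 / (F * x1) * (G2 / (F * x2)) * (r3 * (F * x3)) * (r4 * (F * x4))
            = G1 * G2 * r3 * r4 * (x3 * x4) / (x1 * x2)"
          using that(4) by simp
        thus ?thesis using that(1-3) by simp
      qed
      have "?x (s + 1 + a - e) n * ?x (s + 1 + b - e) n = ?x s n * ?x (s + 1 - e) n * ?x ?\<gamma> n"
        unfolding exp_ln_nat_add by (simp add: algebra_simps)
      hence eq: "?t n = Gamma (s + of_nat (Suc n)) * Gamma (s + 1 - e + of_nat (Suc n)) * rGamma (s + 1 + a - e + of_nat (Suc n))
          * rGamma (s + 1 + b - e + of_nat (Suc n)) * ?x ?\<gamma> n"
        by (rule regroup) auto
      have "z + 1 + y - e + of_nat (Suc n) = z + of_nat (Suc n) + 1 + y - e"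
        "z + 1 - e + of_nat (Suc n) = z + of_nat (Suc n) + 1 - e" for z y by simp_all
      thus "?t n = R (s + of_nat (Suc n)) * ?x ?\<gamma> n"
        unfolding eq R_def by (simp only:)
    qed
    finally show ?thesis by simp
  qed
  have "(\<lambda>n. W (s + of_nat (Suc n)) * ?x ?\<gamma> n - \<sigma> * (R (s + of_nat (Suc n)) * ?x ?\<gamma> n)) \<longlonglongrightarrow> \<sigma> - \<sigma> * 1"
    by (intro tendsto_diff tendsto_mult tendsto_const W_lim R_lim)
  hence "(\<lambda>n. D (s + of_nat (Suc n)) * ?x ?\<gamma> n) \<longlonglongrightarrow> 0"
    by (simp add: D_def left_diff_distrib mult.assoc)
  hence "(\<lambda>n. rGamma_series s n * rGamma_series (s + 1 - e) n * D s)
      \<longlonglongrightarrow> rGamma (s + 1 + a - e) * rGamma (s + 1 + b - e) * 0"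
    unfolding series by (intro tendsto_mult rGamma_series_LIMSEQ)
  moreover have "(\<lambda>n. rGamma_series s n * rGamma_series (s + 1 - e) n * D s) \<longlonglongrightarrow> rGamma s * rGamma (s + 1 - e) * D s"
    by (intro tendsto_intros)
  ultimately have "rGamma s * rGamma (s + 1 - e) * D s = 0" using LIMSEQ_unique by fastforce
  hence "D s = 0" using \<open>good s\<close> by (simp add: rGamma_eq_zero_iff good_def)
  thus ?thesis by (simp add: D_def W_def \<sigma>_def R_def)
qed

section \<open>The two-term relation for L\<close>

lemma beta_series_bounded:
  assumes \<gamma>: "0 < Re (1 + a + b - e)" "Re (1 + a + b - e) < 1"
  obtains B where "\<And>k. norm (beta_series a b e (s + of_nat k)) \<le> B"
proof -
  obtain B where B: "\<And>n. norm (beta_kernel (1 + a + b - e) (s + of_nat n)) \<le> B"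
    using beta_kernel_bounded[of "1 + a + b - e" s] \<gamma> by auto
  have "norm (beta_series a b e (s + of_nat k)) \<le> (\<Sum>l. B * norm (gauss_term a b e l))" for k
    unfolding beta_series_def
  proof (rule norm_suminf_le)
    show "summable (\<lambda>l. B * norm (gauss_term a b e l))"
      by (intro summable_mult gauss_term_summable' \<gamma>)
    show "norm (gauss_term a b e l * beta_kernel (1 + a + b - e) (s + of_nat k + of_nat l)) \<le> B * norm (gauss_term a b e l)" for l
      using mult_left_mono[OF B[of "k + l"], of "norm (gauss_term a b e l)"]
      by (simp add: norm_mult mult.commute add.assoc)
  qed
  thus thesis by (rule that)
qed

definition double_beta_series ::
  "complex \<Rightarrow> complex \<Rightarrow> complex \<Rightarrow> complex \<Rightarrow> complex \<Rightarrow> complex \<Rightarrow> complex \<Rightarrow> complex" where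
  "double_beta_series a b e a' b' e' r = (\<Sum>k. gauss_term a b e k * beta_series a' b' e' (r + of_nat k))"

lemma double_beta_series_summable:
  assumes "0 < Re (1 + a + b - e)" "Re (1 + a + b - e) < 1" "1 + a' + b' - e' = 1 + a + b - e"
  shows "summable (\<lambda>k. gauss_term a b e k * beta_series a' b' e' (r + of_nat k))"
proof -
  obtain B where B: "\<And>k. norm (beta_series a' b' e' (r + of_nat k)) \<le> B"
    using beta_series_bounded[of a' b' e' r] assms by auto
  show ?thesis
  proof (rule summable_comparison_test')
    show "summable (\<lambda>k. B * norm (gauss_term a b e k))" by (intro summable_mult gauss_term_summable' assms)
    show "norm (gauss_term a b e k * beta_series a' b' e' (r + of_nat k)) \<le> B * norm (gauss_term a b e k)" for k
      using mult_left_mono[OF B[of k], of "norm (gauss_term a b e k)"] by (simp add: norm_mult mult.commute)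
  qed
qed

text \<open>Equal values of 1+a+b-e give both triples the same kernel, and its argument depends only
  on k+l.\<close>

lemma double_beta_series_commute:
  assumes \<gamma>: "0 < Re (1 + a + b - e)" "Re (1 + a + b - e) < 1" and \<gamma>': "1 + a' + b' - e' = 1 + a + b - e"
  shows "double_beta_series a b e a' b' e' r = double_beta_series a' b' e' a b e r"
proof -
  let ?\<gamma> = "1 + a + b - e"
  obtain B where B: "\<And>n. norm (beta_kernel ?\<gamma> (r + of_nat n)) \<le> B"
    using beta_kernel_bounded[of ?\<gamma> r] \<gamma> by auto
  have "norm (beta_kernel ?\<gamma> (r + of_nat k + of_nat l)) \<le> B" for k l
    using B[of "k + l"] by (simp add: add.assoc)
  moreover have "summable (\<lambda>l. norm (gauss_term a' b' e' l))"
    by (rule gauss_term_summable'; unfold \<gamma>'; fact \<gamma>)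
  ultimately have "(\<Sum>k. gauss_term a b e k * (\<Sum>l. gauss_term a' b' e' l * beta_kernel ?\<gamma> (r + of_nat k + of_nat l)))
      = (\<Sum>l. gauss_term a' b' e' l * (\<Sum>k. gauss_term a b e k * beta_kernel ?\<gamma> (r + of_nat k + of_nat l)))"
    using gauss_term_summable'[OF \<gamma>] by (intro suminf_swap_bounded)
  moreover have "r + of_nat k + of_nat l = r + of_nat l + of_nat k" for k l by simp
  ultimately show ?thesis
    unfolding double_beta_series_def beta_series_def \<gamma>' by (simp only:)
qed

text \<open>\<open>L\<close> times \<open>sin_pi e\<close>, written with \<open>Phi\<close> so that
  it is free of poles.\<close>

definition L_star ::
  "complex \<Rightarrow> complex \<Rightarrow> complex \<Rightarrow> complex \<Rightarrow> complex \<Rightarrow> complex \<Rightarrow> complex \<Rightarrow> complex" where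
  "L_star a b c d e f g =
     Phi a b c d e f g * A (1 + a - e) (1 + b - e) (1 + c - e) (1 + d - e)
     - Phi (1 + a - e) (1 + b - e) (1 + c - e) (1 + d - e) (2 - e) (1 + f - e) (1 + g - e) * A a b c d"

lemma gauss_term_Gamma_sum:
  assumes "c \<notin> \<int>\<^sub>\<le>\<^sub>0" "d \<notin> \<int>\<^sub>\<le>\<^sub>0" and "e + f + g - a - b - c - d = 1"
  shows "(\<Sum>k. gauss_term a b e k * (Gamma (c + of_nat k) * Gamma (d + of_nat k) * rGamma (f + of_nat k) * rGamma (g + of_nat k)))
     = Gamma c * Gamma d * Phi a b c d e f g"
proof -
  have G: "Gamma (z + of_nat k) = pochhammer z k * Gamma z" if "z \<notin> \<int>\<^sub>\<le>\<^sub>0" for z :: complex and k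
    using pochhammer_Gamma[OF that, of k] that by (simp add: Gamma_eq_zero_iff)
  have eq: "gauss_term a b e k * (Gamma (c + of_nat k) * Gamma (d + of_nat k) * rGamma (f + of_nat k) * rGamma (g + of_nat k))
      = Gamma c * Gamma d * Phi_term a b c d e f g k" for k
    unfolding G[OF assms(1)] G[OF assms(2)] gauss_term_def Phi_term_def by simp
  show ?thesis
    unfolding eq Phi_def using summable_norm_cancel[OF Phi_summable[OF assms(3)]] by (rule suminf_mult)
qed

text \<open>The four double series come from expanding the product of two
  hypergeometric functions \<open>F(a,b;1+a+b-e;y)\<close> and \<open>F(f-d,g-d;1+a+b-e;y)\<close> at \<open>y = 1\<close>, each of them by its
  connection formula, and integrating against \<open>y^(a+b-e) (1-y)^(c-1)\<close>. This integral is symmetric in the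
  two functions.\<close>

definition connected_double_series ::
  "complex \<Rightarrow> complex \<Rightarrow> complex \<Rightarrow> complex \<Rightarrow> complex \<Rightarrow> complex \<Rightarrow> complex \<Rightarrow> complex" where
  "connected_double_series a b e a' b' e' c =
     rGamma (1 + a - e) * rGamma (1 + b - e) * (rGamma (1 + a' - e') * rGamma (1 + b' - e'))
       * double_beta_series a b e a' b' e' c
     - rGamma (1 + a - e) * rGamma (1 + b - e) * (rGamma a' * rGamma b')
       * double_beta_series a b e (1 + a' - e') (1 + b' - e') (2 - e') (c + 1 - e')
     - rGamma a * rGamma b * (rGamma (1 + a' - e') * rGamma (1 + b' - e'))
       * double_beta_series (1 + a - e) (1 + b - e) (2 - e) a' b' e' (c + 1 - e)
     + rGamma a * rGamma b * (rGamma a' * rGamma b')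
       * double_beta_series (1 + a - e) (1 + b - e) (2 - e) (1 + a' - e') (1 + b' - e') (2 - e') (c + 1 - e + 1 - e')"

text \<open>Each double series is symmetric in its two triples; the two middle summands change
  places.\<close>

lemma connected_double_series_commute:
  assumes "0 < Re (1 + a + b - e)" "Re (1 + a + b - e) < 1" and "1 + a' + b' - e' = 1 + a + b - e"
  shows "connected_double_series a b e a' b' e' c = connected_double_series a' b' e' a b e c"
proof -
  have refl: "1 + (1 + x - z) + (1 + y - z) - (2 - z) = 1 + x + y - z" for x y z :: complex by simp
  have "double_beta_series a b e a' b' e' c = double_beta_series a' b' e' a b e c"
    "double_beta_series a b e (1 + a' - e') (1 + b' - e') (2 - e') (c + 1 - e')
       = double_beta_series (1 + a' - e') (1 + b' - e') (2 - e') a b e (c + 1 - e')"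
    "double_beta_series (1 + a - e) (1 + b - e) (2 - e) a' b' e' (c + 1 - e)
       = double_beta_series a' b' e' (1 + a - e) (1 + b - e) (2 - e) (c + 1 - e)"
    "double_beta_series (1 + a - e) (1 + b - e) (2 - e) (1 + a' - e') (1 + b' - e') (2 - e') (c + 1 - e + 1 - e')
       = double_beta_series (1 + a' - e') (1 + b' - e') (2 - e') (1 + a - e) (1 + b - e) (2 - e) (c + 1 - e + 1 - e')"
    by (rule double_beta_series_commute; (simp only: refl assms)?; use assms in simp; fail)+
  moreover have "c + 1 - e + 1 - e' = c + 1 - e' + 1 - e" by simp
  ultimately show ?thesis
    unfolding connected_double_series_def by (simp add: algebra_simps)
qed

text \<open>The weights group the inner sums into pairs to which the nonterminating Saalschuetz
  formula applies, and the Gamma products that it yields turn each outer sum into a 4F3. The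
  balancing condition gives the triple (f-d, g-d, 1+c-d) the same value of 1+a+b-e as (a, b,
  e).\<close>

lemma connected_double_series_eq:
  assumes \<gamma>: "0 < Re (1 + a + b - e)" "Re (1 + a + b - e) < 1"
    and bal: "e + f + g - a - b - c - d = 1"
    and pos: "Re c > 0" "Re d > 0" "Re (1 + c - e) > 0" "Re (1 + d - e) > 0"
  shows "connected_double_series a b e (f - d) (g - d) (1 + c - d) c
     = rGamma (1 + a + b - e) * (sin_pi (1 + c - d) / of_real pi)
       * (Gamma c * Gamma d * Gamma (1 + c - e) * Gamma (1 + d - e) * L_star a b c d e f g)"
proof -
  define a' b' e' where "a' = f - d" and "b' = g - d" and "e' = 1 + c - d"
  define \<kappa> where "\<kappa> = rGamma (1 + a + b - e) * (sin_pi e' / of_real pi)"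
  have \<gamma>': "1 + a' + b' - e' = 1 + a + b - e" using bal by (simp add: a'_def b'_def e'_def algebra_simps)
  have \<gamma>2: "1 + (1 + a' - e') + (1 + b' - e') - (2 - e') = 1 + a + b - e" using \<gamma>' by (simp add: algebra_simps)
  have inner: "rGamma (1 + a' - e') * rGamma (1 + b' - e') * beta_series a' b' e' s
      - rGamma a' * rGamma b' * beta_series (1 + a' - e') (1 + b' - e') (2 - e') (s + 1 - e')
      = \<kappa> * (Gamma s * Gamma (s + d - c) * rGamma (s + f - c) * rGamma (s + g - c))"
    if "Re s > 0" "Re (s + d - c) > 0" for s
  proof -
    have s: "s + 1 - e' = s + d - c" "s + 1 + a' - e' = s + f - c" "s + 1 + b' - e' = s + g - c"
      by (simp_all add: a'_def b'_def e'_def)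
    have "rGamma (1 + a' - e') * rGamma (1 + b' - e') * beta_series a' b' e' s
      - rGamma a' * rGamma b' * beta_series (1 + a' - e') (1 + b' - e') (2 - e') (s + 1 - e')
      = rGamma (1 + a' + b' - e') * (sin_pi e' / of_real pi)
       * (Gamma s * Gamma (s + 1 - e') * rGamma (s + 1 + a' - e') * rGamma (s + 1 + b' - e'))"
      by (rule nonterminating_saalschuetz)
         (unfold \<gamma>' s, use \<gamma> that in \<open>auto intro!: Re_pos_not_nonpos_Int simp: add_pos_pos\<close>)
    thus ?thesis unfolding \<gamma>' s \<kappa>_def .
  qed
  have outer: "rGamma (1 + a' - e') * rGamma (1 + b' - e') * double_beta_series x y z a' b' e' r
      - rGamma a' * rGamma b' * double_beta_series x y z (1 + a' - e') (1 + b' - e') (2 - e') (r + 1 - e')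
      = \<kappa> * (\<Sum>k. gauss_term x y z k * (Gamma (r + of_nat k) * Gamma (r + d - c + of_nat k)
          * rGamma (r + f - c + of_nat k) * rGamma (r + g - c + of_nat k)))"
    if xyz: "1 + x + y - z = 1 + a + b - e" and r: "Re r > 0" "Re (r + d - c) > 0" for x y z r
  proof -
    define P where "P = rGamma (1 + a' - e') * rGamma (1 + b' - e')"
    define Q where "Q = rGamma a' * rGamma b'"
    have summ: "summable (\<lambda>k. gauss_term x y z k * beta_series a' b' e' (r + of_nat k))"
      "summable (\<lambda>k. gauss_term x y z k * beta_series (1 + a' - e') (1 + b' - e') (2 - e') (r + 1 - e' + of_nat k))"
      by (rule double_beta_series_summable; unfold xyz \<gamma>' \<gamma>2; use \<gamma> in simp)+
    have "(\<lambda>k. P * (gauss_term x y z k * beta_series a' b' e' (r + of_nat k))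
        - Q * (gauss_term x y z k * beta_series (1 + a' - e') (1 + b' - e') (2 - e') (r + 1 - e' + of_nat k)))
        sums (P * double_beta_series x y z a' b' e' r
          - Q * double_beta_series x y z (1 + a' - e') (1 + b' - e') (2 - e') (r + 1 - e'))"
      unfolding double_beta_series_def using summ by (intro sums_diff sums_mult summable_sums)
    moreover have "P * (gauss_term x y z k * beta_series a' b' e' (r + of_nat k))
        - Q * (gauss_term x y z k * beta_series (1 + a' - e') (1 + b' - e') (2 - e') (r + 1 - e' + of_nat k))
        = \<kappa> * (gauss_term x y z k * (Gamma (r + of_nat k) * Gamma (r + d - c + of_nat k)
          * rGamma (r + f - c + of_nat k) * rGamma (r + g - c + of_nat k)))" for k
    proof -
      have s: "r + 1 - e' + of_nat k = r + of_nat k + 1 - e'" "r + w - c + of_nat k = r + of_nat k + w - c" for w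
        by simp_all
      have i: "P * beta_series a' b' e' (r + of_nat k) - Q * beta_series (1 + a' - e') (1 + b' - e') (2 - e') (r + of_nat k + 1 - e')
          = \<kappa> * (Gamma (r + of_nat k) * Gamma (r + of_nat k + d - c) * rGamma (r + of_nat k + f - c) * rGamma (r + of_nat k + g - c))"
        unfolding P_def Q_def by (rule inner) (use r in auto)
      show ?thesis unfolding s using arg_cong[OF i, of "\<lambda>t. gauss_term x y z k * t"]
        by (simp only: right_diff_distrib mult_ac)
    qed
    ultimately have sums: "(\<lambda>k. \<kappa> * (gauss_term x y z k * (Gamma (r + of_nat k) * Gamma (r + d - c + of_nat k)
          * rGamma (r + f - c + of_nat k) * rGamma (r + g - c + of_nat k))))
        sums (P * double_beta_series x y z a' b' e' r
          - Q * double_beta_series x y z (1 + a' - e') (1 + b' - e') (2 - e') (r + 1 - e'))" by (simp only:)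
    show ?thesis
    \<comment> \<open>The constant contains the sine of 1+c-d and may vanish. If it does not,
      dividing it out gives summability of the Gamma sum.\<close>
    proof (cases "\<kappa> = 0")
      case True
      thus ?thesis using sums_unique[OF sums] by (simp add: P_def Q_def)
    next
      case False
      hence "summable (\<lambda>k. gauss_term x y z k * (Gamma (r + of_nat k) * Gamma (r + d - c + of_nat k)
          * rGamma (r + f - c + of_nat k) * rGamma (r + g - c + of_nat k)))"
        using sums_summable[OF sums] by (simp only: summable_cmult_iff) simp
      thus ?thesis using sums_unique[OF sums] by (simp add: P_def Q_def suminf_mult)
    qed
  qed
  have first: "(\<Sum>k. gauss_term a b e k * (Gamma (c + of_nat k) * Gamma (c + d - c + of_nat k)
          * rGamma (c + f - c + of_nat k) * rGamma (c + g - c + of_nat k))) = Gamma c * Gamma d * Phi a b c d e f g"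
    using gauss_term_Gamma_sum[of c d e f g a b] bal pos by (simp add: Re_pos_not_nonpos_Int)
  have second: "(\<Sum>k. gauss_term (1 + a - e) (1 + b - e) (2 - e) k * (Gamma (c + 1 - e + of_nat k) * Gamma (c + 1 - e + d - c + of_nat k)
          * rGamma (c + 1 - e + f - c + of_nat k) * rGamma (c + 1 - e + g - c + of_nat k)))
      = Gamma (1 + c - e) * Gamma (1 + d - e)
        * Phi (1 + a - e) (1 + b - e) (1 + c - e) (1 + d - e) (2 - e) (1 + f - e) (1 + g - e)"
  proof -
    have s1: "c + 1 - e + w - c = 1 + w - e" for w by simp
    have s2: "c + 1 - e = 1 + c - e" by simp
    show ?thesis unfolding s1 unfolding s2
      by (rule gauss_term_Gamma_sum) (use bal pos in \<open>auto intro!: Re_pos_not_nonpos_Int simp: algebra_simps\<close>)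
  qed
  have Gr: "Gamma z * rGamma z = 1" if "Re z > 0" for z :: complex
    using Re_pos_not_nonpos_Int[OF that] by (simp add: rGamma_inverse_Gamma Gamma_eq_zero_iff)
  have o1: "rGamma (1 + a' - e') * rGamma (1 + b' - e') * double_beta_series a b e a' b' e' c
      - rGamma a' * rGamma b' * double_beta_series a b e (1 + a' - e') (1 + b' - e') (2 - e') (c + 1 - e')
      = \<kappa> * (Gamma c * Gamma d * Phi a b c d e f g)"
    using outer[of a b e c] pos unfolding first by simp
  have o2: "rGamma (1 + a' - e') * rGamma (1 + b' - e') * double_beta_series (1 + a - e) (1 + b - e) (2 - e) a' b' e' (c + 1 - e)
      - rGamma a' * rGamma b' * double_beta_series (1 + a - e) (1 + b - e) (2 - e) (1 + a' - e') (1 + b' - e') (2 - e') (c + 1 - e + 1 - e')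
      = \<kappa> * (Gamma (1 + c - e) * Gamma (1 + d - e)
        * Phi (1 + a - e) (1 + b - e) (1 + c - e) (1 + d - e) (2 - e) (1 + f - e) (1 + g - e))"
    using outer[of "1 + a - e" "1 + b - e" "2 - e" "c + 1 - e"] pos unfolding second by (simp add: algebra_simps)
  have "connected_double_series a b e a' b' e' c
      = rGamma (1 + a - e) * rGamma (1 + b - e) * (\<kappa> * (Gamma c * Gamma d * Phi a b c d e f g))
        - rGamma a * rGamma b * (\<kappa> * (Gamma (1 + c - e) * Gamma (1 + d - e)
        * Phi (1 + a - e) (1 + b - e) (1 + c - e) (1 + d - e) (2 - e) (1 + f - e) (1 + g - e)))"
    unfolding connected_double_series_def using o1 o2 by algebra
  also have "\<dots> = \<kappa> * (Gamma c * Gamma d * Gamma (1 + c - e) * Gamma (1 + d - e) * L_star a b c d e f g)"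
    unfolding L_star_def A_def using Gr[OF pos(1)] Gr[OF pos(2)] Gr[OF pos(3)] Gr[OF pos(4)] by algebra
  finally show ?thesis by (simp add: \<kappa>_def a'_def b'_def e'_def)
qed

text \<open>For the parameters on the right the associated second triple is (a, b, e) again, so both
  sides come from evaluating the same symmetric double series.\<close>

lemma L_star_swap:
  assumes \<gamma>: "0 < Re (1 + a + b - e)" "Re (1 + a + b - e) < 1"
    and bal: "e + f + g - a - b - c - d = 1"
    and pos: "Re c > 0" "Re d > 0" "Re (1 + c - e) > 0" "Re (1 + d - e) > 0"
  shows "sin_pi (1 + c - d) * L_star a b c d e f g
     = sin_pi e * L_star (f - d) (g - d) c (1 + c - e) (1 + c - d) (1 + a + c - e) (1 + b + c - e)"
proof -
  define \<kappa> where "\<kappa> = rGamma (1 + a + b - e) * (Gamma c * Gamma d * Gamma (1 + c - e) * Gamma (1 + d - e)) / of_real pi"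
  have \<gamma>': "1 + (f - d) + (g - d) - (1 + c - d) = 1 + a + b - e" using bal by (simp add: algebra_simps)
  have "\<kappa> \<noteq> 0"
    using pos \<gamma>(1) Re_pos_not_nonpos_Int unfolding \<kappa>_def by (simp add: Gamma_eq_zero_iff rGamma_eq_zero_iff)
  have "connected_double_series a b e (f - d) (g - d) (1 + c - d) c
     = rGamma (1 + a + b - e) * (sin_pi (1 + c - d) / of_real pi)
       * (Gamma c * Gamma d * Gamma (1 + c - e) * Gamma (1 + d - e) * L_star a b c d e f g)"
    by (rule connected_double_series_eq[OF \<gamma> bal pos])
  hence "connected_double_series a b e (f - d) (g - d) (1 + c - d) c = \<kappa> * (sin_pi (1 + c - d) * L_star a b c d e f g)"
    by (simp add: \<kappa>_def mult_ac)
  moreover have "connected_double_series (f - d) (g - d) (1 + c - d) (1 + a + c - e - (1 + c - e)) (1 + b + c - e - (1 + c - e)) (1 + c - (1 + c - e)) c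
     = rGamma (1 + (f - d) + (g - d) - (1 + c - d)) * (sin_pi (1 + c - (1 + c - e)) / of_real pi)
       * (Gamma c * Gamma (1 + c - e) * Gamma (1 + c - (1 + c - d)) * Gamma (1 + (1 + c - e) - (1 + c - d))
          * L_star (f - d) (g - d) c (1 + c - e) (1 + c - d) (1 + a + c - e) (1 + b + c - e))"
    by (rule connected_double_series_eq; (unfold \<gamma>')?; use \<gamma> bal pos in \<open>simp add: algebra_simps\<close>)
  hence "connected_double_series (f - d) (g - d) (1 + c - d) a b e c
     = \<kappa> * (sin_pi e * L_star (f - d) (g - d) c (1 + c - e) (1 + c - d) (1 + a + c - e) (1 + b + c - e))"
    unfolding \<gamma>' by (simp add: \<kappa>_def algebra_simps)
  ultimately have "\<kappa> * (sin_pi (1 + c - d) * L_star a b c d e f g)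
     = \<kappa> * (sin_pi e * L_star (f - d) (g - d) c (1 + c - e) (1 + c - d) (1 + a + c - e) (1 + b + c - e))"
    using connected_double_series_commute[OF \<gamma> \<gamma>', of c] by (simp only:)
  thus ?thesis using \<open>\<kappa> \<noteq> 0\<close> by simp
qed

section \<open>Values of the bilateral Saalschuetzian series\<close>

definition saal_series ::
  "complex \<Rightarrow> complex \<Rightarrow> complex \<Rightarrow> complex \<Rightarrow> complex \<Rightarrow> complex \<Rightarrow> complex \<Rightarrow> complex \<Rightarrow> complex" where
  "saal_series a b c d e f g = bilateral_series (\<lambda>i. [a, b, c, d] ! i) (\<lambda>i. [1, e, f, g] ! i)"

lemma bilateral_series_cong:
  assumes "\<And>t. bilateral_term u l t = bilateral_term u' l' t"
  shows "bilateral_series u l = bilateral_series u' l'"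
proof -
  have "bilateral_term (\<lambda>i. 1 - l i) (\<lambda>i. 1 - u i) t = bilateral_term (\<lambda>i. 1 - l' i) (\<lambda>i. 1 - u' i) t" for t
    by (simp add: bilateral_term_reflect assms)
  thus ?thesis by (intro ext) (simp add: bilateral_series_def half_series_def assms)
qed

lemma bilateral_term_4:
  "bilateral_term (\<lambda>i. [a, b, c, d] ! i) (\<lambda>i. [h, e, f, g] ! i) t
     = A (1 - a - t) (1 - b - t) (1 - c - t) (1 - d - t) * A (h + t) (e + t) (f + t) (g + t)"
  by (simp add: bilateral_term_def A_def prod_lessThan_4)

lemma saal_series_swap_lower: "saal_series a b c d f e g = saal_series a b c d e f g"
    "saal_series a b c d e g f = saal_series a b c d e f g"
  unfolding saal_series_def
  by (rule bilateral_series_cong, simp add: bilateral_term_4, simp add: A_def)+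

lemma rGamma_minus_of_nat: "rGamma (1 - a - of_nat n) = (- 1) ^ n * pochhammer a n * rGamma (1 - a)" for a :: complex
proof (induction n)
  case (Suc n)
  have "rGamma (1 - a - of_nat (Suc n)) = (- a - of_nat n) * rGamma (1 - a - of_nat n)"
    using rGamma_plus1[of "- a - of_nat n"] by (simp add: algebra_simps)
  thus ?case using Suc by (simp add: pochhammer_Suc algebra_simps)
qed simp

lemma A_minus_of_nat:
  "A (1 - a - of_nat n) (1 - b - of_nat n) (1 - c - of_nat n) (1 - d - of_nat n)
     = pochhammer a n * pochhammer b n * pochhammer c n * pochhammer d n * A (1 - a) (1 - b) (1 - c) (1 - d)"
proof -
  define s :: complex where "s = (- 1) ^ n"
  have "s * s = 1" by (simp add: s_def flip: power_mult_distrib)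
  hence "s * pa * ra * (s * pb * rb) * (s * pc * rc) * (s * pd * rd) = pa * pb * pc * pd * (ra * rb * rc * rd)"
    for pa ra pb rb pc rc pd rd by algebra
  thus ?thesis unfolding A_def rGamma_minus_of_nat s_def by blast
qed

lemma A_Phi_term:
  "A (1 - a - of_nat n) (1 - b - of_nat n) (1 - c - of_nat n) (1 - d - of_nat n)
     * A (1 + of_nat n) (e + of_nat n) (f + of_nat n) (g + of_nat n)
   = A (1 - a) (1 - b) (1 - c) (1 - d) * Phi_term a b c d e f g n"
proof -
  have "rGamma (1 + of_nat n :: complex) = inverse (fact n)"
    by (simp add: rGamma_inverse_Gamma Gamma_fact)
  thus ?thesis
    unfolding A_minus_of_nat by (simp add: A_def Phi_term_def divide_inverse)
qed

lemma rGamma_minus_nat_zero: "rGamma (- of_nat n) = (0 :: complex)"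
  by (simp add: rGamma_eq_zero_iff)

context
  fixes a b c d e f g :: complex
  assumes bal: "e + f + g - a - b - c - d = 1"
begin

lemma saal_balanced: "(\<Sum>i<4. [1, e, f, g] ! i) - (\<Sum>i<4. [a, b, c, d] ! i) = 2"
  using bal by (simp add: sum_lessThan_4 algebra_simps)

lemma saal_series_periodic: "saal_series a b c d e f g (t + 1) = saal_series a b c d e f g t"
  unfolding saal_series_def by (rule bilateral_series_periodic[OF saal_balanced])

lemma saal_series_eq:
  "saal_series a b c d e f g t
     = (\<Sum>n. A (1 - a - (t + of_nat n)) (1 - b - (t + of_nat n)) (1 - c - (t + of_nat n)) (1 - d - (t + of_nat n))
             * A (1 + (t + of_nat n)) (e + (t + of_nat n)) (f + (t + of_nat n)) (g + (t + of_nat n)))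
       + (\<Sum>n. A (1 - a + (1 - t + of_nat n)) (1 - b + (1 - t + of_nat n)) (1 - c + (1 - t + of_nat n)) (1 - d + (1 - t + of_nat n))
             * A (1 - (1 - t + of_nat n)) (e - (1 - t + of_nat n)) (f - (1 - t + of_nat n)) (g - (1 - t + of_nat n)))"
  unfolding saal_series_def bilateral_series_def half_series_def bilateral_term_reflect bilateral_term_4
  by (simp add: algebra_simps)

text \<open>The factor 1/Gamma(1+t) removes all terms at negative integers.\<close>

lemma saal_series_0: "saal_series a b c d e f g 0 = A (1 - a) (1 - b) (1 - c) (1 - d) * Phi a b c d e f g"
proof -
  have "summable (Phi_term a b c d e f g)" using Phi_summable[OF bal] by (rule summable_norm_cancel)
  moreover have "A (1 - (1 - 0 + of_nat n)) y z w = 0" for n y z w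
    using rGamma_minus_nat_zero[of n] by (simp add: A_def)
  ultimately show ?thesis
    unfolding saal_series_eq add_0 A_Phi_term by (simp add: Phi_def suminf_mult)
qed

text \<open>By periodicity the sum may be started at 1-e. There 1/Gamma(e+t) takes the part of 1/n!
  and removes the other half.\<close>

lemma saal_series_lower:
  "saal_series a b c d e f g (- e) = A (e - a) (e - b) (e - c) (e - d)
     * Phi (1 + a - e) (1 + b - e) (1 + c - e) (1 + d - e) (2 - e) (1 + f - e) (1 + g - e)"
proof -
  let ?\<Phi> = "Phi_term (1 + a - e) (1 + b - e) (1 + c - e) (1 + d - e) (2 - e) (1 + f - e) (1 + g - e)"
  have "(2 - e) + (1 + f - e) + (1 + g - e) - (1 + a - e) - (1 + b - e) - (1 + c - e) - (1 + d - e) = 1"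
    using bal by (simp add: algebra_simps)
  hence summ: "summable ?\<Phi>" using Phi_summable summable_norm_cancel by blast
  have "A x (e - (1 - (1 - e) + of_nat n)) z w = 0" for n x z w
    using rGamma_minus_nat_zero[of n] by (simp add: A_def)
  moreover have "A (1 - a - (1 - e + of_nat n)) (1 - b - (1 - e + of_nat n)) (1 - c - (1 - e + of_nat n)) (1 - d - (1 - e + of_nat n))
             * A (1 + (1 - e + of_nat n)) (e + (1 - e + of_nat n)) (f + (1 - e + of_nat n)) (g + (1 - e + of_nat n))
      = A (e - a) (e - b) (e - c) (e - d) * ?\<Phi> n" for n
  proof -
    have shift: "1 - x - (1 - e + of_nat n) = 1 - (1 + x - e) - of_nat n" "e - x = 1 - (1 + x - e)"
      "e + (1 - e + of_nat n) = 1 + of_nat n" "1 + (1 - e + of_nat n) = 2 - e + of_nat n"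
      "x + (1 - e + of_nat n) = 1 + x - e + of_nat n" for x by simp_all
    have comm: "A x y z w = A y x z w" for x y z w by (simp add: A_def)
    show ?thesis
      unfolding A_Phi_term[symmetric] shift(2)
      by (subst (2) comm) (simp add: algebra_simps)
  qed
  ultimately have "saal_series a b c d e f g (1 - e) = (\<Sum>n. A (e - a) (e - b) (e - c) (e - d) * ?\<Phi> n)"
    unfolding saal_series_eq by simp
  also have "\<dots> = A (e - a) (e - b) (e - c) (e - d) * suminf ?\<Phi>"
    using summ by (rule suminf_mult)
  finally show ?thesis
    using saal_series_periodic[of "- e"] by (simp add: Phi_def)
qed

text \<open>Started at 1-a, the upward half is removed by 1/Gamma(1-a-t). The terms at -a, -a-1, ...
  remain and form a 4F3 in the reflected parameters.\<close>

lemma saal_series_upper: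
  "saal_series a b c d e f g (- a) = A (1 - a) (e - a) (f - a) (g - a)
     * Phi a (1 + a - e) (1 + a - f) (1 + a - g) (1 + a - b) (1 + a - c) (1 + a - d)"
proof -
  let ?\<Phi> = "Phi_term a (1 + a - e) (1 + a - f) (1 + a - g) (1 + a - b) (1 + a - c) (1 + a - d)"
  have "(1 + a - b) + (1 + a - c) + (1 + a - d) - a - (1 + a - e) - (1 + a - f) - (1 + a - g) = 1"
    using bal by (simp add: algebra_simps)
  hence summ: "summable ?\<Phi>" using Phi_summable summable_norm_cancel by blast
  have "A (1 - a - (1 - a + of_nat n)) y z w = 0" for n y z w
    using rGamma_minus_nat_zero[of n] by (simp add: A_def)
  moreover have "A (1 - a + (1 - (1 - a) + of_nat n)) (1 - b + (1 - (1 - a) + of_nat n)) (1 - c + (1 - (1 - a) + of_nat n)) (1 - d + (1 - (1 - a) + of_nat n))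
             * A (1 - (1 - (1 - a) + of_nat n)) (e - (1 - (1 - a) + of_nat n)) (f - (1 - (1 - a) + of_nat n)) (g - (1 - (1 - a) + of_nat n))
      = A (1 - a) (e - a) (f - a) (g - a) * ?\<Phi> n" for n
    using A_Phi_term[of a n "1 + a - e" "1 + a - f" "1 + a - g" "1 + a - b" "1 + a - c" "1 + a - d"]
    by (simp add: algebra_simps)
  ultimately have "saal_series a b c d e f g (1 - a) = (\<Sum>n. A (1 - a) (e - a) (f - a) (g - a) * ?\<Phi> n)"
    unfolding saal_series_eq by simp
  also have "\<dots> = A (1 - a) (e - a) (f - a) (g - a) * suminf ?\<Phi>"
    using summ by (rule suminf_mult)
  finally show ?thesis
    using saal_series_periodic[of "- a"] by (simp add: Phi_def)
qed

end

section \<open>Elimination identities for sinusoids\<close>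

text \<open>The letters stand for sines and cosines of pi a, pi e, pi f, pi g. Sinusoids form a
  2-dimensional space, so the values of tau at these four points are linearly dependent; this is the
  dependency whose coefficient at a contains the negative of \<open>saal_det\<close>.\<close>

lemma saal_core1:
  fixes sa ca se ce sf cf sg cg p q p' q' :: complex
  defines "\<tau> \<equiv> \<lambda>s c. q * c - p * s" and "\<nu> \<equiv> \<lambda>s c. q' * c - p' * s"
  shows "(sg * cf - cg * sf) * ((sf * sg * (se * ca - ce * sa) * \<nu> se ce
        + (sf * ce - cf * se) * (sg * ce - cg * se) * sa * q') * \<tau> sa ca)
    = se * ((sg * cf - cg * sf) * q' * \<tau> se ce * (sf * ca - cf * sa) * (sg * ca - cg * sa)
        + (se * ca - ce * sa) * (sf * (sg * ca - cg * sa) * \<tau> sf cf * \<nu> sg cg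
            - sg * (sf * ca - cf * sa) * \<tau> sg cg * \<nu> sf cf))"
  unfolding \<tau>_def \<nu>_def by algebra

text \<open>\<open>saal_core1\<close> with tau = nu, divided by sin(g-f): the last two products then
  combine through sin f sin(g-a) - sin g sin(f-a) = sin a sin(g-f).\<close>

lemma saal_core2:
  fixes sa ca se ce sf cf sg cg p' q' :: complex
  defines "\<nu> \<equiv> \<lambda>s c. q' * c - p' * s"
  shows "se * (q' * \<nu> se ce * (sf * ca - cf * sa) * (sg * ca - cg * sa)
        + sa * (se * ca - ce * sa) * \<nu> sf cf * \<nu> sg cg)
    = \<nu> sa ca * (sf * sg * (se * ca - ce * sa) * \<nu> se ce
        + (sf * ce - cf * se) * (sg * ce - cg * se) * sa * q')"
  unfolding \<nu>_def by algebra

section \<open>Continuation of the two-term relation and inversion of L\<close>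

lemma Phi_perm:
  "Phi b a c d e f g = Phi a b c d e f g" "Phi a c b d e f g = Phi a b c d e f g" "Phi a b d c e f g = Phi a b c d e f g"
  "Phi a b c d f e g = Phi a b c d e f g" "Phi a b c d e g f = Phi a b c d e f g"
  by (simp_all add: Phi_def Phi_term_def mult_ac)

lemma A_perm: "A b a c d = A a b c d" "A a c b d = A a b c d" "A a b d c = A a b c d"
  by (simp_all add: A_def mult_ac)

lemma L_star_perm:
  "L_star b a c d e f g = L_star a b c d e f g" "L_star a c b d e f g = L_star a b c d e f g"
  "L_star a b d c e f g = L_star a b c d e f g" "L_star a b c d e g f = L_star a b c d e f g"
  unfolding L_star_def
  by (simp_all only: Phi_perm(1) A_perm(1) Phi_perm(2)[of a c] A_perm(2)[of _ "1 + c - e"] A_perm(2)[of a c]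
      Phi_perm(2)[of "1 + a - e" "1 + c - e"] Phi_perm(3)[of a b d c] Phi_perm(3)[of _ _ "1 + d - e" "1 + c - e"]
      A_perm(3)[of a b d c] A_perm(3)[of _ _ "1 + d - e" "1 + c - e"] Phi_perm(5)[of _ _ _ _ _ g f]
      Phi_perm(5)[of _ _ _ _ _ "1 + g - e" "1 + f - e"]
      Phi_perm(1)[of b a] A_perm(1)[of b a] Phi_perm(1)[of "1 + b - e"] A_perm(1)[of "1 + b - e"])

lemma A_holomorphic:
  assumes "x holomorphic_on UNIV" "y holomorphic_on UNIV" "z holomorphic_on UNIV" "w holomorphic_on UNIV"
  shows "(\<lambda>s. A (x s) (y s) (z s) (w s)) holomorphic_on UNIV"
  unfolding A_def using assms by (intro holomorphic_intros) auto

lemma sin_pi_holomorphic: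
  assumes "x holomorphic_on UNIV"
  shows "(\<lambda>s. sin_pi (x s)) holomorphic_on UNIV"
  unfolding sin_pi_def using assms by (intro holomorphic_intros)

lemma L_star_holomorphic:
  assumes "a holomorphic_on UNIV" "b holomorphic_on UNIV" "c holomorphic_on UNIV" "d holomorphic_on UNIV"
      "e holomorphic_on UNIV" "f holomorphic_on UNIV" "g holomorphic_on UNIV"
    and "\<And>s. e s + f s + g s - a s - b s - c s - d s = 1"
  shows "(\<lambda>s. L_star (a s) (b s) (c s) (d s) (e s) (f s) (g s)) holomorphic_on UNIV"
  unfolding L_star_def using assms
  by (intro holomorphic_on_diff holomorphic_on_mult Phi_holomorphic A_holomorphic holomorphic_intros)
     (simp_all add: algebra_simps)

text \<open>Both sides are holomorphic along a complex line in \<open>V\<close>, so the inequalities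
  assumed in \<open>L_star_swap\<close> are only needed near one point of it.\<close>

theorem L_star_two_term:
  assumes bal: "e + f + g - a - b - c - d = 1"
  shows "sin_pi (1 + c - d) * L_star a b c d e f g
     = sin_pi e * L_star (f - d) (g - d) c (1 + c - e) (1 + c - d) (1 + a + c - e) (1 + b + c - e)"
proof -
  define line :: "complex \<Rightarrow> complex \<Rightarrow> complex \<Rightarrow> complex" where "line = (\<lambda>x y s. x + s * (y - x))"
  have line_hol: "line x y holomorphic_on UNIV" for x y
    unfolding line_def by (intro holomorphic_intros)
  \<comment> \<open>The point at s = 0 is balanced and satisfies every strict inequality of
    \<open>L_star_swap\<close>; for instance 1+a+b-e equals 1/2 there.\<close>
  define a' b' c' d' e' f' g' where defs: "a' = line (1 / 4) a" "b' = line (1 / 4) b" "c' = line (1 / 2) c"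
    "d' = line (1 / 2) d" "e' = line 1 e" "f' = line (3 / 4) f" "g' = line (3 / 4) g"
  have hol: "a' holomorphic_on UNIV" "b' holomorphic_on UNIV" "c' holomorphic_on UNIV" "d' holomorphic_on UNIV"
      "e' holomorphic_on UNIV" "f' holomorphic_on UNIV" "g' holomorphic_on UNIV"
    unfolding defs by (rule line_hol)+
  have bal': "e' s + f' s + g' s - a' s - b' s - c' s - d' s = 1" for s
  proof -
    have "e' s + f' s + g' s - a' s - b' s - c' s - d' s = 1 + s * (e + f + g - a - b - c - d - 1)"
      by (simp add: defs line_def algebra_simps)
    thus ?thesis using bal by simp
  qed
  define F where "F = (\<lambda>s. sin_pi (1 + c' s - d' s) * L_star (a' s) (b' s) (c' s) (d' s) (e' s) (f' s) (g' s))"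
  define G where "G = (\<lambda>s. sin_pi (e' s) * L_star (f' s - d' s) (g' s - d' s) (c' s) (1 + c' s - e' s)
      (1 + c' s - d' s) (1 + a' s + c' s - e' s) (1 + b' s + c' s - e' s))"
  have F_hol: "F holomorphic_on UNIV"
    unfolding F_def using hol bal'
    by (intro holomorphic_on_mult sin_pi_holomorphic L_star_holomorphic holomorphic_intros)
  have G_hol: "G holomorphic_on UNIV"
    unfolding G_def using hol
  proof (intro holomorphic_on_mult sin_pi_holomorphic L_star_holomorphic holomorphic_intros)
    show "1 + c' s - d' s + (1 + a' s + c' s - e' s) + (1 + b' s + c' s - e' s) - (f' s - d' s) - (g' s - d' s)
        - c' s - (1 + c' s - e' s) = 1" for s
      using bal'[of s] by algebra
  qed
  define U where "U = {s. 0 < Re (1 + a' s + b' s - e' s)} \<inter> {s. Re (1 + a' s + b' s - e' s) < 1}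
      \<inter> {s. Re (c' s) > 0} \<inter> {s. Re (d' s) > 0} \<inter> {s. Re (1 + c' s - e' s) > 0} \<inter> {s. Re (1 + d' s - e' s) > 0}"
  have cont: "continuous_on UNIV a'" "continuous_on UNIV b'" "continuous_on UNIV c'" "continuous_on UNIV d'"
      "continuous_on UNIV e'"
    using hol by (auto intro: holomorphic_on_imp_continuous_on)
  have "open U"
    unfolding U_def by (intro open_Int open_Collect_less continuous_intros cont)
  moreover have "0 \<in> U" by (simp add: U_def defs line_def)
  moreover have "F s = G s" if "s \<in> U" for s
    unfolding F_def G_def using that bal' by (intro L_star_swap) (auto simp: U_def)
  ultimately have "F 1 = G 1"
    using F_hol G_hol by (intro analytic_continuation_open[of U UNIV F G 1]) auto
  moreover have "line x y 1 = y" for x y by (simp add: line_def)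
  ultimately show ?thesis by (simp only: F_def G_def defs)
qed

text \<open>The two-term relation carries the L function of the pair {f,g} and the inverted L
  function to the same function \<open>?mid\<close>, up to permutations of its parameters. The
  factor sin pi(1+c-d), common to both applications, is then cancelled.\<close>

lemma L_star_inversion:
  assumes bal: "e + f + g - a - b - c - d = 1" and "sin_pi (1 + c - d) \<noteq> 0"
  shows "sin_pi (2 - e) * L_star (1 + a - f) (1 + b - f) (1 + c - f) (1 + d - f) (1 + g - f) (2 - f) (1 + e - f)
     = sin_pi (1 + g - f) * L_star (1 - a) (1 - b) (1 - c) (1 - d) (2 - e) (2 - f) (2 - g)"
proof -
  let ?mid = "L_star (1 - d) (e - d) (1 + c - f) (1 + c - g) (1 + c - d) (1 + e - b - d) (1 + e - a - d)"
  have fg: "g = 1 + a + b + c + d - e - f" using bal by (simp add: algebra_simps)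
  have "sin_pi (1 + (1 + c - f) - (1 + d - f))
        * L_star (1 + a - f) (1 + b - f) (1 + c - f) (1 + d - f) (1 + g - f) (2 - f) (1 + e - f)
     = sin_pi (1 + g - f) * L_star (2 - f - (1 + d - f)) (1 + e - f - (1 + d - f)) (1 + c - f) (1 + (1 + c - f) - (1 + g - f))
         (1 + (1 + c - f) - (1 + d - f)) (1 + (1 + a - f) + (1 + c - f) - (1 + g - f)) (1 + (1 + b - f) + (1 + c - f) - (1 + g - f))"
    by (rule L_star_two_term) (use bal in \<open>simp add: algebra_simps\<close>)
  moreover have "1 + (1 + c - f) - (1 + d - f) = 1 + c - d" "2 - f - (1 + d - f) = 1 - d"
    "1 + e - f - (1 + d - f) = e - d" "1 + (1 + c - f) - (1 + g - f) = 1 + c - g"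
    "1 + (1 + a - f) + (1 + c - f) - (1 + g - f) = 1 + e - b - d"
    "1 + (1 + b - f) + (1 + c - f) - (1 + g - f) = 1 + e - a - d"
    by (simp_all add: fg algebra_simps)
  ultimately have 1: "sin_pi (1 + c - d) * L_star (1 + a - f) (1 + b - f) (1 + c - f) (1 + d - f) (1 + g - f) (2 - f) (1 + e - f)
      = sin_pi (1 + g - f) * ?mid" by (simp only:)
  have "sin_pi (1 + (1 - d) - (1 - c)) * L_star (1 - a) (1 - b) (1 - d) (1 - c) (2 - e) (2 - f) (2 - g)
     = sin_pi (2 - e) * L_star (2 - f - (1 - c)) (2 - g - (1 - c)) (1 - d) (1 + (1 - d) - (2 - e))
         (1 + (1 - d) - (1 - c)) (1 + (1 - a) + (1 - d) - (2 - e)) (1 + (1 - b) + (1 - d) - (2 - e))"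
    by (rule L_star_two_term) (use bal in \<open>simp add: algebra_simps\<close>)
  moreover have "1 + (1 - d) - (1 - c) = 1 + c - d" "2 - f - (1 - c) = 1 + c - f" "2 - g - (1 - c) = 1 + c - g"
    "1 + (1 - d) - (2 - e) = e - d" "1 + (1 - a) + (1 - d) - (2 - e) = 1 + e - a - d"
    "1 + (1 - b) + (1 - d) - (2 - e) = 1 + e - b - d"
    by simp_all
  ultimately have "sin_pi (1 + c - d) * L_star (1 - a) (1 - b) (1 - d) (1 - c) (2 - e) (2 - f) (2 - g)
      = sin_pi (2 - e) * L_star (1 + c - f) (1 + c - g) (1 - d) (e - d) (1 + c - d) (1 + e - a - d) (1 + e - b - d)"
    by (simp only:)
  moreover have "L_star (1 + c - f) (1 + c - g) (1 - d) (e - d) (1 + c - d) (1 + e - a - d) (1 + e - b - d) = ?mid"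
    by (metis L_star_perm)
  moreover have "L_star (1 - a) (1 - b) (1 - d) (1 - c) (2 - e) (2 - f) (2 - g)
      = L_star (1 - a) (1 - b) (1 - c) (1 - d) (2 - e) (2 - f) (2 - g)"
    by (rule L_star_perm)
  ultimately have 2: "sin_pi (1 + c - d) * L_star (1 - a) (1 - b) (1 - c) (1 - d) (2 - e) (2 - f) (2 - g) = sin_pi (2 - e) * ?mid"
    by simp
  have "sin_pi (1 + c - d) * (sin_pi (2 - e) * L_star (1 + a - f) (1 + b - f) (1 + c - f) (1 + d - f) (1 + g - f) (2 - f) (1 + e - f))
      = sin_pi (1 + c - d) * (sin_pi (1 + g - f) * L_star (1 - a) (1 - b) (1 - c) (1 - d) (2 - e) (2 - f) (2 - g))"
    using 1 2 by algebra
  thus ?thesis using assms(2) by simp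
qed

section \<open>Trigonometric polynomials\<close>

lemma S_simps [simp]: "S [] = 1" "S (x # xs) = sin_pi x * S xs"
  by (simp_all add: S_def)

lemma cos_2pi: "cos (2 * of_real pi * t) = 1 - 2 * (sin_pi t * sin_pi t)"
  using cos_double_sin[of "of_real pi * t"] by (simp add: sin_pi_def power2_eq_square mult_ac)

lemma sin_2pi: "sin (2 * of_real pi * t) = 2 * (sin_pi t * cos_pi t)"
  using sin_double[of "of_real pi * t"] by (simp add: sin_pi_def cos_pi_def mult_ac)

text \<open>T - kappa M vanishes at 0 and is therefore divisible by sin pi t, leaving a sinusoid of
  half the frequency.\<close>

lemma trig_degree2_decompose:
  assumes "trig_degree2 T" "trig_degree2 M" "T 0 = \<kappa> * M 0"
  obtains p q where "\<And>t. T t = \<kappa> * M t + sin_pi t * (p * sin_pi t + q * cos_pi t)"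
proof -
  obtain \<alpha> \<beta> \<gamma> where T: "\<And>t. T t = \<alpha> + \<beta> * cos (2 * of_real pi * t) + \<gamma> * sin (2 * of_real pi * t)"
    using assms(1) unfolding trig_degree2_def by blast
  obtain \<alpha>' \<beta>' \<gamma>' where M: "\<And>t. M t = \<alpha>' + \<beta>' * cos (2 * of_real pi * t) + \<gamma>' * sin (2 * of_real pi * t)"
    using assms(2) unfolding trig_degree2_def by blast
  have "\<alpha> + \<beta> = \<kappa> * (\<alpha>' + \<beta>')" using assms(3) by (simp add: T M)
  hence "T t = \<kappa> * M t + sin_pi t * ((2 * (\<kappa> * \<beta>' - \<beta>)) * sin_pi t + (2 * (\<gamma> - \<kappa> * \<gamma>')) * cos_pi t)" for t
    unfolding T M cos_2pi sin_2pi by algebra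
  thus thesis by (rule that)
qed

lemma trig_degree2_sinusoids:
  "trig_degree2 (\<lambda>t. (p * sin_pi t + q * cos_pi t) * (p' * sin_pi t + q' * cos_pi t)
     - r * ((u * sin_pi t + v * cos_pi t) * (u' * sin_pi t + v' * cos_pi t)))"
proof -
  have *: "(p * sin_pi t + q * cos_pi t) * (p' * sin_pi t + q' * cos_pi t)
      = (p * p' + q * q') / 2 + (q * q' - p * p') / 2 * cos (2 * of_real pi * t) + (p * q' + q * p') / 2 * sin (2 * of_real pi * t)"
    for p q p' q' t
  proof -
    have c: "cos_pi t * cos_pi t = 1 - sin_pi t * sin_pi t" using sin_cos_pi_squared[of t] by (simp add: algebra_simps)
    have "(p * sin_pi t + q * cos_pi t) * (p' * sin_pi t + q' * cos_pi t)
        = p * p' * (sin_pi t * sin_pi t) + q * q' * (cos_pi t * cos_pi t) + (p * q' + q * p') * (sin_pi t * cos_pi t)"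
      by (simp add: algebra_simps)
    moreover have "x * ss + y * (1 - ss) + z * sc = (x + y) / 2 + (y - x) / 2 * (1 - 2 * ss) + z / 2 * (2 * sc)"
      for x y z ss sc :: complex
      by (simp add: field_simps)
    ultimately show ?thesis unfolding c cos_2pi sin_2pi by (simp only:)
  qed
  show ?thesis
    unfolding trig_degree2_def *
    by (intro exI[of _ "(p * p' + q * q') / 2 - r * ((u * u' + v * v') / 2)"]
        exI[of _ "(q * q' - p * p') / 2 - r * ((v * v' - u * u') / 2)"]
        exI[of _ "(p * q' + q * p') / 2 - r * ((u * v' + v * u') / 2)"] allI)
       (simp add: algebra_simps)
qed

lemma sin_pi_triple_product:
  "sin_pi x * sin_pi y * sin_pi z
     = (sin_pi (x + y - z) + sin_pi (x - y + z) + sin_pi (y + z - x) - sin_pi (x + y + z)) / 4"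
proof -
  have "4 * (sin_pi x * sin_pi y * sin_pi z)
     = sin_pi (x + y - z) + sin_pi (x - y + z) + sin_pi (y + z - x) - sin_pi (x + y + z)"
    unfolding sin_pi_add sin_pi_diff cos_pi_add cos_pi_diff by algebra
  hence "4 * (sin_pi x * sin_pi y * sin_pi z) / 4
     = (sin_pi (x + y - z) + sin_pi (x - y + z) + sin_pi (y + z - x) - sin_pi (x + y + z)) / 4"
    by (simp only:)
  thus ?thesis by (simp only: nonzero_mult_div_cancel_left[OF zero_neq_numeral[symmetric]])
qed

lemma sin_pi_add_1: "sin_pi (x + 1) = - sin_pi x"
  by (simp add: sin_pi_add) (simp add: sin_pi_def cos_pi_def)

text \<open>The leading frequencies of the two products cancel.\<close>

lemma sum_of_triple_products_sinusoid:
  assumes "x + y + z + 1 = x' + y' + z'"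
  obtains p q where "\<And>t. sin_pi (x + t) * sin_pi (y + t) * sin_pi (z + t)
      + sin_pi (x' + t) * sin_pi (y' + t) * sin_pi (z' + t) = p * sin_pi t + q * cos_pi t"
proof -
  define s where "s = [x + y - z, x - y + z, y + z - x, x' + y' - z', x' - y' + z', y' + z' - x']"
  have "sin_pi (x + t) * sin_pi (y + t) * sin_pi (z + t) + sin_pi (x' + t) * sin_pi (y' + t) * sin_pi (z' + t)
      = (\<Sum>w\<leftarrow>s. cos_pi w) / 4 * sin_pi t + (\<Sum>w\<leftarrow>s. sin_pi w) / 4 * cos_pi t" for t
  proof -
    have "x' + t + (y' + t) + (z' + t) = (x + t + (y + t) + (z + t)) + 1" using assms by (simp add: algebra_simps)
    hence top: "sin_pi (x' + t + (y' + t) + (z' + t)) = - sin_pi (x + t + (y + t) + (z + t))"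
      by (simp only: sin_pi_add_1)
    have lin: "x + t + (y + t) - (z + t) = (x + y - z) + t" "x + t - (y + t) + (z + t) = (x - y + z) + t"
      "y + t + (z + t) - (x + t) = (y + z - x) + t" for x y z :: complex by simp_all
    have "sin_pi (x + t) * sin_pi (y + t) * sin_pi (z + t) + sin_pi (x' + t) * sin_pi (y' + t) * sin_pi (z' + t)
        = (\<Sum>w\<leftarrow>s. sin_pi (w + t)) / 4"
      unfolding sin_pi_triple_product[of "x + t"] sin_pi_triple_product[of "x' + t"] top lin
      by (simp add: s_def add_divide_distrib diff_divide_distrib)
    also have "(\<Sum>w\<leftarrow>s. sin_pi (w + t)) = (\<Sum>w\<leftarrow>s. cos_pi w) * sin_pi t + (\<Sum>w\<leftarrow>s. sin_pi w) * cos_pi t"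
      unfolding sin_pi_add s_def by (simp only: list.map sum_list.Cons sum_list.Nil) algebra
    finally show ?thesis by (simp add: add_divide_distrib)
  qed
  thus thesis by (rule that)
qed

section \<open>The linear relation between K and two L functions\<close>

lemma sin_pi_shift: "sin_pi (1 - x) = sin_pi x" "sin_pi (2 - x) = - sin_pi x" "sin_pi (1 + x) = - sin_pi x"
proof -
  have 1: "sin_pi (1 - x) = sin_pi x" for x
    using sin_pi_add_1[of "- x"] by (simp add: add.commute)
  show "sin_pi (1 - x) = sin_pi x" by (rule 1)
  show "sin_pi (2 - x) = - sin_pi x" using sin_pi_add_1[of "1 - x"] 1[of x] by (simp add: algebra_simps)
  show "sin_pi (1 + x) = - sin_pi x" using sin_pi_add_1[of x] by (simp add: add.commute)
qed

lemma sin_pi_diff_swap: "sin_pi (x - y) = - sin_pi (y - x)"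
  using sin_pi_minus[of "y - x"] by simp

text \<open>The coefficient of K in its relation with the two L functions. It takes the same value
  at the inverted parameters, so the relations for K at both points can be compared.\<close>

definition saal_det :: "complex \<Rightarrow> complex \<Rightarrow> complex \<Rightarrow> complex \<Rightarrow> complex \<Rightarrow> complex \<Rightarrow> complex \<Rightarrow> complex" where
  "saal_det a b c d e f g = S [f, g] * S [e - a, e - b, e - c, e - d] - S [f - e, g - e] * S [a, b, c, d]"

text \<open>The function is sin(b+t) sin(c+t) sin(d+t) + sin(e-a+t) sin(f+t) sin(g+t), arguments
  times pi, evaluated at t = 0, -a, -e, -f, -g. Its values at 0 and -a are the brackets in
  \<open>B_4\<close> and \<open>B_2\<close>; at -f and -g the second product vanishes.\<close>

lemma saal_sinusoid:
  assumes bal: "e + f + g - a - b - c - d = 1"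
  obtains p q where
    "q = S [b, c, d] + S [e - a, f, g]"
    "q * cos_pi a - p * sin_pi a = S [b - a, c - a, d - a] + S [e - 2 * a, f - a, g - a]"
    "q * cos_pi e - p * sin_pi e = - (S [e - b, e - c, e - d] + S [a, f - e, g - e])"
    "q * cos_pi f - p * sin_pi f = - S [f - b, f - c, f - d]"
    "q * cos_pi g - p * sin_pi g = - S [g - b, g - c, g - d]"
proof -
  have "b + c + d + 1 = (e - a) + f + g" using bal by (simp add: algebra_simps)
  then obtain p q where pq: "\<And>t. sin_pi (b + t) * sin_pi (c + t) * sin_pi (d + t)
      + sin_pi (e - a + t) * sin_pi (f + t) * sin_pi (g + t) = p * sin_pi t + q * cos_pi t"
    by (rule sum_of_triple_products_sinusoid) blast
  have zero: "sin_pi 0 = 0" "cos_pi 0 = 1" by (simp_all add: sin_pi_def cos_pi_def)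
  show thesis
  proof (rule that)
    show "q = S [b, c, d] + S [e - a, f, g]" using pq[of 0, symmetric] zero by (simp add: mult.assoc)
    show "q * cos_pi a - p * sin_pi a = S [b - a, c - a, d - a] + S [e - 2 * a, f - a, g - a]"
      using pq[of "- a"] by (simp add: algebra_simps)
    show "q * cos_pi e - p * sin_pi e = - (S [e - b, e - c, e - d] + S [a, f - e, g - e])"
      using pq[of "- e"] by (simp add: sin_pi_diff_swap[of b e] sin_pi_diff_swap[of c e] sin_pi_diff_swap[of d e] zero)
        (simp add: algebra_simps)
    show "q * cos_pi f - p * sin_pi f = - S [f - b, f - c, f - d]"
      using pq[of "- f"] by (simp add: sin_pi_diff_swap[of b f] sin_pi_diff_swap[of c f] sin_pi_diff_swap[of d f] zero)
        (simp add: algebra_simps)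
    show "q * cos_pi g - p * sin_pi g = - S [g - b, g - c, g - d]"
      using pq[of "- g"] by (simp add: sin_pi_diff_swap[of b g] sin_pi_diff_swap[of c g] sin_pi_diff_swap[of d g] zero)
        (simp add: algebra_simps)
  qed
qed

text \<open>\<open>saal_core2\<close> for the sinusoid of \<open>saal_sinusoid\<close>. This is how
  the bracket of \<open>B_2\<close> enters the final elimination.\<close>

lemma saal_det_identity:
  assumes bal: "e + f + g - a - b - c - d = 1"
  shows "saal_det a b c d e f g * (S [b - a, c - a, d - a] + S [e - 2 * a, f - a, g - a])
     = sin_pi e * ((S [b, c, d] + S [e - a, f, g]) * (S [e - b, e - c, e - d] + S [a, f - e, g - e]) * S [f - a, g - a]
        - S [a, e - a] * S [f - b, f - c, f - d] * S [g - b, g - c, g - d])"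
proof -
  obtain p q where pq:
    "q = S [b, c, d] + S [e - a, f, g]"
    "q * cos_pi a - p * sin_pi a = S [b - a, c - a, d - a] + S [e - 2 * a, f - a, g - a]"
    "q * cos_pi e - p * sin_pi e = - (S [e - b, e - c, e - d] + S [a, f - e, g - e])"
    "q * cos_pi f - p * sin_pi f = - S [f - b, f - c, f - d]"
    "q * cos_pi g - p * sin_pi g = - S [g - b, g - c, g - d]"
    using saal_sinusoid[OF bal] by blast
  have core: "sin_pi e * (q * (q * cos_pi e - p * sin_pi e) * sin_pi (f - a) * sin_pi (g - a)
        + sin_pi a * sin_pi (e - a) * (q * cos_pi f - p * sin_pi f) * (q * cos_pi g - p * sin_pi g))
    = (q * cos_pi a - p * sin_pi a) * (sin_pi f * sin_pi g * sin_pi (e - a) * (q * cos_pi e - p * sin_pi e)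
        + sin_pi (f - e) * sin_pi (g - e) * sin_pi a * q)"
    unfolding sin_pi_diff by (rule saal_core2)
  have det: "sin_pi f * sin_pi g * sin_pi (e - a) * (q * cos_pi e - p * sin_pi e)
        + sin_pi (f - e) * sin_pi (g - e) * sin_pi a * q = - saal_det a b c d e f g"
    unfolding pq(3) by (subst pq(1)) (simp add: saal_det_def algebra_simps)
  show ?thesis
    using core unfolding det unfolding pq(2-5) unfolding pq(1) S_simps by algebra
qed

text \<open>The denominators are the values of one comparison function M at 0, -a, -e, -f, -g, up to
  sign at -a. Subtracting the multiple of M that agrees with T at 0 turns every bracket into values
  of a single sinusoid tau, and \<open>saal_core1\<close> relates these.\<close>

lemma saal_trig_relation:
  assumes bal: "e + f + g - a - b - c - d = 1" and T: "trig_degree2 T"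
    and nz: "S [a, b, c, d] \<noteq> 0" "S [e - a, e - b, e - c, e - d] \<noteq> 0"
      "S [f - a, f - b, f - c, f - d] \<noteq> 0" "S [g - a, g - b, g - c, g - d] \<noteq> 0"
  shows "sin_pi (g - f) * (saal_det a b c d e f g * (T 0 / S [a, b, c, d] + T (- a) / S [a, e - a, f - a, g - a]))
     = sin_pi (g - f) * ((S [b, c, d] + S [e - a, f, g]) * S [e - b, e - c, e - d]
         * (T 0 / S [a, b, c, d] - T (- e) / S [e - a, e - b, e - c, e - d]))
       + sin_pi e * (S [f - b, f - c, f - d] * S [g - b, g - c, g - d]
         * (T (- f) / S [f - a, f - b, f - c, f - d] - T (- g) / S [g - a, g - b, g - c, g - d]))"
proof -
  obtain p' q' where pq:
    "q' = S [b, c, d] + S [e - a, f, g]"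
    "q' * cos_pi a - p' * sin_pi a = S [b - a, c - a, d - a] + S [e - 2 * a, f - a, g - a]"
    "q' * cos_pi e - p' * sin_pi e = - (S [e - b, e - c, e - d] + S [a, f - e, g - e])"
    "q' * cos_pi f - p' * sin_pi f = - S [f - b, f - c, f - d]"
    "q' * cos_pi g - p' * sin_pi g = - S [g - b, g - c, g - d]"
    using saal_sinusoid[OF bal] by blast
  define r where "r = sin_pi a * sin_pi (e - a)"
  \<comment> \<open>With arguments times pi, sin(a+t) sin(e-a+t) - sin a sin(e-a) = sin t sin(e+t).
    Hence M(t) is the product of the sines of a+t, b+t, c+t, d+t plus the product of the sines of t,
    e+t, f+t, g+t, and balancing cancels their top frequencies.\<close>
  define M where "M = (\<lambda>t. sin_pi (a + t) * (p' * sin_pi t + q' * cos_pi t) - r * (sin_pi (f + t) * sin_pi (g + t)))"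
  have "M = (\<lambda>t. (cos_pi a * sin_pi t + sin_pi a * cos_pi t) * (p' * sin_pi t + q' * cos_pi t)
      - r * ((cos_pi f * sin_pi t + sin_pi f * cos_pi t) * (cos_pi g * sin_pi t + sin_pi g * cos_pi t)))"
    by (intro ext) (simp add: M_def sin_pi_add algebra_simps)
  hence M: "trig_degree2 M" by (simp only: trig_degree2_sinusoids)
  have zero: "sin_pi 0 = 0" "cos_pi 0 = 1" by (simp_all add: sin_pi_def cos_pi_def)
  have neg: "p' * sin_pi (- x) + q' * cos_pi (- x) = q' * cos_pi x - p' * sin_pi x" for x by simp
  have M0: "M 0 = S [a, b, c, d]"
    by (simp add: M_def zero r_def pq(1) algebra_simps)
  have Ma: "M (- a) = - S [a, e - a, f - a, g - a]"
    unfolding M_def neg pq(2) by (simp add: zero r_def)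
  have Me: "M (- e) = S [e - a, e - b, e - c, e - d]"
    unfolding M_def neg pq(3) using sin_pi_diff_swap[of a e] by (simp add: r_def algebra_simps)
  have Mf: "M (- f) = S [f - a, f - b, f - c, f - d]"
    unfolding M_def neg pq(4) using sin_pi_diff_swap[of a f] by (simp add: zero)
  have Mg: "M (- g) = S [g - a, g - b, g - c, g - d]"
    unfolding M_def neg pq(5) using sin_pi_diff_swap[of a g] by (simp add: zero)
  define \<kappa> where "\<kappa> = T 0 / S [a, b, c, d]"
  have "T 0 = \<kappa> * M 0" using nz(1) by (simp add: \<kappa>_def M0)
  then obtain p q where "\<And>t. T t = \<kappa> * M t + sin_pi t * (p * sin_pi t + q * cos_pi t)"
    using trig_degree2_decompose[OF T M] by metis
  hence T_neg: "T (- x) = \<kappa> * M (- x) - sin_pi x * (q * cos_pi x - p * sin_pi x)" for x by simp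
  define \<tau> where "\<tau> = (\<lambda>x. q * cos_pi x - p * sin_pi x)"
  have k: "T 0 / S [a, b, c, d] + T (- a) / S [a, e - a, f - a, g - a] = - \<tau> a / S [e - a, f - a, g - a]"
  proof -
    have "T (- a) / S [a, e - a, f - a, g - a] = - \<kappa> - \<tau> a / S [e - a, f - a, g - a]"
      unfolding T_neg Ma \<tau>_def using nz by (simp add: field_simps)
    thus ?thesis by (simp add: \<kappa>_def)
  qed
  have l0: "T 0 / S [a, b, c, d] - T (- e) / S [e - a, e - b, e - c, e - d]
      = sin_pi e * \<tau> e / S [e - a, e - b, e - c, e - d]"
    unfolding T_neg Me \<kappa>_def[symmetric] \<tau>_def using nz(2) by (simp add: diff_divide_distrib)
  have lf: "T (- f) / S [f - a, f - b, f - c, f - d] - T (- g) / S [g - a, g - b, g - c, g - d]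
      = sin_pi g * \<tau> g / S [g - a, g - b, g - c, g - d] - sin_pi f * \<tau> f / S [f - a, f - b, f - c, f - d]"
    unfolding T_neg Mf Mg \<tau>_def using nz(3,4) by (simp add: diff_divide_distrib)
  have core: "sin_pi (g - f) * ((sin_pi f * sin_pi g * sin_pi (e - a) * (q' * cos_pi e - p' * sin_pi e)
        + sin_pi (f - e) * sin_pi (g - e) * sin_pi a * q') * \<tau> a)
    = sin_pi e * (sin_pi (g - f) * q' * \<tau> e * sin_pi (f - a) * sin_pi (g - a)
        + sin_pi (e - a) * (sin_pi f * sin_pi (g - a) * \<tau> f * (q' * cos_pi g - p' * sin_pi g)
            - sin_pi g * sin_pi (f - a) * \<tau> g * (q' * cos_pi f - p' * sin_pi f)))"
    unfolding sin_pi_diff \<tau>_def by (rule saal_core1)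
  have det: "sin_pi f * sin_pi g * sin_pi (e - a) * (q' * cos_pi e - p' * sin_pi e)
        + sin_pi (f - e) * sin_pi (g - e) * sin_pi a * q' = - saal_det a b c d e f g"
    unfolding pq(3) by (subst pq(1)) (simp add: saal_det_def algebra_simps)
  have "sin_pi (g - f) * (saal_det a b c d e f g * (- \<tau> a / S [e - a, f - a, g - a]))
      = sin_pi e * (sin_pi (g - f) * q' * \<tau> e * sin_pi (f - a) * sin_pi (g - a)
        + sin_pi (e - a) * (- (sin_pi f * sin_pi (g - a) * \<tau> f * S [g - b, g - c, g - d])
            + sin_pi g * sin_pi (f - a) * \<tau> g * S [f - b, f - c, f - d])) / S [e - a, f - a, g - a]"
    using core unfolding det pq(4,5) by (simp add: algebra_simps)
  also have "\<dots> = sin_pi (g - f) * (q' * S [e - b, e - c, e - d]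
         * (sin_pi e * \<tau> e / S [e - a, e - b, e - c, e - d]))
       + sin_pi e * (S [f - b, f - c, f - d] * S [g - b, g - c, g - d]
         * (sin_pi g * \<tau> g / S [g - a, g - b, g - c, g - d] - sin_pi f * \<tau> f / S [f - a, f - b, f - c, f - d]))"
    using nz by (simp add: field_simps)
  finally show ?thesis unfolding k l0 lf pq(1) .
qed

text \<open>\<open>K\<close> times \<open>sin_pi a\<close>, again free of poles.\<close>

definition K_star ::
  "complex \<Rightarrow> complex \<Rightarrow> complex \<Rightarrow> complex \<Rightarrow> complex \<Rightarrow> complex \<Rightarrow> complex \<Rightarrow> complex" where
  "K_star a b c d e f g =
     Phi a b c d e f g * A a (1 + a - e) (1 + a - f) (1 + a - g)
     + Phi a (1 + a - e) (1 + a - f) (1 + a - g) (1 + a - b) (1 + a - c) (1 + a - d) * A a b c d"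

lemma A_reflection: "of_real pi ^ 4 * (A x y z w * A (1 - x) (1 - y) (1 - z) (1 - w)) = S [x, y, z, w]"
proof -
  have "A x y z w * A (1 - x) (1 - y) (1 - z) (1 - w)
      = (rGamma x * rGamma (1 - x)) * (rGamma y * rGamma (1 - y)) * (rGamma z * rGamma (1 - z)) * (rGamma w * rGamma (1 - w))"
    by (simp add: A_def mult_ac)
  thus ?thesis unfolding rGamma_reflection_sin_pi by (simp add: field_simps power4_eq_xxxx)
qed

lemma A_reflection_diff:
  "of_real pi ^ 4 * (A (x - p) (x - q) (x - r) (x - s) * A (1 + p - x) (1 + q - x) (1 + r - x) (1 + s - x))
     = S [x - p, x - q, x - r, x - s]"
  using A_reflection[of "x - p" "x - q" "x - r" "x - s"] by (simp add: algebra_simps)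

text \<open>Reflection turns the sine products under the values of T into the reciprocal Gammas of
  \<open>K_star\<close> and \<open>L_star\<close>. What is left after splitting off common Gamma
  factors are the brackets of \<open>saal_trig_relation\<close>.\<close>

lemma saal_reduction:
  assumes bal: "e + f + g - a - b - c - d = 1" and trig: "trig_degree2 (saal_series a b c d e f g)"
    and nz: "S [a, b, c, d] \<noteq> 0" "S [e - a, e - b, e - c, e - d] \<noteq> 0"
      "S [f - a, f - b, f - c, f - d] \<noteq> 0" "S [g - a, g - b, g - c, g - d] \<noteq> 0"
  obtains k l lf where
    "K_star a b c d e f g = of_real pi ^ 4 * A a b c d * A a (1 + a - e) (1 + a - f) (1 + a - g) * k"
    "L_star a b c d e f g = of_real pi ^ 4 * A a b c d * A (1 + a - e) (1 + b - e) (1 + c - e) (1 + d - e) * l"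
    "L_star (1 + a - f) (1 + b - f) (1 + c - f) (1 + d - f) (1 + g - f) (2 - f) (1 + e - f)
       = of_real pi ^ 4 * A (1 + a - f) (1 + b - f) (1 + c - f) (1 + d - f) * A (1 + a - g) (1 + b - g) (1 + c - g) (1 + d - g) * lf"
    "sin_pi (g - f) * (saal_det a b c d e f g * k)
       = sin_pi (g - f) * ((S [b, c, d] + S [e - a, f, g]) * S [e - b, e - c, e - d] * l)
         + sin_pi e * (S [f - b, f - c, f - d] * S [g - b, g - c, g - d] * lf)"
proof -
  define T where "T = saal_series a b c d e f g"
  let ?w = "of_real pi ^ 4 :: complex"
  have cancel: "w * p * r * (p' * \<phi> / s) = \<phi> * r" if "w * (p * p') = s" "s \<noteq> 0" for w p p' r \<phi> s :: complex
  proof -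
    have "w * p * r * (p' * \<phi> / s) = \<phi> * r * (w * (p * p')) / s" by simp
    thus ?thesis using that by simp
  qed
  define k where "k = T 0 / S [a, b, c, d] + T (- a) / S [a, e - a, f - a, g - a]"
  define l where "l = T 0 / S [a, b, c, d] - T (- e) / S [e - a, e - b, e - c, e - d]"
  define lf where "lf = T (- f) / S [f - a, f - b, f - c, f - d] - T (- g) / S [g - a, g - b, g - c, g - d]"
  have T0: "T 0 = A (1 - a) (1 - b) (1 - c) (1 - d) * Phi a b c d e f g"
    unfolding T_def by (rule saal_series_0[OF bal])
  have Ta: "T (- a) = A (1 - a) (e - a) (f - a) (g - a)
      * Phi a (1 + a - e) (1 + a - f) (1 + a - g) (1 + a - b) (1 + a - c) (1 + a - d)"
    unfolding T_def by (rule saal_series_upper[OF bal])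
  have Te: "T (- e) = A (e - a) (e - b) (e - c) (e - d)
      * Phi (1 + a - e) (1 + b - e) (1 + c - e) (1 + d - e) (2 - e) (1 + f - e) (1 + g - e)"
    unfolding T_def by (rule saal_series_lower[OF bal])
  have Tf: "T (- f) = A (f - a) (f - b) (f - c) (f - d)
      * Phi (1 + a - f) (1 + b - f) (1 + c - f) (1 + d - f) (2 - f) (1 + e - f) (1 + g - f)"
  proof -
    have "f + e + g - a - b - c - d = 1" using bal by (simp add: algebra_simps)
    from saal_series_lower[OF this] show ?thesis unfolding T_def by (metis saal_series_swap_lower)
  qed
  have Tg: "T (- g) = A (g - a) (g - b) (g - c) (g - d)
      * Phi (1 + a - g) (1 + b - g) (1 + c - g) (1 + d - g) (2 - g) (1 + e - g) (1 + f - g)"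
  proof -
    have "g + e + f - a - b - c - d = 1" using bal by (simp add: algebra_simps)
    from saal_series_lower[OF this] show ?thesis unfolding T_def by (metis saal_series_swap_lower)
  qed
  have r1: "?w * (A a b c d * A (1 - a) (1 - b) (1 - c) (1 - d)) = S [a, b, c, d]" by (rule A_reflection)
  have r2: "?w * (A a (1 + a - e) (1 + a - f) (1 + a - g) * A (1 - a) (e - a) (f - a) (g - a)) = S [a, e - a, f - a, g - a]"
    using A_reflection[of a "1 + a - e" "1 + a - f" "1 + a - g"] sin_pi_shift(1)[of "e - a"] sin_pi_shift(1)[of "f - a"] sin_pi_shift(1)[of "g - a"]
    by (simp add: algebra_simps)
  note r3 = A_reflection_diff[of e a b c d] and r4 = A_reflection_diff[of f a b c d] and r5 = A_reflection_diff[of g a b c d]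
  have nz2: "S [a, e - a, f - a, g - a] \<noteq> 0" using nz by simp
  have swap: "w * p * r * (x + y) = w * p * r * x + w * r * p * y" "w * p * r * (x - y) = w * p * r * x - w * r * p * y"
    for w p r x y :: complex by (simp_all add: algebra_simps)
  have K: "K_star a b c d e f g = ?w * A a b c d * A a (1 + a - e) (1 + a - f) (1 + a - g) * k"
    unfolding k_def T0 Ta swap cancel[OF r1 nz(1)] cancel[OF r2 nz2] K_star_def ..
  have r3': "?w * (A (1 + a - e) (1 + b - e) (1 + c - e) (1 + d - e) * A (e - a) (e - b) (e - c) (e - d)) = S [e - a, e - b, e - c, e - d]"
    "?w * (A (1 + a - f) (1 + b - f) (1 + c - f) (1 + d - f) * A (f - a) (f - b) (f - c) (f - d)) = S [f - a, f - b, f - c, f - d]"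
    "?w * (A (1 + a - g) (1 + b - g) (1 + c - g) (1 + d - g) * A (g - a) (g - b) (g - c) (g - d)) = S [g - a, g - b, g - c, g - d]"
    using r3 r4 r5 by (simp_all only: mult.commute)
  have L: "L_star a b c d e f g = ?w * A a b c d * A (1 + a - e) (1 + b - e) (1 + c - e) (1 + d - e) * l"
    unfolding l_def T0 Te swap cancel[OF r1 nz(1)] cancel[OF r3'(1) nz(2)] L_star_def ..
  have Lf: "L_star (1 + a - f) (1 + b - f) (1 + c - f) (1 + d - f) (1 + g - f) (2 - f) (1 + e - f)
       = ?w * A (1 + a - f) (1 + b - f) (1 + c - f) (1 + d - f) * A (1 + a - g) (1 + b - g) (1 + c - g) (1 + d - g) * lf"
  proof -
    have args: "1 + (1 + x - f) - (1 + g - f) = 1 + x - g" "2 - (1 + g - f) = 1 + f - g" "1 + (2 - f) - (1 + g - f) = 2 - g"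
      for x by simp_all
    have "Phi x y z w (1 + g - f) (2 - f) (1 + e - f) = Phi x y z w (2 - f) (1 + e - f) (1 + g - f)"
      "Phi x y z w (1 + f - g) (2 - g) (1 + e - g) = Phi x y z w (2 - g) (1 + e - g) (1 + f - g)" for x y z w
      by (metis Phi_perm(4) Phi_perm(5))+
    thus ?thesis
      unfolding lf_def Tf Tg swap cancel[OF r3'(2) nz(3)] cancel[OF r3'(3) nz(4)] L_star_def args by simp
  qed
  show thesis
    by (rule that[OF K L Lf])
       (unfold k_def l_def lf_def, rule saal_trig_relation[OF bal trig[folded T_def] nz])
qed

text \<open>The letters abbreviate the values of \<^const>\<open>A\<close> and \<^const>\<open>sin_pi\<close> in the theorem, and
  \<open>w = pi^4\<close>. Primes mark the values at the inverted parameters.\<close>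

lemma eliminate_L_functions:
  fixes w iw P Q R P1 Q1 E1 F1 F2 G1 G2 k l lf k' l' lf' :: complex
    and sa sbcd se ea eb fa fb ga gb gf D \<beta> \<beta>2 \<beta>e K K' L L' Lf Lf' B2 B4 C0 :: complex
  assumes K: "K = w * P * Q * k" and L: "L = w * P * R * l" and Lf: "Lf = w * F2 * G2 * lf"
    and rel: "gf * (D * k) = gf * (\<beta> * eb * l) + se * (fb * gb * lf)"
    and K': "K' = w * P1 * Q1 * k'" and L': "L' = w * P1 * E1 * l'" and Lf': "Lf' = w * F1 * G1 * lf'"
    and rel': "gf * (D * k') = gf * (\<beta> * eb * l') + se * (fb * gb * lf')"
    and inv: "se * Lf = gf * L'" "se * Lf' = gf * L"
    and refl: "w * (P * P1) = sa * sbcd" "w * (R * E1) = ea * eb" "w * (Q * Q1) = sa * (ea * fa * ga)"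
      "w * (F1 * F2) = fa * fb" "w * (G1 * G2) = ga * gb"
    and det: "D * \<beta>2 = se * (\<beta> * \<beta>e * (fa * ga) - sa * ea * fb * gb)" "\<beta> * eb = D + sbcd * \<beta>e"
    and w: "w * iw = 1"
    and B4: "B4 = iw * (fa * ga) * \<beta>" and B2: "B2 = iw * (fa * ga) * \<beta>2"
    and C0: "C0 = iw * ea * (sbcd * B2 + se * (fa * ga) * B4)"
    and nz: "D \<noteq> 0" "gf \<noteq> 0"
  shows "R * Q1 * B4 * se * K - ea * F1 * G1 * P * Q * se * K' - C0 * sa * L = 0"
proof -
  have wnz: "w \<noteq> 0" using w by auto
  have "w * (se * F2 * G2 * lf) = w * (gf * P1 * E1 * l')" using inv(1) unfolding Lf L' by algebra
  hence s1: "se * F2 * G2 * lf = gf * P1 * E1 * l'" using wnz by simp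
  have "w * (se * F1 * G1 * lf') = w * (gf * P * R * l)" using inv(2) unfolding Lf' L by algebra
  hence s2: "se * F1 * G1 * lf' = gf * P * R * l" using wnz by simp
  have s3: "sa * sbcd * (ea * eb) * gf * F1 * G1 * l' = P * R * se * fa * fb * ga * gb * lf"
  proof -
    have "sa * sbcd * (ea * eb) * gf * F1 * G1 * l' = w * w * P * R * F1 * G1 * (gf * P1 * E1 * l')"
      unfolding refl(1,2)[symmetric] by (simp add: mult_ac)
    also have "\<dots> = P * R * se * (w * (F1 * F2)) * (w * (G1 * G2)) * lf"
      unfolding s1[symmetric] by (simp add: mult_ac)
    finally show ?thesis unfolding refl(4,5) by (simp add: mult_ac)
  qed
  have s4: "sa * sbcd * ea * F1 * G1 * (gf * (D * k'))
      = \<beta> * P * R * se * fa * fb * ga * gb * lf + sa * sbcd * ea * fb * gb * (gf * P * R * l)"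
  proof -
    have "sa * sbcd * ea * F1 * G1 * (gf * (D * k'))
        = \<beta> * (sa * sbcd * (ea * eb) * gf * F1 * G1 * l') + sa * sbcd * ea * fb * gb * (se * F1 * G1 * lf')"
      unfolding rel' by (simp add: algebra_simps)
    thus ?thesis unfolding s3 s2 by (simp add: mult_ac)
  qed
  have t1: "w * (R * Q1 * B4 * se * K) = P * R * se * fa * ga * \<beta> * (sa * (ea * fa * ga)) * k"
  proof -
    have "w * (R * Q1 * B4 * se * K) = (w * iw) * (P * R * se * fa * ga * \<beta> * (w * (Q * Q1)) * k)"
      unfolding K B4 by (simp add: mult_ac)
    thus ?thesis unfolding w refl(3) by simp
  qed
  have t2: "w * (ea * F1 * G1 * P * Q * se * K') = ea * se * F1 * G1 * k' * (sa * sbcd) * (sa * (ea * fa * ga))"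
    unfolding K' refl(1,3)[symmetric] by (simp add: mult_ac)
  have t3: "w * (C0 * sa * L) = ea * (fa * ga) * (sbcd * \<beta>2 + se * (fa * ga) * \<beta>) * sa * P * R * l"
  proof -
    have "w * (C0 * sa * L) = (w * iw) * (w * iw) * (ea * (fa * ga) * (sbcd * \<beta>2 + se * (fa * ga) * \<beta>) * sa * P * R * l)"
      unfolding L C0 B2 B4 by (simp add: algebra_simps)
    thus ?thesis unfolding w by simp
  qed
  \<comment> \<open>After multiplication by D gf the two relations can be inserted without division.
    The terms with lf cancel, and the coefficient of l vanishes by the two identities for D.\<close>
  have "D * gf * (w * (R * Q1 * B4 * se * K - ea * F1 * G1 * P * Q * se * K' - C0 * sa * L))
      = P * R * se * fa * ga * \<beta> * (sa * (ea * fa * ga)) * (gf * (D * k))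
        - se * fa * ga * sa * ea * (sa * sbcd * ea * F1 * G1 * (gf * (D * k')))
        - ea * (fa * ga) * (sbcd * (D * \<beta>2) + se * (fa * ga) * \<beta> * D) * sa * P * R * l * gf"
    unfolding right_diff_distrib t1 t2 t3 by (simp add: algebra_simps)
  also have "\<dots> = P * R * se * fa * ga * sa * ea * gf * l
      * (\<beta> * fa * ga * (\<beta> * eb) - sa * sbcd * ea * fb * gb - sbcd * (\<beta> * \<beta>e * (fa * ga) - sa * ea * fb * gb) - fa * ga * \<beta> * D)"
    unfolding rel s4 det(1) by (simp add: algebra_simps)
  also have "\<dots> = 0" unfolding det(2) by (simp add: algebra_simps)
  finally show ?thesis using nz wnz by simp
qed

section \<open>The three-term relation\<close>

text \<open>The left-hand side of the theorem times \<open>sin_pi a * sin_pi e\<close>. It is an entire function on \<^const>\<open>V\<close>.\<close>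

definition relation_lhs ::
  "complex \<Rightarrow> complex \<Rightarrow> complex \<Rightarrow> complex \<Rightarrow> complex \<Rightarrow> complex \<Rightarrow> complex \<Rightarrow> complex" where
  "relation_lhs a b c d e f g =
     A (1 + a - e) (1 + b - e) (1 + c - e) (1 + d - e) * A (1 - a) (e - a) (f - a) (g - a)
       * B_4 (a, b, c, d, e, f, g) * sin_pi e * K_star a b c d e f g
     - sin_pi (e - a) * A (f - a) (f - b) (f - c) (f - d) * A (g - a) (g - b) (g - c) (g - d)
       * A a b c d * A a (1 + a - e) (1 + a - f) (1 + a - g) * sin_pi e
       * K_star (1 - a) (1 - b) (1 - c) (1 - d) (2 - e) (2 - f) (2 - g)
     - C (a, b, c, d, e, f, g) * sin_pi a * L_star a b c d e f g"

lemma relation_lhs_eq_0_generic: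
  assumes bal: "e + f + g - a - b - c - d = 1"
    and trig: "trig_degree2 (saal_series a b c d e f g)"
      "trig_degree2 (saal_series (1 - a) (1 - b) (1 - c) (1 - d) (2 - e) (2 - f) (2 - g))"
    and nz: "S [a, b, c, d] \<noteq> 0" "S [e - a, e - b, e - c, e - d] \<noteq> 0"
      "S [f - a, f - b, f - c, f - d] \<noteq> 0" "S [g - a, g - b, g - c, g - d] \<noteq> 0"
      "sin_pi (g - f) \<noteq> 0" "sin_pi (c - d) \<noteq> 0" "saal_det a b c d e f g \<noteq> 0"
  shows "relation_lhs a b c d e f g = 0"
proof -
  have sin_swap: "sin_pi (1 + x - y) = sin_pi (y - x)" for x y
    using sin_pi_shift(1)[of "y - x"] by (simp add: algebra_simps)
  have args: "1 + (1 - x) - (2 - y) = y - x" "2 - y - (1 - x) = 1 + x - y" "1 - (1 - x) = x" "2 - (2 - y) = y"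
    "1 + (2 - x) - (2 - y) = 1 + y - x" "2 - x - (2 - y) = y - x" "1 + (1 - x) - (1 - y) = 1 + y - x" for x y :: complex
    by simp_all
  \<comment> \<open>Inversion sends e-a to 1-(e-a), which has the same sine; the sign changes from
    f, g and from f-e, g-e come in pairs.\<close>
  have det': "saal_det (1 - a) (1 - b) (1 - c) (1 - d) (2 - e) (2 - f) (2 - g) = saal_det a b c d e f g"
    unfolding saal_det_def S_simps args sin_swap sin_pi_shift
    by (simp add: sin_pi_diff_swap[of f e] sin_pi_diff_swap[of g e])
  obtain k l lf where
    K: "K_star a b c d e f g = of_real pi ^ 4 * A a b c d * A a (1 + a - e) (1 + a - f) (1 + a - g) * k" and
    L: "L_star a b c d e f g = of_real pi ^ 4 * A a b c d * A (1 + a - e) (1 + b - e) (1 + c - e) (1 + d - e) * l" and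
    Lf: "L_star (1 + a - f) (1 + b - f) (1 + c - f) (1 + d - f) (1 + g - f) (2 - f) (1 + e - f)
       = of_real pi ^ 4 * A (1 + a - f) (1 + b - f) (1 + c - f) (1 + d - f) * A (1 + a - g) (1 + b - g) (1 + c - g) (1 + d - g) * lf" and
    rel: "sin_pi (g - f) * (saal_det a b c d e f g * k)
       = sin_pi (g - f) * ((S [b, c, d] + S [e - a, f, g]) * S [e - b, e - c, e - d] * l)
         + sin_pi e * (S [f - b, f - c, f - d] * S [g - b, g - c, g - d] * lf)"
    by (rule saal_reduction[OF bal trig(1) nz(1-4)])
  have bal': "(2 - e) + (2 - f) + (2 - g) - (1 - a) - (1 - b) - (1 - c) - (1 - d) = 1"
    using bal by (simp add: algebra_simps)
  have nz': "S [1 - a, 1 - b, 1 - c, 1 - d] \<noteq> 0"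
    "S [2 - e - (1 - a), 2 - e - (1 - b), 2 - e - (1 - c), 2 - e - (1 - d)] \<noteq> 0"
    "S [2 - f - (1 - a), 2 - f - (1 - b), 2 - f - (1 - c), 2 - f - (1 - d)] \<noteq> 0"
    "S [2 - g - (1 - a), 2 - g - (1 - b), 2 - g - (1 - c), 2 - g - (1 - d)] \<noteq> 0"
    using nz unfolding S_simps args sin_swap sin_pi_shift by simp_all
  obtain k' l' lf' where
    K': "K_star (1 - a) (1 - b) (1 - c) (1 - d) (2 - e) (2 - f) (2 - g)
      = of_real pi ^ 4 * A (1 - a) (1 - b) (1 - c) (1 - d) * A (1 - a) (e - a) (f - a) (g - a) * k'" and
    L': "L_star (1 - a) (1 - b) (1 - c) (1 - d) (2 - e) (2 - f) (2 - g)
      = of_real pi ^ 4 * A (1 - a) (1 - b) (1 - c) (1 - d) * A (e - a) (e - b) (e - c) (e - d) * l'" and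
    Lf': "L_star (f - a) (f - b) (f - c) (f - d) (1 + f - g) f (1 + f - e)
       = of_real pi ^ 4 * A (f - a) (f - b) (f - c) (f - d) * A (g - a) (g - b) (g - c) (g - d) * lf'" and
    rel': "sin_pi (f - g) * (saal_det a b c d e f g * k')
       = sin_pi (f - g) * ((S [1 - b, 1 - c, 1 - d] + S [1 + a - e, 2 - f, 2 - g]) * S [1 + b - e, 1 + c - e, 1 + d - e] * l')
         + sin_pi (2 - e) * (S [1 + b - f, 1 + c - f, 1 + d - f] * S [1 + b - g, 1 + c - g, 1 + d - g] * lf')"
    using saal_reduction[OF bal' trig(2) nz'] unfolding args det' by metis
  have rel'': "sin_pi (g - f) * (saal_det a b c d e f g * k')
       = sin_pi (g - f) * ((S [b, c, d] + S [e - a, f, g]) * S [e - b, e - c, e - d] * l')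
         + sin_pi e * (S [f - b, f - c, f - d] * S [g - b, g - c, g - d] * lf')"
    using rel' unfolding S_simps sin_swap sin_pi_shift sin_pi_diff_swap[of f g] by algebra
  have inv1: "sin_pi e * L_star (1 + a - f) (1 + b - f) (1 + c - f) (1 + d - f) (1 + g - f) (2 - f) (1 + e - f)
      = sin_pi (g - f) * L_star (1 - a) (1 - b) (1 - c) (1 - d) (2 - e) (2 - f) (2 - g)"
    using L_star_inversion[OF bal] nz(6) sin_pi_diff_swap[of d c]
    unfolding sin_swap sin_pi_shift sin_pi_diff_swap[of f g] by simp
  have inv2: "sin_pi e * L_star (f - a) (f - b) (f - c) (f - d) (1 + f - g) f (1 + f - e)
      = sin_pi (g - f) * L_star a b c d e f g"
    using L_star_inversion[OF bal'] nz(6) unfolding args sin_swap by simp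
  have r1: "of_real pi ^ 4 * (A a b c d * A (1 - a) (1 - b) (1 - c) (1 - d)) = sin_pi a * S [b, c, d]"
    unfolding A_reflection S_simps ..
  have r2: "of_real pi ^ 4 * (A (1 + a - e) (1 + b - e) (1 + c - e) (1 + d - e) * A (e - a) (e - b) (e - c) (e - d))
      = sin_pi (e - a) * S [e - b, e - c, e - d]"
    using A_reflection_diff[of e a b c d] unfolding S_simps by (simp only: mult.commute)
  have r3: "of_real pi ^ 4 * (A a (1 + a - e) (1 + a - f) (1 + a - g) * A (1 - a) (e - a) (f - a) (g - a))
      = sin_pi a * (sin_pi (e - a) * sin_pi (f - a) * sin_pi (g - a))"
    using A_reflection[of a "1 + a - e" "1 + a - f" "1 + a - g"] unfolding S_simps sin_swap
    by (simp add: algebra_simps)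
  have r4: "of_real pi ^ 4 * (A (x - a) (x - b) (x - c) (x - d) * A (1 + a - x) (1 + b - x) (1 + c - x) (1 + d - x))
      = sin_pi (x - a) * S [x - b, x - c, x - d]" for x
    unfolding A_reflection_diff S_simps ..
  have det1: "saal_det a b c d e f g * (S [b - a, c - a, d - a] + S [e - 2 * a, f - a, g - a])
     = sin_pi e * ((S [b, c, d] + S [e - a, f, g]) * (S [e - b, e - c, e - d] + S [a, f - e, g - e]) * (sin_pi (f - a) * sin_pi (g - a))
        - sin_pi a * sin_pi (e - a) * S [f - b, f - c, f - d] * S [g - b, g - c, g - d])"
    using saal_det_identity[OF bal] by simp
  have det2: "(S [b, c, d] + S [e - a, f, g]) * S [e - b, e - c, e - d]
      = saal_det a b c d e f g + S [b, c, d] * (S [e - b, e - c, e - d] + S [a, f - e, g - e])"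
    by (simp add: saal_det_def algebra_simps)
  have w: "of_real pi ^ 4 * (1 / of_real pi ^ 4) = (1 :: complex)" by simp
  show ?thesis
    unfolding relation_lhs_def
    by (rule eliminate_L_functions[OF K L Lf rel K' L' Lf' rel'' inv1 inv2 r1 r2 r3 r4 r4 det1 det2 w _ _ _ nz(7) nz(5),
          where ?B2.0 = "B_2 (a, b, c, d, e, f, g)"])
       (simp_all add: mult_ac)
qed

text \<open>The lower parameters g, 1, e, f are paired with a, c, d, b. The pair with difference at
  least 1 goes to index 0, where the growth estimate expects it.\<close>

lemma saal_series_trig_degree2:
  fixes a b c d e f g :: real
  assumes "a + 1 \<le> g" "c \<le> 1" "d \<le> e" "b \<le> f" and bal: "e + f + g - a - b - c - d = 1"
  shows "trig_degree2 (saal_series a b c d e f g)"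
proof -
  define u where "u = (\<lambda>i. [a, c, d, b] ! i)"
  define l where "l = (\<lambda>i. [g, 1, e, f] ! i)"
  have "trig_degree2 (bilateral_series (\<lambda>i. u i) (\<lambda>i. l i))"
  proof (rule bilateral_series_trig_degree2)
    show "u i \<le> l i" if "i < 4" for i
      using less_4_cases[OF that] assms by (auto simp: u_def l_def)
    show "u 0 + 1 \<le> l 0" using assms by (simp add: u_def l_def)
    show "(\<Sum>i<4. l i) - (\<Sum>i<4. u i) = 2" using bal by (simp add: u_def l_def sum_lessThan_4)
  qed
  moreover have "bilateral_series (\<lambda>i. u i) (\<lambda>i. l i) = saal_series a b c d e f g"
    unfolding saal_series_def
    by (rule bilateral_series_cong) (simp add: bilateral_term_def prod_lessThan_4 u_def l_def)
  ultimately show ?thesis by simp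
qed

lemma saal_series_perm:
  "saal_series b d a c f g e = saal_series a b c d e f g"
  unfolding saal_series_def
  by (rule bilateral_series_cong) (simp add: bilateral_term_def prod_lessThan_4)

lemma sin_pi_of_real: "sin_pi (of_real x) = of_real (sin (pi * x))"
  by (simp add: sin_pi_def flip: sin_of_real)

lemma sin_pi_real_pos: "0 < x \<Longrightarrow> x < 1 \<Longrightarrow> sin (pi * x) > 0" for x :: real
  using mult_strict_left_mono[of x 1 pi] by (intro sin_gt_zero) auto

lemma sin_pi_real_neg: "1 < x \<Longrightarrow> x < 2 \<Longrightarrow> sin (pi * x) < 0" for x :: real
  using mult_strict_left_mono[of 1 x pi] mult_strict_left_mono[of x 2 pi] by (intro sin_lt_zero) auto

lemma sin_pi_real_neg': "- 1 < x \<Longrightarrow> x < 0 \<Longrightarrow> sin (pi * x) < 0" for x :: real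
  using sin_pi_real_pos[of "- x"] by simp

text \<open>The centre of the box is chosen such that the lower and upper parameters can be paired as
  \<open>saal_series_trig_degree2\<close> requires, both here and after inversion, and such that both summands of
  \<^const>\<open>saal_det\<close> are negative.\<close>

lemma relation_lhs_eq_0_box:
  fixes a b c d e f g :: real
  assumes box: "\<bar>a - 1 / 5\<bar> < 1 / 200" "\<bar>b - 37 / 40\<bar> < 1 / 200" "\<bar>c - 13 / 20\<bar> < 1 / 200"
      "\<bar>d - 19 / 40\<bar> < 1 / 200" "\<bar>e - 33 / 40\<bar> < 1 / 200" "\<bar>f - 11 / 10\<bar> < 1 / 200"
    and g: "g = 1 + a + b + c + d - e - f"
  shows "relation_lhs a b c d e f g = 0"
proof (rule relation_lhs_eq_0_generic)
  have box': "a - 1 / 5 < 1 / 200" "1 / 5 - a < 1 / 200" "b - 37 / 40 < 1 / 200" "37 / 40 - b < 1 / 200"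
    "c - 13 / 20 < 1 / 200" "13 / 20 - c < 1 / 200" "d - 19 / 40 < 1 / 200" "19 / 40 - d < 1 / 200"
    "e - 33 / 40 < 1 / 200" "33 / 40 - e < 1 / 200" "f - 11 / 10 < 1 / 200" "11 / 10 - f < 1 / 200"
    using box by linarith+
  have bal: "e + f + g - a - b - c - d = 1" using g by simp
  show "complex_of_real e + f + g - a - b - c - d = 1"
    using arg_cong[OF bal, of complex_of_real] by simp
  show "trig_degree2 (saal_series a b c d e f g)"
    by (rule saal_series_trig_degree2) (use box' g in linarith)+
  \<comment> \<open>After inversion the pairing is a different one: the difference of at least 1
    lies between 1-b and 2-e, while 1, 2-f, 2-g go with 1-a, 1-c, 1-d.\<close>
  have "trig_degree2 (saal_series (1 - of_real b) (1 - of_real d) (1 - of_real a) (1 - of_real c)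
      (2 - of_real f) (2 - of_real g) (2 - of_real e))"
    using saal_series_trig_degree2[of "1 - b" "2 - e" "1 - a" "1 - c" "2 - f" "1 - d" "2 - g"] box' g by simp
  thus "trig_degree2 (saal_series (1 - of_real a) (1 - of_real b) (1 - of_real c) (1 - of_real d)
      (2 - of_real e) (2 - of_real f) (2 - of_real g))"
    by (subst (asm) saal_series_perm)
  have pos: "sin (pi * x) > 0" if "x \<in> {a, b, c, d, e - a, e - c, e - d, f - a, f - b, f - c, f - d,
      g - b, g - c, g - d, g - f, c - d, f - e, g - e}" for x
    using that box' g by (intro sin_pi_real_pos) auto
  have neg: "sin (pi * x) < 0" if "x \<in> {g - a, f, g}" for x
    using that box' g by (intro sin_pi_real_neg) auto
  have neg': "sin (pi * (e - b)) < 0"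
    using box' by (intro sin_pi_real_neg') linarith+
  note sin_of_real_diff = sin_pi_of_real[of "x - y" for x y, unfolded of_real_diff]
  have nz: "sin (pi * x) \<noteq> 0" if "x \<in> {a, b, c, d, e - a, e - b, e - c, e - d, f - a, f - b, f - c, f - d,
      g - a, g - b, g - c, g - d, g - f, c - d}" for x
    using that pos[of x] neg[of x] neg' by auto
  show "S [of_real a, of_real b, of_real c, of_real d] \<noteq> 0"
    "S [of_real e - of_real a, of_real e - of_real b, of_real e - of_real c, of_real e - of_real d] \<noteq> 0"
    "S [of_real f - of_real a, of_real f - of_real b, of_real f - of_real c, of_real f - of_real d] \<noteq> 0"
    "S [of_real g - of_real a, of_real g - of_real b, of_real g - of_real c, of_real g - of_real d] \<noteq> 0"
    "sin_pi (of_real g - of_real f) \<noteq> 0" "sin_pi (of_real c - of_real d) \<noteq> 0"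
    unfolding S_simps sin_of_real_diff sin_pi_of_real using nz by simp_all
  define X where "X = sin (pi * f) * sin (pi * g) * (sin (pi * (e - a)) * sin (pi * (e - b)) * (sin (pi * (e - c)) * sin (pi * (e - d))))"
  define Y where "Y = sin (pi * (f - e)) * sin (pi * (g - e)) * (sin (pi * a) * sin (pi * b) * (sin (pi * c) * sin (pi * d)))"
  have "sin (pi * f) * sin (pi * g) > 0" by (intro mult_neg_neg neg) auto
  moreover have "sin (pi * (e - a)) * sin (pi * (e - b)) < 0" by (intro mult_pos_neg pos neg') auto
  moreover have "sin (pi * (e - c)) * sin (pi * (e - d)) > 0" by (intro mult_pos_pos pos) auto
  ultimately have "X < 0" unfolding X_def by (rule mult_pos_neg[OF _ mult_neg_pos])
  moreover have "Y > 0"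
    unfolding Y_def by (intro mult_pos_pos pos) auto
  moreover have "saal_det a b c d e f g = of_real (X - Y)"
    unfolding saal_det_def S_simps sin_of_real_diff sin_pi_of_real X_def Y_def by (simp add: mult.assoc)
  ultimately show "saal_det a b c d e f g \<noteq> 0" by (simp del: of_real_diff)
qed

section \<open>Continuation from the real box\<close>

lemma K_star_holomorphic:
  assumes "a holomorphic_on UNIV" "b holomorphic_on UNIV" "c holomorphic_on UNIV" "d holomorphic_on UNIV"
      "e holomorphic_on UNIV" "f holomorphic_on UNIV" "g holomorphic_on UNIV"
    and "\<And>s. e s + f s + g s - a s - b s - c s - d s = 1"
  shows "(\<lambda>s. K_star (a s) (b s) (c s) (d s) (e s) (f s) (g s)) holomorphic_on UNIV"
  unfolding K_star_def using assms
  by (intro holomorphic_on_add holomorphic_on_mult Phi_holomorphic A_holomorphic holomorphic_intros)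
     (simp_all add: algebra_simps)

lemma relation_lhs_holomorphic:
  assumes hol: "a holomorphic_on UNIV" "b holomorphic_on UNIV" "c holomorphic_on UNIV" "d holomorphic_on UNIV"
      "e holomorphic_on UNIV" "f holomorphic_on UNIV" "g holomorphic_on UNIV"
    and bal: "\<And>s. e s + f s + g s - a s - b s - c s - d s = 1"
  shows "(\<lambda>s. relation_lhs (a s) (b s) (c s) (d s) (e s) (f s) (g s)) holomorphic_on UNIV"
proof -
  have K: "(\<lambda>s. K_star (1 - a s) (1 - b s) (1 - c s) (1 - d s) (2 - e s) (2 - f s) (2 - g s)) holomorphic_on UNIV"
  proof (intro K_star_holomorphic holomorphic_intros hol)
    show "2 - e s + (2 - f s) + (2 - g s) - (1 - a s) - (1 - b s) - (1 - c s) - (1 - d s) = 1" for s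
      using bal[of s] by algebra
  qed
  show ?thesis
    unfolding relation_lhs_def B_4.simps C.simps B_2.simps S_simps
    by (intro holomorphic_on_add holomorphic_on_diff holomorphic_on_mult holomorphic_on_const K
        K_star_holomorphic[OF hol bal] L_star_holomorphic[OF hol bal] A_holomorphic sin_pi_holomorphic
        hol holomorphic_on_power holomorphic_on_divide) auto
qed

lemma entire_eq_0_of_real_interval:
  fixes F :: "complex \<Rightarrow> complex"
  assumes "F holomorphic_on UNIV" "\<epsilon> > 0" "\<And>x::real. \<bar>x\<bar> < \<epsilon> \<Longrightarrow> F (of_real x) = 0"
  shows "F z = 0"
proof (rule analytic_continuation[where f = F and S = UNIV and U = "of_real ` {- \<epsilon><..<\<epsilon>}" and \<xi> = 0])
  have "(0::complex) islimpt of_real ` {- \<epsilon><..<\<epsilon>}"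
    unfolding islimpt_approachable
  proof (intro allI impI)
    fix \<delta> :: real assume "\<delta> > 0"
    define x where "x = min \<delta> \<epsilon> / 2"
    have "0 < x" "x < \<delta>" "x < \<epsilon>" using \<open>\<delta> > 0\<close> assms(2) by (auto simp: x_def)
    thus "\<exists>x'\<in>of_real ` {- \<epsilon><..<\<epsilon>}. x' \<noteq> (0::complex) \<and> dist x' 0 < \<delta>"
      by (intro bexI[of _ "of_real x"]) auto
  qed
  thus "(0::complex) islimpt of_real ` {- \<epsilon><..<\<epsilon>}" .
qed (use assms in auto)

lemma relation_lhs_eq_0:
  assumes bal: "e + f + g - a - b - c - d = 1"
  shows "relation_lhs a b c d e f g = 0"
proof -
  text \<open>A complex parameter \<open>z\<close> is reached from the real base point \<open>x\<close> through \<open>s = 1\<close>, \<open>r = \<i>\<close>;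
    real \<open>s\<close> and \<open>r\<close> keep the parameters real.\<close>
  define line where "line = (\<lambda>(x::real) (z::complex) (s::complex) (r::complex). of_real x + s * of_real (Re z - x) + r * of_real (Im z))"
  define a' b' c' d' e' f' where defs: "a' = line (1 / 5) a" "b' = line (37 / 40) b" "c' = line (13 / 20) c"
    "d' = line (19 / 40) d" "e' = line (33 / 40) e" "f' = line (11 / 10) f"
  define F where "F = (\<lambda>s r. relation_lhs (a' s r) (b' s r) (c' s r) (d' s r) (e' s r) (f' s r)
      (1 + a' s r + b' s r + c' s r + d' s r - e' s r - f' s r))"
  have F_hol: "(\<lambda>s. F s r) holomorphic_on UNIV" "(\<lambda>r. F s r) holomorphic_on UNIV" for s r
    unfolding F_def defs line_def
    by (intro relation_lhs_holomorphic holomorphic_intros; simp)+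
  define B where "B = (\<lambda>x z. \<bar>Re z - x\<bar> + \<bar>Im z\<bar>)"
  define M where "M = 1 + B (1 / 5) a + B (37 / 40) b + B (13 / 20) c + B (19 / 40) d + B (33 / 40) e + B (11 / 10) f"
  have B_nonneg: "B x z \<ge> 0" for x z by (simp add: B_def)
  have "M > 0" using B_nonneg unfolding M_def by (intro add_pos_nonneg) auto
  \<comment> \<open>Chosen so that epsilon M is the radius 1/200 of the box; M exceeds every
    displacement \<open>B x z\<close> in question by at least 1.\<close>
  define \<epsilon> where "\<epsilon> = 1 / (200 * M)"
  have "\<epsilon> > 0" using \<open>M > 0\<close> by (simp add: \<epsilon>_def)
  have near: "\<bar>x + s * (Re z - x) + r * Im z - x\<bar> < 1 / 200"
    if "\<bar>s\<bar> < \<epsilon>" "\<bar>r\<bar> < \<epsilon>" "B x z \<le> M - 1" for x s r :: real and z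
  proof -
    have "\<bar>s * (Re z - x) + r * Im z\<bar> \<le> \<bar>s\<bar> * \<bar>Re z - x\<bar> + \<bar>r\<bar> * \<bar>Im z\<bar>"
      by (metis abs_mult abs_triangle_ineq)
    also have "\<dots> \<le> \<epsilon> * \<bar>Re z - x\<bar> + \<epsilon> * \<bar>Im z\<bar>"
      using that by (intro add_mono mult_right_mono) auto
    also have "\<dots> = \<epsilon> * B x z" by (simp add: B_def distrib_left)
    also have "\<dots> < \<epsilon> * M" using that \<open>\<epsilon> > 0\<close> by (intro mult_strict_left_mono) auto
    also have "\<dots> = 1 / 200" using \<open>M > 0\<close> by (simp add: \<epsilon>_def)
    finally show ?thesis by simp
  qed
  have "F (of_real s) (of_real r) = 0" if sr: "\<bar>s\<bar> < \<epsilon>" "\<bar>r\<bar> < \<epsilon>" for s r :: real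
  proof -
    have line_real: "line x z (of_real s) (of_real r) = of_real (x + s * (Re z - x) + r * Im z)" for x z
      by (simp add: line_def)
    show ?thesis
      unfolding F_def defs line_real
      using relation_lhs_eq_0_box[OF near[OF sr] near[OF sr] near[OF sr] near[OF sr] near[OF sr] near[OF sr] refl,
          of a b c d e f] B_nonneg
      by (simp add: M_def)
  qed
  \<comment> \<open>The identity theorem is applied in one variable at a time: in r for small real
    s, then in s for arbitrary r.\<close>
  hence "F (of_real s) r = 0" if "\<bar>s\<bar> < \<epsilon>" for s :: real and r
    using entire_eq_0_of_real_interval[OF F_hol(2) \<open>\<epsilon> > 0\<close>] that by blast
  hence "F s r = 0" for s r
    using entire_eq_0_of_real_interval[OF F_hol(1) \<open>\<epsilon> > 0\<close>] by blast
  hence "F 1 \<i> = 0" .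
  moreover have "line x z 1 \<i> = z" for x z
    by (simp add: line_def complex_eq_iff)
  moreover have "g = 1 + a + b + c + d - e - f" using bal by (simp add: algebra_simps)
  ultimately show ?thesis by (simp only: F_def defs)
qed

section \<open>Return from the entire functions to K and L\<close>

lemma K_eq_K_star:
  assumes "K_defined a b c d e f g" and bal: "e + f + g - a - b - c - d = 1"
  shows "K a b c d e f g = K_star a b c d e f g / sin_pi a"
proof -
  have "(1 + a - b) + (1 + a - c) + (1 + a - d) - a - (1 + a - e) - (1 + a - f) - (1 + a - g) = 1"
    using bal by (simp add: algebra_simps)
  from F43_eq_Phi[OF this] F43_eq_Phi[OF bal] show ?thesis
    using assms(1) unfolding K_def K_star_def K_defined_def A_def
    by (simp add: add_divide_distrib flip: mult.assoc) (simp add: mult_ac)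
qed

lemma L_eq_L_star:
  assumes "L_defined a b c d e f g" and bal: "e + f + g - a - b - c - d = 1"
  shows "L a b c d e f g = L_star a b c d e f g / sin_pi e"
proof -
  have "(2 - e) + (1 + f - e) + (1 + g - e) - (1 + a - e) - (1 + b - e) - (1 + c - e) - (1 + d - e) = 1"
    using bal by (simp add: algebra_simps)
  from F43_eq_Phi[OF this] F43_eq_Phi[OF bal] show ?thesis
    using assms(1) unfolding L_def L_star_def L_defined_def A_def
    by (simp add: diff_divide_distrib flip: mult.assoc) (simp add: mult_ac)
qed

theorem proposition6p15:
  fixes a b c d e f g :: complex and x :: param
  assumes x: "x = (a, b, c, d, e, f, g)" and "x \<in> V"
    and "K_p0_defined x" and "K_n0_defined x" and "L_6_defined x"
  shows
    "A (1 + a - e) (1 + b - e) (1 + c - e) (1 + d - e) * A (1 - a) (e - a) (f - a) (g - a)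
       * B_4 x * K_p0 x
     - S [e - a] * A (f - a) (f - b) (f - c) (f - d) * A (g - a) (g - b) (g - c) (g - d)
       * A a b c d * A a (1 + a - e) (1 + a - f) (1 + a - g) * K_n0 x
     - C x * L_6 x = 0"
proof -
  have bal: "e + f + g - a - b - c - d = 1" using assms(1,2) by (simp add: V_def)
  have bal': "(2 - e) + (2 - f) + (2 - g) - (1 - a) - (1 - b) - (1 - c) - (1 - d) = 1"
    using bal by (simp add: algebra_simps)
  have K: "K_p0 x = K_star a b c d e f g / sin_pi a"
    using assms bal by (simp add: K_eq_K_star)
  have K': "K_n0 x = K_star (1 - a) (1 - b) (1 - c) (1 - d) (2 - e) (2 - f) (2 - g) / sin_pi a"
    using assms bal' by (simp add: K_eq_K_star sin_pi_shift)
  have L: "L_6 x = L_star a b c d e f g / sin_pi e"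
    using assms bal by (simp add: L_eq_L_star)
  have nz: "sin_pi a \<noteq> 0" "sin_pi e \<noteq> 0"
    using assms by (simp_all add: K_defined_def L_defined_def)
  \<comment> \<open>The inverted K has denominator sin pi(1-a) = sin pi a, so sin pi a sin pi e
    clears all three terms.\<close>
  have clear: "p * (k / s) - q * (k' / s) - r * (l / t) = (p * t * k - q * t * k' - r * s * l) / (s * t)"
    if "s \<noteq> 0" "t \<noteq> 0" for p q r k k' l s t :: complex
    using that by (simp add: field_simps)
  show ?thesis
    unfolding K K' L unfolding clear[OF nz] x S_simps mult_1_right
    using relation_lhs_eq_0[OF bal] unfolding relation_lhs_def by (simp only: div_0)
qed

end
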